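(* Let $\boldsymbol\mu,\boldsymbol\kappa\in W^{1,\infty}(\Omega)$, let $\mathbf f\in L^2(\Omega)^3$, and let $\mathbf w\in H_0(\mathbf{curl};\Omega)$ be the solution of the adjoint problem $$\mathbf{curl}(\boldsymbol\mu^{-1}\mathbf{curl}\,\mathbf w)-\mathrm i\omega\boldsymbol\kappa\mathbf w=\mathbf f\ \text{ in }\Omega,\qquad\mathbf w\times\mathbf n=\mathbf 0\ \text{ on }\Gamma.$$ Then $$\boldsymbol\mu^{-1}\mathbf{curl}\,\mathbf w\in H(\mathbf{curl};\Omega)\cap H_0(\mathrm{div};\Omega).$$
   Context: $\Omega\subset\mathbb R^3$ is a bounded connected polyhedron with Lipschitz boundary $\Gamma$ and outward unit normal $\mathbf n$; functions are complex valued except the coefficients. $\boldsymbol\mu,\boldsymbol\kappa$ are real scalar functions bounded below a.e. by positive constants; $\omega\in\mathbb R\setminus\{0\}$. $H(\mathbf{curl};\Omega)=\{\mathbf v\in L^2(\Omega)^3:\mathbf{curl}\,\mathbf v\in L^2(\Omega)^3\}$; $H_0(\mathbf{curl};\Omega)$ is its subspace of fields with vanishing tangential trace $\mathbf v\times\mathbf n$ on $\Gamma$. $H(\mathrm{div};\Omega)=\{\mathbf v\in L^2(\Omega)^3:\mathrm{div}\,\mathbf v\in L^2(\Omega)\}$; $H_0(\mathrm{div};\Omega)$ is its subspace of fields with vanishing normal trace $\mathbf v\cdot\mathbf n\in H^{-1/2}(\Gamma)$. The adjoint problem is understood weakly: $\int_\Omega\boldsymbol\mu^{-1}\mathbf{curl}\,\mathbf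 w\cdot\mathbf{curl}\,\overline{\mathbf v}\,dx-\mathrm i\omega\int_\Omega\boldsymbol\kappa\mathbf w\cdot\overline{\mathbf v}\,dx=\int_\Omega\mathbf f\cdot\overline{\mathbf v}\,dx$ for all $\mathbf v\in H_0(\mathbf{curl};\Omega)$; it has a unique solution $\mathbf w\in H_0(\mathbf{curl};\Omega)$. *)

theory Defs
  imports "HOL-Analysis.Analysis"
begin

section \<open>Lipschitz polyhedra\<close>

text \<open>The closure of \<open>\<Omega>\<close> is a finite union of convex polytopes; \<open>\<Omega>\<close> itself need not be convex
  (the library predicate \<^const>\<open>polyhedron\<close> denotes convex polyhedra only).\<close>

definition polyhedral_domain :: "(real^3) set \<Rightarrow> bool" where
  "polyhedral_domain \<Omega> \<longleftrightarrow>
     open \<Omega> \<and> \<Omega> \<noteq> {} \<and> connected \<Omega> \<and> bounded \<Omega> \<and>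
     (\<exists>F. finite F \<and> (\<forall>P\<in>F. polytope P) \<and> closure \<Omega> = \<Union>F)"

text \<open>Near each boundary point, \<open>\<Omega>\<close> is the strict epigraph of a Lipschitz function over a plane
  with unit normal \<open>e\<close>; \<open>g\<close> is only evaluated on the orthogonal complement of \<open>e\<close>.\<close>

definition lipschitz_boundary :: "(real^3) set \<Rightarrow> bool" where
  "lipschitz_boundary \<Omega> \<longleftrightarrow>
     (\<forall>p\<in>frontier \<Omega>. \<exists>r>0. \<exists>e L. \<exists>g :: real^3 \<Rightarrow> real.
        norm e = 1 \<and> L-lipschitz_on UNIV g \<and>
        \<Omega> \<inter> ball p r = {x \<in> ball p r. g (x - (x \<bullet> e) *\<^sub>R e) < x \<bullet> e})"

section \<open>Test functions\<close>

definition partial_deriv :: "3 \<Rightarrow> (real^3 \<Rightarrow> 'a::real_normed_vector) \<Rightarrow> real^3 \<Rightarrow> 'a" where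
  "partial_deriv i f x = frechet_derivative f (at x) (axis i 1)"

primrec C_k :: "nat \<Rightarrow> (real^3 \<Rightarrow> 'a::real_normed_vector) \<Rightarrow> bool" where
  "C_k 0 f \<longleftrightarrow> continuous_on UNIV f"
| "C_k (Suc k) f \<longleftrightarrow> (\<forall>x. f differentiable (at x)) \<and> (\<forall>i. C_k k (partial_deriv i f))"

definition smooth :: "(real^3 \<Rightarrow> 'a::real_normed_vector) \<Rightarrow> bool" where
  "smooth f \<longleftrightarrow> (\<forall>k. C_k k f)"

definition test_functions :: "(real^3) set \<Rightarrow> (real^3 \<Rightarrow> 'a::real_normed_vector) set" where
  "test_functions \<Omega> =
     {\<phi>. smooth \<phi> \<and> compact (closure {x. \<phi> x \<noteq> 0}) \<and> closure {x. \<phi> x \<noteq> 0} \<subseteq> \<Omega>}"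

definition grad :: "(real^3 \<Rightarrow> complex) \<Rightarrow> real^3 \<Rightarrow> complex^3" where
  "grad \<phi> x = (\<chi> i. partial_deriv i \<phi> x)"

definition curl :: "(real^3 \<Rightarrow> complex^3) \<Rightarrow> real^3 \<Rightarrow> complex^3" where
  "curl \<phi> x = vector
     [partial_deriv 2 \<phi> x $ 3 - partial_deriv 3 \<phi> x $ 2,
      partial_deriv 3 \<phi> x $ 1 - partial_deriv 1 \<phi> x $ 3,
      partial_deriv 1 \<phi> x $ 2 - partial_deriv 2 \<phi> x $ 1]"

section \<open>Lebesgue and Sobolev spaces\<close>

text \<open>Elements of the spaces below are functions on the whole of \<open>\<real>\<^sup>3\<close> of which only the restriction
  to \<open>\<Omega>\<close> matters, and not classes modulo null sets; membership is invariant under changes on a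
  null set.\<close>

definition L2 :: "(real^3) set \<Rightarrow> (real^3 \<Rightarrow> 'a::real_normed_vector) set" where
  "L2 \<Omega> = {f. f \<in> borel_measurable (lebesgue_on \<Omega>) \<and>
               integrable (lebesgue_on \<Omega>) (\<lambda>x. (norm (f x))\<^sup>2)}"

definition Linf :: "(real^3) set \<Rightarrow> (real^3 \<Rightarrow> 'a::real_normed_vector) set" where
  "Linf \<Omega> = {f. f \<in> borel_measurable (lebesgue_on \<Omega>) \<and>
                 (\<exists>C. AE x in lebesgue_on \<Omega>. norm (f x) \<le> C)}"

text \<open>Bilinear product, without conjugation.\<close>

definition cdot :: "complex^3 \<Rightarrow> complex^3 \<Rightarrow> complex" (infixl "\<bullet>\<^sub>c" 70) where
  "a \<bullet>\<^sub>c b = (\<Sum>i\<in>UNIV. a $ i * b $ i)"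

definition vec_cnj :: "complex^3 \<Rightarrow> complex^3" where
  "vec_cnj a = (\<chi> i. cnj (a $ i))"

text \<open>The weak derivatives are only used for functions and derivatives in \<open>L\<^sup>2\<close> or \<open>L\<^sup>\<infinity>\<close> of a bounded
  domain, so that all integrals exist.\<close>

definition has_weak_grad ::
  "(real^3) set \<Rightarrow> (real^3 \<Rightarrow> 'a::{real_normed_field,banach,second_countable_topology})
    \<Rightarrow> (real^3 \<Rightarrow> 'a^3) \<Rightarrow> bool" where
  "has_weak_grad \<Omega> f G \<longleftrightarrow>
     (\<forall>i. \<forall>\<phi>\<in>test_functions \<Omega>.
        (LINT x|lebesgue_on \<Omega>. f x * partial_deriv i \<phi> x) =
        - (LINT x|lebesgue_on \<Omega>. G x $ i * \<phi> x))"

definition has_weak_curl ::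
  "(real^3) set \<Rightarrow> (real^3 \<Rightarrow> complex^3) \<Rightarrow> (real^3 \<Rightarrow> complex^3) \<Rightarrow> bool" where
  "has_weak_curl \<Omega> v c \<longleftrightarrow>
     (\<forall>\<phi>\<in>test_functions \<Omega>.
        (LINT x|lebesgue_on \<Omega>. v x \<bullet>\<^sub>c curl \<phi> x) = (LINT x|lebesgue_on \<Omega>. c x \<bullet>\<^sub>c \<phi> x))"

definition has_weak_div ::
  "(real^3) set \<Rightarrow> (real^3 \<Rightarrow> complex^3) \<Rightarrow> (real^3 \<Rightarrow> complex) \<Rightarrow> bool" where
  "has_weak_div \<Omega> v d \<longleftrightarrow>
     (\<forall>\<phi>\<in>test_functions \<Omega>.
        (LINT x|lebesgue_on \<Omega>. v x \<bullet>\<^sub>c grad \<phi> x) = - (LINT x|lebesgue_on \<Omega>. d x * \<phi> x))"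

definition W1inf :: "(real^3) set \<Rightarrow> (real^3 \<Rightarrow> real) set" where
  "W1inf \<Omega> = {f \<in> Linf \<Omega>. \<exists>G\<in>Linf \<Omega>. has_weak_grad \<Omega> f G}"

definition H1 :: "(real^3) set \<Rightarrow> (real^3 \<Rightarrow> complex) set" where
  "H1 \<Omega> = {f \<in> L2 \<Omega>. \<exists>G\<in>L2 \<Omega>. has_weak_grad \<Omega> f G}"

definition H1_fields :: "(real^3) set \<Rightarrow> (real^3 \<Rightarrow> complex^3) set" where
  "H1_fields \<Omega> = {\<phi>. \<forall>i. (\<lambda>x. \<phi> x $ i) \<in> H1 \<Omega>}"

definition Hcurl :: "(real^3) set \<Rightarrow> (real^3 \<Rightarrow> complex^3) set" where
  "Hcurl \<Omega> = {v \<in> L2 \<Omega>. \<exists>c\<in>L2 \<Omega>. has_weak_curl \<Omega> v c}"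

definition Hdiv :: "(real^3) set \<Rightarrow> (real^3 \<Rightarrow> complex^3) set" where
  "Hdiv \<Omega> = {v \<in> L2 \<Omega>. \<exists>d\<in>L2 \<Omega>. has_weak_div \<Omega> v d}"

text \<open>Weak derivatives are unique up to null sets; these operators choose a representative, and are
  meaningful on \<open>H1\<close>, \<open>Hcurl\<close> and \<open>Hdiv\<close> respectively.\<close>

definition weak_grad :: "(real^3) set \<Rightarrow> (real^3 \<Rightarrow> complex) \<Rightarrow> real^3 \<Rightarrow> complex^3" where
  "weak_grad \<Omega> f = (SOME G. G \<in> L2 \<Omega> \<and> has_weak_grad \<Omega> f G)"

definition weak_curl :: "(real^3) set \<Rightarrow> (real^3 \<Rightarrow> complex^3) \<Rightarrow> real^3 \<Rightarrow> complex^3" where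
  "weak_curl \<Omega> v = (SOME c. c \<in> L2 \<Omega> \<and> has_weak_curl \<Omega> v c)"

definition weak_div :: "(real^3) set \<Rightarrow> (real^3 \<Rightarrow> complex^3) \<Rightarrow> real^3 \<Rightarrow> complex" where
  "weak_div \<Omega> v = (SOME d. d \<in> L2 \<Omega> \<and> has_weak_div \<Omega> v d)"

section \<open>Traces\<close>

text \<open>For fields that are merely in \<open>H(curl)\<close> or \<open>H(div)\<close>, the traces \<open>v \<times> n\<close> and \<open>v \<cdot> n\<close> are the
  elements of \<open>H\<^sup>-\<^sup>1\<^sup>/\<^sup>2(\<Gamma>)\<close> given by Green's formulas
    \<open>\<langle>v \<times> n, \<phi>\<rangle> = \<integral> v \<cdot> curl \<phi> - curl v \<cdot> \<phi>\<close>,  \<open>\<langle>v \<cdot> n, \<phi>\<rangle> = \<integral> v \<cdot> grad \<phi> + div v \<phi>\<close>.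
  Since \<open>H\<^sup>1\<^sup>/\<^sup>2(\<Gamma>)\<close> is the space of traces of \<open>H\<^sup>1(\<Omega>)\<close>, they are represented as functionals on
  \<open>H\<^sup>1(\<Omega>)\<close>, and vanish iff these functionals do.\<close>

definition tangential_trace ::
  "(real^3) set \<Rightarrow> (real^3 \<Rightarrow> complex^3) \<Rightarrow> (real^3 \<Rightarrow> complex^3) \<Rightarrow> complex" where
  "tangential_trace \<Omega> v \<phi> =
     (LINT x|lebesgue_on \<Omega>. v x \<bullet>\<^sub>c weak_curl \<Omega> \<phi> x - weak_curl \<Omega> v x \<bullet>\<^sub>c \<phi> x)"

definition normal_trace ::
  "(real^3) set \<Rightarrow> (real^3 \<Rightarrow> complex^3) \<Rightarrow> (real^3 \<Rightarrow> complex) \<Rightarrow> complex" where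
  "normal_trace \<Omega> v \<phi> =
     (LINT x|lebesgue_on \<Omega>. v x \<bullet>\<^sub>c weak_grad \<Omega> \<phi> x + weak_div \<Omega> v x * \<phi> x)"

definition H0curl :: "(real^3) set \<Rightarrow> (real^3 \<Rightarrow> complex^3) set" where
  "H0curl \<Omega> = {v \<in> Hcurl \<Omega>. \<forall>\<phi>\<in>H1_fields \<Omega>. tangential_trace \<Omega> v \<phi> = 0}"

definition H0div :: "(real^3) set \<Rightarrow> (real^3 \<Rightarrow> complex^3) set" where
  "H0div \<Omega> = {v \<in> Hdiv \<Omega>. \<forall>\<phi>\<in>H1 \<Omega>. normal_trace \<Omega> v \<phi> = 0}"

section \<open>The adjoint problem\<close>

definition ae_bounded_below :: "(real^3) set \<Rightarrow> (real^3 \<Rightarrow> real) \<Rightarrow> bool" where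
  "ae_bounded_below \<Omega> a \<longleftrightarrow> (\<exists>c>0. AE x in lebesgue_on \<Omega>. c \<le> a x)"

definition adjoint_solution ::
  "(real^3) set \<Rightarrow> (real^3 \<Rightarrow> real) \<Rightarrow> (real^3 \<Rightarrow> real) \<Rightarrow> real
    \<Rightarrow> (real^3 \<Rightarrow> complex^3) \<Rightarrow> (real^3 \<Rightarrow> complex^3) \<Rightarrow> bool" where
  "adjoint_solution \<Omega> \<mu> \<kappa> \<omega> f w \<longleftrightarrow>
     w \<in> H0curl \<Omega> \<and>
     (\<forall>v\<in>H0curl \<Omega>.
        (LINT x|lebesgue_on \<Omega>. (inverse (\<mu> x) *\<^sub>R weak_curl \<Omega> w x) \<bullet>\<^sub>c vec_cnj (weak_curl \<Omega> v x))
        - \<i> * of_real \<omega> * (LINT x|lebesgue_on \<Omega>. (\<kappa> x *\<^sub>R w x) \<bullet>\<^sub>c vec_cnj (v x))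
        = (LINT x|lebesgue_on \<Omega>. f x \<bullet>\<^sub>c vec_cnj (v x)))"

end

theory Submission
  imports Defs
begin

text \<open>Write \<open>c = curl w\<close> and \<open>u = c / \<mu>\<close>.

Testing the variational equation with the conjugate of a test field \<open>\<theta>\<close> gives
\<open>\<integral> u \<cdot> curl \<theta> = \<integral> (f + \<i>\<omega>\<kappa>w) \<cdot> \<theta>\<close>, so that \<open>u\<close> has a square-integrable weak curl
(\<open>adjoint_solution_flux_weak_curl\<close>). Test fields are admissible because they lie in \<open>H0curl\<close>, and their
weak curl is the classical one almost everywhere by the fundamental lemma of the calculus of variations.

For the divergence, the boundary condition on \<open>w\<close> is first turned into a property of \<open>c\<close>. If \<open>\<psi>\<close> is twice
continuously differentiable on the whole space, then \<open>grad \<psi>\<close> may be inserted into the tangential trace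
of \<open>w\<close>, and since its curl vanishes, \<open>\<integral> c \<cdot> grad \<psi> = 0\<close> (\<open>weak_curl_orthogonal_grad\<close>). The divergence
formula \<open>div (c / \<mu>) = - (c \<cdot> grad \<mu>) / \<mu>\<^sup>2\<close> and the vanishing of the normal trace of \<open>c / \<mu>\<close> are both contained
in the single statement \<open>\<integral> c \<cdot> grad (\<phi> / \<mu>) = 0\<close> for \<open>\<phi>\<close> in \<open>H1\<close>, where the gradient stands for the
expression given by the quotient rule (\<open>quotient_identity\<close>).

That statement follows by approximating \<open>\<phi>\<close> and \<open>\<mu>\<close>, together with their weak gradients, by smooth functions
on the whole space. Mollifying the extensions by zero with centred kernels fails near the boundary, where the
extensions jump. A partition of unity localises \<open>\<phi>\<close> near a point of the closure of \<open>\<Omega>\<close>. There the Lipschitz condition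
provides a cone of directions that point into \<open>\<Omega>\<close> (\<open>cone_condition\<close>), and kernels supported in
that cone only look at values inside \<open>\<Omega>\<close>: the derivative of the mollification is the mollification of the weak
gradient, up to the boundary. Mollifications converge because translations are continuous in \<open>L\<^sup>2\<close>
(\<open>mollification_error_tendsto_0\<close>). To pass to the limit in the quotient, it suffices that a factor
converging in \<open>L\<^sup>1\<close> may be multiplied by boundedly \<open>L\<^sup>1\<close>-convergent ones (\<open>L1_lim_mult\<close>). The
coefficient \<open>\<mu>\<close> is extended by \<open>1\<close> and not by \<open>0\<close>, so that its mollifications stay bounded away from zero on the
whole space and the quotients are smooth.\<close>

section \<open>Calculus of \<open>C_k\<close> functions\<close>

lemma partial_deriv_eq:
  assumes "(f has_derivative D) (at x)"
  shows "partial_deriv i f x = D (axis i 1)"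
  using frechet_derivative_at[OF assms] by (simp add: partial_deriv_def)

lemma C_k_0I: "(\<And>x. f differentiable (at x)) \<Longrightarrow> C_k 0 f"
  by (simp add: continuous_at_imp_continuous_on differentiable_imp_continuous_within)

lemma C_k_SucD: "C_k (Suc k) f \<Longrightarrow> C_k k f"
proof (induction k arbitrary: f)
  case 0
  then show ?case by (intro C_k_0I) simp
qed auto

lemma C_k_antimono: "k \<le> l \<Longrightarrow> C_k l f \<Longrightarrow> C_k k f"
  by (induction l rule: dec_induct) (auto dest: C_k_SucD simp del: C_k.simps)

lemma C_k_differentiable: "C_k (Suc k) f \<Longrightarrow> f differentiable (at x)"
  by simp

lemma C_k_has_derivative:
  "C_k (Suc k) f \<Longrightarrow> (f has_derivative frechet_derivative f (at x)) (at x)"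
  by (simp add: frechet_derivative_works)

lemma C_k_continuous: "C_k k f \<Longrightarrow> continuous_on S f"
  using C_k_antimono[of 0 k f] continuous_on_subset by fastforce

text \<open>Every closure property of \<open>C_k\<close> below is an induction on \<open>k\<close> with this rule: it suffices to exhibit the
derivative and to recognise its entries as functions of the same kind.\<close>

lemma C_k_SucI:
  assumes "\<And>x. (f has_derivative D x) (at x)"
    and "\<And>i. C_k k (\<lambda>x. D x (axis i 1))"
  shows "C_k (Suc k) f"
proof -
  have "partial_deriv i f = (\<lambda>x. D x (axis i 1))" for i
    using partial_deriv_eq[OF assms(1)] by blast
  with assms show ?thesis
    by (auto simp: differentiable_def)
qed

lemma C_k_const: "C_k k (\<lambda>x. c)"
proof (induction k arbitrary: c)
  case (Suc k)
  show ?case by (rule C_k_SucI[of _ "\<lambda>x h. 0"]) (auto intro: Suc)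
qed simp

lemma frechet_partial: "frechet_derivative f (at x) (axis i 1) = partial_deriv i f x"
  by (simp add: partial_deriv_def)

lemma C_k_partial_deriv: "C_k (Suc k) f \<Longrightarrow> C_k k (partial_deriv i f)"
  by simp

lemma C_k_bounded_linear:
  assumes "bounded_linear L" shows "C_k k f \<Longrightarrow> C_k k (\<lambda>x. L (f x))"
proof (induction k arbitrary: f)
  case 0
  then show ?case
    using bounded_linear.continuous_on[OF assms] by simp
next
  case (Suc k)
  show ?case
  proof (rule C_k_SucI)
    show "((\<lambda>x. L (f x)) has_derivative (\<lambda>h. L (frechet_derivative f (at x) h))) (at x)" for x
      using C_k_has_derivative[OF Suc.prems] bounded_linear.has_derivative[OF assms] by blast
    show "C_k k (\<lambda>x. L (frechet_derivative f (at x) (axis i 1)))" for i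
      using Suc.IH C_k_partial_deriv[OF Suc.prems, of i] by (simp add: frechet_partial)
  qed
qed

lemma partial_deriv_bounded_linear:
  assumes "bounded_linear L" "f differentiable (at x)"
  shows "partial_deriv i (\<lambda>x. L (f x)) x = L (partial_deriv i f x)"
  using partial_deriv_eq[OF bounded_linear.has_derivative[OF assms(1)
        assms(2)[unfolded frechet_derivative_works]]]
  by (simp add: frechet_partial)

lemma C_k_add: "C_k k f \<Longrightarrow> C_k k g \<Longrightarrow> C_k k (\<lambda>x. f x + g x)"
proof (induction k arbitrary: f g)
  case 0
  then show ?case by (simp add: continuous_on_add)
next
  case (Suc k)
  show ?case
  proof (rule C_k_SucI)
    show "((\<lambda>x. f x + g x) has_derivative
      (\<lambda>h. frechet_derivative f (at x) h + frechet_derivative g (at x) h)) (at x)" for x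
      by (intro has_derivative_add C_k_has_derivative[OF Suc.prems(1)] C_k_has_derivative[OF Suc.prems(2)])
    show "C_k k (\<lambda>x. frechet_derivative f (at x) (axis i 1) + frechet_derivative g (at x) (axis i 1))" for i
      unfolding frechet_partial
      by (intro Suc.IH C_k_partial_deriv Suc.prems)
  qed
qed

lemma C_k_minus: "C_k k f \<Longrightarrow> C_k k (\<lambda>x. - f x)"
  by (rule C_k_bounded_linear[OF bounded_linear_minus[OF bounded_linear_ident]])

lemma C_k_diff: "C_k k f \<Longrightarrow> C_k k g \<Longrightarrow> C_k k (\<lambda>x. f x - g x)"
  using C_k_add[OF _ C_k_minus, of k f g] by simp

lemma C_k_sum: "(\<And>j. j \<in> J \<Longrightarrow> C_k k (f j)) \<Longrightarrow> C_k k (\<lambda>x. \<Sum>j\<in>J. f j x)"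
  by (induction J rule: infinite_finite_induct) (auto intro: C_k_const C_k_add simp del: C_k.simps)

lemma C_k_bilinear:
  assumes "bounded_bilinear B"
  shows "C_k k f \<Longrightarrow> C_k k g \<Longrightarrow> C_k k (\<lambda>x. B (f x) (g x))"
proof (induction k arbitrary: f g)
  case 0
  then show ?case
    using bounded_bilinear.continuous_on[OF assms] by simp
next
  case (Suc k)
  show ?case
  proof (rule C_k_SucI)
    show "((\<lambda>x. B (f x) (g x)) has_derivative
      (\<lambda>h. B (f x) (frechet_derivative g (at x) h) + B (frechet_derivative f (at x) h) (g x))) (at x)" for x
      by (rule bounded_bilinear.FDERIV[OF assms C_k_has_derivative[OF Suc.prems(1)] C_k_has_derivative[OF Suc.prems(2)]])
    show "C_k k (\<lambda>x. B (f x) (frechet_derivative g (at x) (axis i 1))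
                    + B (frechet_derivative f (at x) (axis i 1)) (g x))" for i
      unfolding frechet_partial
      by (intro C_k_add Suc.IH C_k_partial_deriv Suc.prems C_k_SucD[OF Suc.prems(1)] C_k_SucD[OF Suc.prems(2)])
  qed
qed

lemma partial_deriv_mult:
  fixes f g :: "real^3 \<Rightarrow> 'a::real_normed_field"
  assumes "f differentiable (at x)" "g differentiable (at x)"
  shows "partial_deriv i (\<lambda>x. f x * g x) x = f x * partial_deriv i g x + partial_deriv i f x * g x"
  using partial_deriv_eq[OF has_derivative_mult[OF assms[unfolded frechet_derivative_works]]]
  by (simp add: frechet_partial)

lemma partial_deriv_const_add:
  assumes "f differentiable (at x)"
  shows "partial_deriv i (\<lambda>x. c + f x) x = partial_deriv i f x"
  using partial_deriv_eq[OF has_derivative_add[OF has_derivative_const assms[unfolded frechet_derivative_works]]]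
  by (simp add: frechet_partial)

lemmas C_k_mult = C_k_bilinear[OF bounded_bilinear_mult]

lemma C_k_shift: "C_k k f \<Longrightarrow> C_k k (\<lambda>x. f (x - a))"
proof (induction k arbitrary: f)
  case 0
  then show ?case
    using continuous_on_compose2[of UNIV f UNIV "\<lambda>x. x - a"] by (simp add: continuous_on_diff)
next
  case (Suc k)
  show ?case
  proof (rule C_k_SucI)
    show "((\<lambda>x. f (x - a)) has_derivative frechet_derivative f (at (x - a))) (at x)" for x
    proof -
      have "((\<lambda>x. x - a) has_derivative (\<lambda>h. h)) (at x)"
        by (auto intro!: derivative_eq_intros)
      from has_derivative_compose[OF this C_k_has_derivative[OF Suc.prems]] show ?thesis by simp
    qed
    show "C_k k (\<lambda>x. frechet_derivative f (at (x - a)) (axis i 1))" for i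
      unfolding frechet_partial by (intro Suc.IH C_k_partial_deriv Suc.prems)
  qed
qed

lemma partial_deriv_shift:
  assumes "\<And>x. f differentiable (at x)"
  shows "partial_deriv i (\<lambda>x. f (x - a)) x = partial_deriv i f (x - a)"
proof -
  have "((\<lambda>x. f (x - a)) has_derivative frechet_derivative f (at (x - a))) (at x)"
  proof -
    have "((\<lambda>x. x - a) has_derivative (\<lambda>h. h)) (at x)"
      by (auto intro!: derivative_eq_intros)
    from has_derivative_compose[OF this assms[unfolded frechet_derivative_works]] show ?thesis by simp
  qed
  from partial_deriv_eq[OF this] show ?thesis by (simp add: frechet_partial)
qed

lemma C_k_inverse:
  fixes f :: "real^3 \<Rightarrow> 'a::real_normed_field"
  assumes nz: "\<And>x. f x \<noteq> 0"
  shows "C_k k f \<Longrightarrow> C_k k (\<lambda>x. inverse (f x))"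
proof (induction k)
  case 0
  then show ?case using nz by (simp add: continuous_on_inverse)
next
  case (Suc k)
  show ?case
  proof (rule C_k_SucI)
    show "((\<lambda>x. inverse (f x)) has_derivative
      (\<lambda>h. - (inverse (f x) * frechet_derivative f (at x) h * inverse (f x)))) (at x)" for x
      by (rule Deriv.has_derivative_inverse[OF nz C_k_has_derivative[OF Suc.prems]])
    show "C_k k (\<lambda>x. - (inverse (f x) * frechet_derivative f (at x) (axis i 1) * inverse (f x)))" for i
      unfolding frechet_partial
      by (intro C_k_minus C_k_mult Suc.IH C_k_partial_deriv Suc.prems C_k_SucD[OF Suc.prems(1)])
  qed
qed

lemma partial_deriv_divide:
  fixes f g :: "real^3 \<Rightarrow> 'a::real_normed_field"
  assumes "f differentiable (at x)" "g differentiable (at x)" "g x \<noteq> 0"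
  shows "partial_deriv i (\<lambda>x. f x / g x) x =
    partial_deriv i f x * inverse (g x) - f x * partial_deriv i g x * inverse (g x) * inverse (g x)"
  using partial_deriv_eq[OF has_derivative_divide[OF assms(1,2)[unfolded frechet_derivative_works] assms(3)]]
  by (simp add: frechet_partial divide_inverse mult_ac)

lemma C_k_divide:
  fixes f :: "real^3 \<Rightarrow> 'a::real_normed_field"
  assumes "\<And>x. g x \<noteq> 0" "C_k k f" "C_k k g"
  shows "C_k k (\<lambda>x. f x / g x)"
  unfolding divide_inverse by (intro C_k_mult C_k_inverse assms)

section \<open>Smooth bump functions\<close>

text \<open>The functions \<open>p (1 / t) exp (- 1 / t)\<close> on \<open>t > 0\<close>, extended by zero. Allowing a polynomial factor makes
the class closed under differentiation, which reduces the smoothness of \<open>exp (- 1 / t)\<close> to an induction.\<close>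

definition flat_exp :: "real poly \<Rightarrow> real \<Rightarrow> real" where
  "flat_exp p t = (if t \<le> 0 then 0 else poly p (inverse t) * exp (- inverse t))"

lemma poly_mult_exp_minus_tendsto_0: "((\<lambda>s. poly p s * exp (- s)) \<longlongrightarrow> 0) (at_top :: real filter)"
proof -
  have "((\<lambda>s. \<Sum>i\<le>degree p. coeff p i * (s ^ i / exp s)) \<longlongrightarrow> (\<Sum>i\<le>degree p. coeff p i * 0)) (at_top :: real filter)"
    by (intro tendsto_intros tendsto_power_div_exp_0)
  then show ?thesis
    by (simp add: poly_altdef sum_distrib_right exp_minus divide_inverse mult.assoc)
qed

text \<open>At \<open>0\<close> the difference quotient is again of the form \<open>q (1 / t) exp (- 1 / t)\<close>, and the exponential
beats every polynomial.\<close>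

lemma flat_exp_has_real_derivative:
  "(flat_exp p has_real_derivative flat_exp ([:0, 0, 1:] * (p - pderiv p)) t) (at t)"
proof -
  consider "t > 0" | "t < 0" | "t = 0" by linarith
  then show ?thesis
  proof cases
    case 1
    have "((\<lambda>t. poly p (inverse t) * exp (- inverse t)) has_real_derivative
        flat_exp ([:0, 0, 1:] * (p - pderiv p)) t) (at t)"
      using 1 by (auto intro!: derivative_eq_intros
        DERIV_chain2[OF poly_DERIV] simp: flat_exp_def field_simps power2_eq_square)
    then show ?thesis
      by (rule DERIV_cong_ev[THEN iffD1, rotated -1])
        (use 1 in \<open>auto simp: flat_exp_def intro!: eventually_mono[OF eventually_nhds_in_open[of "{0<..}"]]\<close>)
  next
    case 2
    have "((\<lambda>t. 0) has_real_derivative flat_exp ([:0, 0, 1:] * (p - pderiv p)) t) (at t)"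
      using 2 by (simp add: flat_exp_def)
    then show ?thesis
      by (rule DERIV_cong_ev[THEN iffD1, rotated -1])
        (use 2 in \<open>auto simp: flat_exp_def intro!: eventually_mono[OF eventually_nhds_in_open[of "{..<0}"]]\<close>)
  next
    case 3
    have "((\<lambda>h. flat_exp p h / h) \<longlongrightarrow> 0) (at 0)"
    proof (rule filterlim_split_at)
      have "((\<lambda>h. 0) \<longlongrightarrow> (0::real)) (at_left 0)" by simp
      then show "((\<lambda>h. flat_exp p h / h) \<longlongrightarrow> 0) (at_left 0)"
        by (rule Lim_transform_eventually) (auto simp: eventually_at_filter flat_exp_def)
      have "((\<lambda>h. poly (pCons 0 p) (inverse h) * exp (- inverse h)) \<longlongrightarrow> 0) (at_right (0::real))"
        by (rule filterlim_compose[OF poly_mult_exp_minus_tendsto_0 filterlim_inverse_at_top_right])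
      then show "((\<lambda>h. flat_exp p h / h) \<longlongrightarrow> 0) (at_right 0)"
        by (rule Lim_transform_eventually) (auto simp: eventually_at_filter flat_exp_def divide_inverse)
    qed
    then show ?thesis
      using 3 by (simp add: DERIV_def flat_exp_def)
  qed
qed

lemma C_k_flat_exp:
  fixes g :: "real^3 \<Rightarrow> real"
  shows "C_k k g \<Longrightarrow> C_k k (\<lambda>x. flat_exp p (g x))"
proof (induction k arbitrary: p)
  case 0
  have "continuous_on UNIV (flat_exp p)"
    using DERIV_continuous[OF flat_exp_has_real_derivative] continuous_at_imp_continuous_on by blast
  with 0 show ?case by (auto intro: continuous_on_compose2)
next
  case (Suc k)
  let ?q = "[:0, 0, 1:] * (p - pderiv p)"
  show ?case
  proof (rule C_k_SucI)
    show "((\<lambda>x. flat_exp p (g x)) has_derivative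
      (\<lambda>h. flat_exp ?q (g x) * frechet_derivative g (at x) h)) (at x)" for x
      using has_derivative_compose[OF C_k_has_derivative[OF Suc.prems]
          flat_exp_has_real_derivative[unfolded has_field_derivative_def]] by (simp add: mult.commute)
    show "C_k k (\<lambda>x. flat_exp ?q (g x) * frechet_derivative g (at x) (axis i 1))" for i
      unfolding frechet_partial
      by (intro C_k_mult Suc.IH C_k_partial_deriv Suc.prems C_k_SucD[OF Suc.prems(1)])
  qed
qed

lemma C_k_component: "C_k k (\<lambda>x::real^3. x $ i)"
proof (cases k)
  case (Suc l)
  show ?thesis unfolding Suc
    by (rule C_k_SucI[of _ "\<lambda>x h. h $ i"]) (auto intro!: C_k_const bounded_linear_imp_has_derivative bounded_linear_vec_nth)
qed (simp add: continuous_on_component)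

text \<open>With the constant polynomial \<open>1\<close> this is \<open>exp (- 1 / (r\<^sup>2 - |x - a|\<^sup>2))\<close> inside the ball and zero outside.\<close>

definition bump :: "real^3 \<Rightarrow> real \<Rightarrow> real^3 \<Rightarrow> real" where
  "bump a r x = flat_exp 1 (r\<^sup>2 - (norm (x - a))\<^sup>2)"

lemma smooth_bump: "smooth (bump a r)"
  unfolding smooth_def
proof
  fix k
  have eq: "bump a r = (\<lambda>x. flat_exp 1 (r\<^sup>2 - (\<Sum>i\<in>UNIV. ((x - a) $ i) * ((x - a) $ i))))"
    by (simp add: bump_def fun_eq_iff dot_square_norm[symmetric] inner_vec_def)
  show "C_k k (bump a r)"
    unfolding eq by (intro C_k_flat_exp C_k_diff C_k_const C_k_sum C_k_mult C_k_shift[OF C_k_component])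
qed

lemma bump_nonneg: "0 \<le> bump a r x"
  by (simp add: bump_def flat_exp_def)

lemma bump_pos_iff: "0 < r \<Longrightarrow> 0 < bump a r x \<longleftrightarrow> x \<in> ball a r"
  by (auto simp: bump_def flat_exp_def dist_norm norm_minus_commute power_less_imp_less_base
      intro!: power_strict_mono)

lemma bump_eq_0: "0 < r \<Longrightarrow> x \<notin> ball a r \<Longrightarrow> bump a r x = 0"
  using bump_pos_iff[of r a x] bump_nonneg[of a r x] by linarith

section \<open>Continuity of translations\<close>

lemma
  fixes f :: "'a::euclidean_space \<Rightarrow> 'b::{banach, second_countable_topology}"
  shows lborel_integrable_translation: "integrable lborel (\<lambda>x. f (x + z)) \<longleftrightarrow> integrable lborel f" (is ?A)
    and lborel_integral_translation: "(LINT x|lborel. f (x + z)) = (LINT x|lborel. f x)" (is ?B)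
proof -
  have *: "integrable lborel (\<lambda>x. f (x + z))" if "integrable lborel f" for f :: "'a \<Rightarrow> 'b" and z
  proof -
    have [measurable]: "f \<in> borel_measurable borel"
      using borel_measurable_integrable[OF that] by simp
    have "integrable (distr lborel borel ((+) z)) f"
      using that by (simp add: lborel_distr_plus)
    then show ?thesis
      by (subst (asm) integrable_distr_eq) (auto simp: add.commute)
  qed
  show A: ?A
    using *[of f z] *[of "\<lambda>x. f (x + z)" "- z"] by (auto simp: add.assoc)
  show ?B
  proof (cases "integrable lborel f")
    case True
    then have [measurable]: "f \<in> borel_measurable borel"
      using borel_measurable_integrable by force
    have "(LINT x|distr lborel borel ((+) z). f x) = (LINT x|lborel. f (z + x))"
      by (intro integral_distr) auto
    then show ?thesis by (simp add: lborel_distr_plus add.commute)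
  next
    case False
    then show ?thesis using A by (simp add: not_integrable_integral_eq)
  qed
qed

text \<open>Translations are isometries of \<open>L\<^sup>1\<close>, so the functions with continuous translation form a closed set.\<close>

lemma translation_tendsto_approx:
  fixes f :: "'a::euclidean_space \<Rightarrow> 'b::{banach, second_countable_topology}"
  assumes f: "integrable lborel f"
    and approx: "\<And>e. 0 < e \<Longrightarrow> \<exists>g. integrable lborel g \<and> (LINT x|lborel. norm (f x - g x)) < e \<and>
      ((\<lambda>z. LINT x|lborel. norm (g (x + z) - g x)) \<longlongrightarrow> 0) (at 0)"
  shows "((\<lambda>z. LINT x|lborel. norm (f (x + z) - f x)) \<longlongrightarrow> 0) (at 0)"
proof (rule tendstoI)
  fix e :: real assume e: "0 < e"
  obtain g where g: "integrable lborel g" and fg: "(LINT x|lborel. norm (f x - g x)) < e / 3"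
    and lim: "((\<lambda>z. LINT x|lborel. norm (g (x + z) - g x)) \<longlongrightarrow> 0) (at 0)"
    using approx[of "e/3"] e by auto
  have "\<forall>\<^sub>F z in at 0. (LINT x|lborel. norm (g (x + z) - g x)) < e / 3"
    using order_tendstoD(2)[OF lim, of "e/3"] e by simp
  then show "\<forall>\<^sub>F z in at 0. dist (LINT x|lborel. norm (f (x + z) - f x)) 0 < e"
  proof eventually_elim
    case (elim z)
    note fz = lborel_integrable_translation[of f z, THEN iffD2, OF f]
    note gz = lborel_integrable_translation[of g z, THEN iffD2, OF g]
    have "(LINT x|lborel. norm (f (x + z) - f x)) \<le>
      (LINT x|lborel. norm (f (x + z) - g (x + z)) + norm (g (x + z) - g x) + norm (f x - g x))"
    proof (rule integral_mono)
      fix x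
      show "norm (f (x + z) - f x) \<le> norm (f (x + z) - g (x + z)) + norm (g (x + z) - g x) + norm (f x - g x)"
        using norm_triangle_ineq[of "f (x + z) - g (x + z) + (g (x + z) - g x)" "g x - f x"]
          norm_triangle_ineq[of "f (x + z) - g (x + z)" "g (x + z) - g x"]
        by (simp add: norm_minus_commute)
    qed (use f g fz gz in auto)
    also have "\<dots> = (LINT x|lborel. norm (f (x + z) - g (x + z))) + (LINT x|lborel. norm (g (x + z) - g x))
        + (LINT x|lborel. norm (f x - g x))"
      using f g fz gz by (subst Bochner_Integration.integral_add, simp, simp)+ simp
    also have "\<dots> < e"
      using fg elim lborel_integral_translation[of "\<lambda>x. norm (f x - g x)" z] by simp
    finally show ?case by (simp add: integral_nonneg_AE)
  qed
qed

text \<open>Since \<open>U\<close> is open, \<open>1\<^sub>U(x) 1\<^sub>U(x + z)\<close> tends to \<open>1\<^sub>U(x)\<close> for every \<open>x\<close>, also on the boundary of \<open>U\<close>, where both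
sides vanish. The distance of \<open>1\<^sub>U\<close> from its translate is expressed by the integral of this product.\<close>

lemma translation_tendsto_open:
  fixes U :: "'a::euclidean_space set" and c :: "'b::{banach, second_countable_topology}"
  assumes U: "open U" and fin: "emeasure lborel U < \<infinity>"
  shows "((\<lambda>z. LINT x|lborel. norm (indicator U (x + z) *\<^sub>R c - indicator U x *\<^sub>R c)) \<longlongrightarrow> 0) (at 0)"
  unfolding tendsto_at_iff_sequentially
proof (intro allI impI)
  fix Z :: "nat \<Rightarrow> 'a" assume Z: "Z \<longlonglongrightarrow> 0"
  define u where "u = (indicator U :: 'a \<Rightarrow> real)"
  have [measurable]: "U \<in> sets borel" using U by simp
  have u: "integrable lborel u" using fin by (simp add: u_def)
  have uz: "integrable lborel (\<lambda>x. u (x + z))" for z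
    using u by (simp add: lborel_integrable_translation)
  have i: "integrable lborel (\<lambda>x. u x * u (x + z))" for z
    by (rule Bochner_Integration.integrable_bound[OF u])
       (auto simp: u_def indicator_def)
  have lim: "(\<lambda>n. LINT x|lborel. u x * u (x + Z n)) \<longlonglongrightarrow> (LINT x|lborel. u x)"
  proof (rule integral_dominated_convergence[where w = u])
    show "AE x in lborel. (\<lambda>n. u x * u (x + Z n)) \<longlonglongrightarrow> u x"
    proof (rule AE_I2)
      fix x
      show "(\<lambda>n. u x * u (x + Z n)) \<longlonglongrightarrow> u x"
      proof (cases "x \<in> U")
        case True
        have "(\<lambda>n. x + Z n) \<longlonglongrightarrow> x" using tendsto_add[OF tendsto_const Z, of x] by simp
        then have "\<forall>\<^sub>F n in sequentially. x + Z n \<in> U"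
          using True U topological_tendstoD by blast
        then show ?thesis
          by (intro tendsto_eventually) (auto simp: u_def True elim!: eventually_mono)
      qed (simp add: u_def)
    qed
  qed (use u in \<open>auto simp: u_def indicator_def\<close>)
  have "(LINT x|lborel. norm (indicator U (x + z) *\<^sub>R c - indicator U x *\<^sub>R c)) =
     (2 * (LINT x|lborel. u x) - 2 * (LINT x|lborel. u x * u (x + z))) * norm c" for z
  proof -
    have "(LINT x|lborel. norm (indicator U (x + z) *\<^sub>R c - indicator U x *\<^sub>R c)) =
        (LINT x|lborel. (u (x + z) + u x - 2 * (u x * u (x + z))) * norm c)"
      by (rule Bochner_Integration.integral_cong) (auto simp: u_def indicator_def)
    also have "\<dots> = (LINT x|lborel. u (x + z) + u x - 2 * (u x * u (x + z))) * norm c"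
      by simp
    also have "(LINT x|lborel. u (x + z) + u x - 2 * (u x * u (x + z))) =
        (LINT x|lborel. u (x + z)) + (LINT x|lborel. u x) - 2 * (LINT x|lborel. u x * u (x + z))"
      using u uz i by (simp add: Bochner_Integration.integral_diff)
    finally show ?thesis using lborel_integral_translation[of u z] by simp
  qed
  moreover have "(\<lambda>n. (2 * (LINT x|lborel. u x) - 2 * (LINT x|lborel. u x * u (x + Z n))) * norm c)
      \<longlonglongrightarrow> (2 * (LINT x|lborel. u x) - 2 * (LINT x|lborel. u x)) * norm c"
    by (intro tendsto_intros lim)
  ultimately show "((\<lambda>z. LINT x|lborel. norm (indicator U (x + z) *\<^sub>R c - indicator U x *\<^sub>R c)) \<circ> Z) \<longlonglongrightarrow> 0"
    by (simp add: o_def)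
qed

text \<open>By outer regularity the indicator of a set of finite measure is close to that of an open set; general
functions are then reached by the approximation lemma.\<close>

lemma translation_tendsto_L1:
  fixes f :: "'a::euclidean_space \<Rightarrow> 'b::{banach, second_countable_topology}"
  assumes "integrable lborel f"
  shows "((\<lambda>z. LINT x|lborel. norm (f (x + z) - f x)) \<longlongrightarrow> 0) (at 0)"
  using assms
proof (induction rule: integrable_induct)
  case (base A c)
  then have [measurable]: "A \<in> sets borel" by simp
  show ?case
  proof (rule translation_tendsto_approx)
    show "integrable lborel (\<lambda>x. indicator A x *\<^sub>R c)" using base by simp
    fix e :: real assume "0 < e"
    then have "0 < e / (norm c + 1)"
      by (simp add: add_nonneg_pos)
    then obtain U where U: "open U" "A \<subseteq> U" "emeasure lborel (U - A) < ennreal (e / (norm c + 1))"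
      using outer_regular_lborel[of A] base by auto
    have [measurable]: "U \<in> sets borel" using U by simp
    have fin: "emeasure lborel (U - A) < \<infinity>" using U(3) by (metis ennreal_less_top infinity_ennreal_def order_less_trans)
    have "emeasure lborel U \<le> emeasure lborel (U - A) + emeasure lborel A"
      using U(2) by (subst plus_emeasure) (auto intro!: emeasure_mono)
    then have Ufin: "emeasure lborel U < \<infinity>"
      using fin base(2) by (simp add: order_le_less_trans)
    have "measure lborel (U - A) < e / (norm c + 1)"
      using U(3) fin by (subst (asm) emeasure_eq_ennreal_measure) (auto simp: ennreal_less_iff)
    then have lt: "measure lborel (U - A) * norm c < e"
      by (smt (verit) measure_nonneg mult_left_mono norm_ge_zero pos_less_divide_eq)
    have "(LINT x|lborel. norm (indicator A x *\<^sub>R c - indicator U x *\<^sub>R c)) =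
      (LINT x|lborel. indicator (U - A) x * norm c)"
      using U(2) by (intro Bochner_Integration.integral_cong) (auto simp: indicator_def)
    also have "\<dots> = measure lborel (U - A) * norm c" by simp
    finally show "\<exists>g. integrable lborel g \<and> (LINT x|lborel. norm (indicator A x *\<^sub>R c - g x)) < e \<and>
        ((\<lambda>z. LINT x|lborel. norm (g (x + z) - g x)) \<longlongrightarrow> 0) (at 0)"
      using lt translation_tendsto_open[OF U(1) Ufin, of c] Ufin
      by (intro exI[of _ "\<lambda>x. indicator U x *\<^sub>R c"]) auto
  qed
next
  case (add f g)
  show ?case
  proof (rule tendsto_sandwich[OF _ _ tendsto_const])
    show "((\<lambda>z. (LINT x|lborel. norm (f (x + z) - f x)) + (LINT x|lborel. norm (g (x + z) - g x))) \<longlongrightarrow> 0) (at 0)"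
      using tendsto_add[OF add.IH] by simp
    show "\<forall>\<^sub>F z in at 0. (LINT x|lborel. norm (f (x + z) + g (x + z) - (f x + g x)))
       \<le> (LINT x|lborel. norm (f (x + z) - f x)) + (LINT x|lborel. norm (g (x + z) - g x))"
    proof (rule always_eventually, rule allI)
      fix z
      note fz = lborel_integrable_translation[of f z, THEN iffD2, OF add.hyps(1)]
      note gz = lborel_integrable_translation[of g z, THEN iffD2, OF add.hyps(2)]
      have "(LINT x|lborel. norm (f (x + z) + g (x + z) - (f x + g x))) \<le>
         (LINT x|lborel. norm (f (x + z) - f x) + norm (g (x + z) - g x))"
        using add.hyps fz gz by (intro integral_mono) (auto simp: add_diff_add norm_triangle_ineq)
      then show "(LINT x|lborel. norm (f (x + z) + g (x + z) - (f x + g x)))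
         \<le> (LINT x|lborel. norm (f (x + z) - f x)) + (LINT x|lborel. norm (g (x + z) - g x))"
        using add.hyps fz gz by simp
    qed
  qed (auto intro!: always_eventually integral_nonneg_AE)
next
  case (lim f s)
  show ?case
  proof (rule translation_tendsto_approx[OF lim.hyps(4)])
    fix e :: real assume e: "0 < e"
    have "(\<lambda>n. LINT x|lborel. norm (f x - s n x)) \<longlonglongrightarrow> (LINT x|(lborel :: 'a measure). 0::real)"
    proof (rule integral_dominated_convergence[where w = "\<lambda>x. 3 * norm (f x)"])
      show "AE x in lborel. (\<lambda>n. norm (f x - s n x)) \<longlonglongrightarrow> 0"
      proof (rule AE_I2)
        fix x
        have "(\<lambda>n. f x - s n x) \<longlonglongrightarrow> f x - f x"
          by (intro tendsto_intros lim.hyps(2)) simp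
        then show "(\<lambda>n. norm (f x - s n x)) \<longlonglongrightarrow> 0"
          by (simp add: tendsto_norm_zero)
      qed
      show "AE x in lborel. norm (norm (f x - s n x)) \<le> 3 * norm (f x)" for n
      proof (rule AE_I2)
        fix x :: 'a
        show "norm (norm (f x - s n x)) \<le> 3 * norm (f x)"
          using lim.hyps(3)[of x n] norm_triangle_ineq4[of "f x" "s n x"] by simp
      qed
    qed (use lim.hyps in auto)
    then have "\<forall>\<^sub>F n in sequentially. (LINT x|lborel. norm (f x - s n x)) < e"
      by (rule order_tendstoD(2)) (use e in simp)
    then obtain n where "(LINT x|lborel. norm (f x - s n x)) < e"
      by (auto simp: eventually_sequentially)
    then show "\<exists>g. integrable lborel g \<and> (LINT x|lborel. norm (f x - g x)) < e \<and>
        ((\<lambda>z. LINT x|lborel. norm (g (x + z) - g x)) \<longlongrightarrow> 0) (at 0)"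
      using lim by (intro exI[of _ "s n"]) auto
  qed
qed

lemma integral_tail_tendsto_0:
  fixes v w :: "'a \<Rightarrow> real"
  assumes w: "integrable M w" and [measurable]: "v \<in> borel_measurable M"
  shows "integrable M (\<lambda>x. indicator {x. real N < v x} x * w x)"
    and "(\<lambda>N. LINT x|M. indicator {x. real N < v x} x * w x) \<longlonglongrightarrow> 0"
proof -
  note [measurable] = borel_measurable_integrable[OF w]
  show "integrable M (\<lambda>x. indicator {x. real N < v x} x * w x)"
    by (rule Bochner_Integration.integrable_bound[OF w]) (auto simp: indicator_def)
  have "(\<lambda>N. LINT x|M. indicator {x. real N < v x} x * w x) \<longlonglongrightarrow> (LINT x|M. 0)"
  proof (rule integral_dominated_convergence[where w = "\<lambda>x. \<bar>w x\<bar>"])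
    show "AE x in M. (\<lambda>N. indicator {x. real N < v x} x * w x) \<longlonglongrightarrow> 0"
    proof (rule AE_I2)
      fix x
      obtain N0 :: nat where "v x \<le> real N0" using real_arch_simple by blast
      then have "\<forall>\<^sub>F N in sequentially. indicator {x. real N < v x} x * w x = 0"
        by (intro eventually_sequentiallyI[of N0]) (auto simp: indicator_def)
      then show "(\<lambda>N. indicator {x. real N < v x} x * w x) \<longlonglongrightarrow> 0" by (rule tendsto_eventually)
    qed
  qed (use w in \<open>auto simp: indicator_def\<close>)
  then show "(\<lambda>N. LINT x|M. indicator {x. real N < v x} x * w x) \<longlonglongrightarrow> 0" by simp
qed

lemma square_sum_bound: "(p + q)\<^sup>2 \<le> 2 * (p\<^sup>2 + q\<^sup>2)" for p q :: real
  using sum_squares_bound[of p q] by (simp add: power2_sum)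

lemma square_integrable_mult_integrable:
  fixes f g :: "'a \<Rightarrow> complex"
  assumes "f \<in> borel_measurable M" "integrable M (\<lambda>x. (norm (f x))\<^sup>2)"
    and "g \<in> borel_measurable M" "integrable M (\<lambda>x. (norm (g x))\<^sup>2)"
  shows "integrable M (\<lambda>x. f x * g x)"
proof (rule Bochner_Integration.integrable_bound)
  show "integrable M (\<lambda>x. (norm (f x))\<^sup>2 + (norm (g x))\<^sup>2)" using assms by simp
  have "u * v \<le> u\<^sup>2 + v\<^sup>2" if "0 \<le> u" "0 \<le> v" for u v :: real
    using sum_squares_bound[of u v] mult_nonneg_nonneg[OF that] by linarith
  then show "AE x in M. norm (f x * g x) \<le> norm ((norm (f x))\<^sup>2 + (norm (g x))\<^sup>2)"
    by (simp add: norm_mult)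
qed (use assms in measurable)

text \<open>The \<open>L\<^sup>2\<close> form of the continuity of translations, stated for a fixed square-integrable weight because
mollification errors are only ever paired with such a weight. Where \<open>|c| \<le> N\<close> the \<open>L\<^sup>1\<close> statement
applies. Where \<open>|c| > N\<close>, Young's inequality with a parameter \<open>L\<close> bounds the integrand by \<open>L |c|\<^sup>2 / 2\<close>, whose
integral over that set is small for large \<open>N\<close>, and a multiple \<open>1 / L\<close> of the squares of \<open>f\<close>.\<close>

lemma translation_tendsto_weighted:
  fixes c f :: "'a::euclidean_space \<Rightarrow> complex"
  assumes [measurable]: "c \<in> borel_measurable borel"
    and c: "integrable lborel (\<lambda>x. (norm (c x))\<^sup>2)"
    and f: "integrable lborel f" "integrable lborel (\<lambda>x. (norm (f x))\<^sup>2)"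
  shows translation_weighted_integrable:
      "integrable lborel (\<lambda>x. norm (c x) * norm (f (x + z) - f x))" (is "?A z")
    and "((\<lambda>z. LINT x|lborel. norm (c x) * norm (f (x + z) - f x)) \<longlongrightarrow> 0) (at 0)" (is ?B)
proof -
  have [measurable]: "f \<in> borel_measurable borel"
    using borel_measurable_integrable[OF f(1)] by simp
  note fz = lborel_integrable_translation[of f, THEN iffD2, OF f(1)]
  note f2z = lborel_integrable_translation[of "\<lambda>x. (norm (f x))\<^sup>2", THEN iffD2, OF f(2)]
  have young: "u * a \<le> L / 2 * u\<^sup>2 + (p\<^sup>2 + q\<^sup>2) / L" if "0 \<le> a" "a \<le> p + q" "0 < L" for u a p q L :: real
  proof -
    have "0 \<le> (L * u - a)\<^sup>2" by simp
    then have "2 * L * (u * a) \<le> L\<^sup>2 * u\<^sup>2 + a\<^sup>2" by (simp add: power2_eq_square algebra_simps)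
    also have "\<dots> \<le> L\<^sup>2 * u\<^sup>2 + 2 * (p\<^sup>2 + q\<^sup>2)"
      using order_trans[OF power_mono[OF that(2,1), of 2] square_sum_bound] by simp
    finally have "2 * L * (u * a) \<le> L\<^sup>2 * u\<^sup>2 + 2 * (p\<^sup>2 + q\<^sup>2)" .
    also have "\<dots> = 2 * L * (L / 2 * u\<^sup>2 + (p\<^sup>2 + q\<^sup>2) / L)"
      using that(3) by (simp add: distrib_left power2_eq_square add_divide_distrib)
    finally show ?thesis using that(3) by simp
  qed
  show A: "?A z" for z
  proof (rule Bochner_Integration.integrable_bound)
    show "integrable lborel (\<lambda>x. 1 / 2 * (norm (c x))\<^sup>2 + ((norm (f (x + z)))\<^sup>2 + (norm (f x))\<^sup>2) / 1)"
      using c f f2z by auto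
    show "AE x in lborel. norm (norm (c x) * norm (f (x + z) - f x)) \<le>
       norm (1 / 2 * (norm (c x))\<^sup>2 + ((norm (f (x + z)))\<^sup>2 + (norm (f x))\<^sup>2) / 1)"
      using young[OF norm_ge_zero norm_triangle_ineq4, of 1] by (intro AE_I2) simp
  qed measurable
  show ?B
  proof (rule tendstoI)
    fix e :: real assume e: "0 < e"
    define F where "F = (LINT x|lborel. (norm (f x))\<^sup>2)"
    \<comment> \<open>This \<open>L\<close> makes the last term of Young's inequality smaller than \<open>e / 3\<close>; the summand \<open>1\<close> covers \<open>F = 0\<close>.\<close>
    define L where "L = 6 * F / e + 1"
    have F: "0 \<le> F" by (simp add: F_def)
    then have L: "0 < L" using e by (simp add: L_def add_nonneg_pos)
    have FL: "2 * F / L < e / 3"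
      using e L F by (simp add: L_def field_simps)
    define R where "R N x = indicator {x. real N < norm (c x)} x * (norm (c x))\<^sup>2" for N x
    have R: "integrable lborel (R N)" for N
      using integral_tail_tendsto_0(1)[OF c, of "\<lambda>x. norm (c x)" N] by (simp add: R_def[abs_def])
    have "(\<lambda>N. LINT x|lborel. R N x) \<longlonglongrightarrow> 0"
      using integral_tail_tendsto_0(2)[OF c, of "\<lambda>x. norm (c x)"] by (simp add: R_def)
    then have "(\<lambda>N. L / 2 * (LINT x|lborel. R N x)) \<longlonglongrightarrow> L / 2 * 0"
      by (intro tendsto_intros) simp
    then have "\<forall>\<^sub>F N in sequentially. L / 2 * (LINT x|lborel. R N x) < e / 3"
      by (rule order_tendstoD(2)) (use e in simp)
    then obtain N where N: "L / 2 * (LINT x|lborel. R N x) < e / 3"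
      by (auto simp: eventually_sequentially)
    have "((\<lambda>z. real N * (LINT x|lborel. norm (f (x + z) - f x))) \<longlongrightarrow> real N * 0) (at 0)"
      by (intro tendsto_intros translation_tendsto_L1 f)
    then have "\<forall>\<^sub>F z in at 0. real N * (LINT x|lborel. norm (f (x + z) - f x)) < e / 3"
      by (rule order_tendstoD(2)) (use e in simp)
    then show "\<forall>\<^sub>F z in at 0. dist (LINT x|lborel. norm (c x) * norm (f (x + z) - f x)) 0 < e"
    proof eventually_elim
      case (elim z)
      have i1: "integrable lborel (\<lambda>x. real N * norm (f (x + z) - f x))"
        using f fz[of z] by (intro integrable_mult_right integrable_norm Bochner_Integration.integrable_diff)
      have i2: "integrable lborel (\<lambda>x. L / 2 * R N x)" using R[of N] by simp
      have i3: "integrable lborel (\<lambda>x. ((norm (f (x + z)))\<^sup>2 + (norm (f x))\<^sup>2) / L)"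
        using f f2z[of z] by simp
      have "(LINT x|lborel. norm (c x) * norm (f (x + z) - f x)) \<le>
        (LINT x|lborel. real N * norm (f (x + z) - f x) + L / 2 * R N x +
            ((norm (f (x + z)))\<^sup>2 + (norm (f x))\<^sup>2) / L)"
      proof (rule integral_mono[OF A])
        fix x
        have ge: "0 \<le> ((norm (f (x + z)))\<^sup>2 + (norm (f x))\<^sup>2) / L" using L by simp
        show "norm (c x) * norm (f (x + z) - f x) \<le> real N * norm (f (x + z) - f x) + L / 2 * R N x +
            ((norm (f (x + z)))\<^sup>2 + (norm (f x))\<^sup>2) / L"
        proof (cases "real N < norm (c x)")
          case True
          then have R: "R N x = (norm (c x))\<^sup>2" by (simp add: R_def)
          have "0 \<le> real N * norm (f (x + z) - f x)" by simp
          then show ?thesis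
            using young[OF norm_ge_zero norm_triangle_ineq4 L, of "norm (c x)" "f (x + z)" "f x"]
            unfolding R by linarith
        next
          case False
          then have "norm (c x) * norm (f (x + z) - f x) \<le> real N * norm (f (x + z) - f x)"
            by (intro mult_right_mono) auto
          then show ?thesis using ge False by (simp add: R_def)
        qed
      qed (use i1 i2 i3 in simp)
      also have "\<dots> = real N * (LINT x|lborel. norm (f (x + z) - f x)) + L / 2 * (LINT x|lborel. R N x) +
            (LINT x|lborel. ((norm (f (x + z)))\<^sup>2 + (norm (f x))\<^sup>2) / L)"
        using i1 i2 i3 by (subst Bochner_Integration.integral_add, simp, simp)+ simp
      also have "(LINT x|lborel. ((norm (f (x + z)))\<^sup>2 + (norm (f x))\<^sup>2) / L) = 2 * F / L"
        using f f2z[of z] lborel_integral_translation[of "\<lambda>x. (norm (f x))\<^sup>2" z] by (simp add: F_def)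
      finally show ?case using elim N FL by (simp add: integral_nonneg_AE)
    qed
  qed
qed

section \<open>Mollification\<close>

text \<open>The average of \<open>f\<close> over \<open>x + supp k\<close>. The kernel is not reflected, so that the support of \<open>k\<close> is the
set of directions in which \<open>f\<close> is sampled; this is what is controlled near the boundary.\<close>

definition mollify :: "('a::euclidean_space \<Rightarrow> complex) \<Rightarrow> ('a \<Rightarrow> complex) \<Rightarrow> 'a \<Rightarrow> complex" where
  "mollify k f x = (LINT y|lebesgue. f y * k (y - x))"

text \<open>As \<open>\<rho>\<close> is a probability density, the error at \<open>x\<close> is the \<open>\<rho>\<close>-average over \<open>z\<close> of \<open>f (x + z) - f x\<close>. After
exchanging the integrals, the error is a \<open>\<rho>\<close>-average of quantities that are at most \<open>e\<close>.\<close>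

lemma mollification_error_bound:
  fixes c f :: "'a::euclidean_space \<Rightarrow> complex" and \<rho> :: "'a \<Rightarrow> real"
  assumes [measurable]: "c \<in> borel_measurable borel" "\<rho> \<in> borel_measurable borel"
    and f: "integrable lborel f"
    and int: "\<And>z. integrable lborel (\<lambda>x. norm (c x) * norm (f (x + z) - f x))"
    and le: "\<And>z. z \<in> S \<Longrightarrow> (LINT x|lborel. norm (c x) * norm (f (x + z) - f x)) \<le> e"
    and \<rho>: "\<And>z. 0 \<le> \<rho> z" "\<And>z. z \<notin> S \<Longrightarrow> \<rho> z = 0" "\<And>z. \<rho> z \<le> B" "(LINT z|lborel. \<rho> z) = 1"
  shows "(\<integral>\<^sup>+x. ennreal (norm (c x) * norm (mollify (\<lambda>z. of_real (\<rho> z)) f x - f x)) \<partial>lborel) \<le> ennreal e"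
proof -
  have [measurable]: "f \<in> borel_measurable borel"
    using borel_measurable_integrable[OF f] by simp
  have \<rho>i: "integrable lborel \<rho>"
    using \<rho>(4) not_integrable_integral_eq by fastforce
  have "norm (c x) * norm (mollify (\<lambda>z. of_real (\<rho> z)) f x - f x) \<le>
      (\<integral>\<^sup>+z. ennreal (\<rho> z * (norm (c x) * norm (f (x + z) - f x))) \<partial>lborel)" for x
  proof -
    have fz: "integrable lborel (\<lambda>z. f (z + x))"
      using f by (simp add: lborel_integrable_translation)
    have i: "integrable lborel (\<lambda>z. f (z + x) * of_real (\<rho> z))"
    proof (rule Bochner_Integration.integrable_bound[OF integrable_mult_right[OF fz, of "of_real B"]])
      show "AE z in lborel. norm (f (z + x) * of_real (\<rho> z)) \<le> norm (of_real B * f (z + x))"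
      proof (rule AE_I2)
        fix z
        have "\<bar>\<rho> z\<bar> \<le> \<bar>B\<bar>" using \<rho>(1)[of z] \<rho>(3)[of z] by linarith
        then show "norm (f (z + x) * of_real (\<rho> z)) \<le> norm (of_real B * f (z + x))"
          by (simp add: norm_mult mult.commute mult_right_mono)
      qed
    qed measurable
    have i': "integrable lborel (\<lambda>z. f x * complex_of_real (\<rho> z))" using \<rho>i by simp
    have "mollify (\<lambda>z. of_real (\<rho> z)) f x = (LINT y|lborel. f y * of_real (\<rho> (y - x)))"
      unfolding mollify_def by (rule integral_completion) measurable
    also have "\<dots> = (LINT z|lborel. f (z + x) * of_real (\<rho> z))"
      using lborel_integral_translation[of "\<lambda>y. f y * complex_of_real (\<rho> (y - x))" x] by simp
    finally have "mollify (\<lambda>z. of_real (\<rho> z)) f x - f x =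
        (LINT z|lborel. f (z + x) * of_real (\<rho> z)) - (LINT z|lborel. f x * complex_of_real (\<rho> z))"
      using \<rho>(4) by simp
    also have "\<dots> = (LINT z|lborel. of_real (\<rho> z) * (f (x + z) - f x))"
      using i i' by (subst Bochner_Integration.integral_diff[symmetric]) (auto simp: algebra_simps)
    finally have eq: "mollify (\<lambda>z. of_real (\<rho> z)) f x - f x = (LINT z|lborel. of_real (\<rho> z) * (f (x + z) - f x))" .
    have "integrable lborel (\<lambda>z. of_real (\<rho> z) * (f (x + z) - f x))"
      using Bochner_Integration.integrable_diff[OF i i'] by (simp add: algebra_simps)
    then have ii: "integrable lborel (\<lambda>z. norm (c x) * norm (of_real (\<rho> z) * (f (x + z) - f x)))"
      by simp
    have "norm (c x) * norm (mollify (\<lambda>z. of_real (\<rho> z)) f x - f x) \<le>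
        norm (c x) * (LINT z|lborel. norm (of_real (\<rho> z) * (f (x + z) - f x)))"
      unfolding eq by (intro mult_left_mono integral_norm_bound) auto
    also have "\<dots> = (LINT z|lborel. norm (c x) * norm (of_real (\<rho> z) * (f (x + z) - f x)))"
      by simp
    finally have "ennreal (norm (c x) * norm (mollify (\<lambda>z. of_real (\<rho> z)) f x - f x)) \<le>
        ennreal (LINT z|lborel. norm (c x) * norm (of_real (\<rho> z) * (f (x + z) - f x)))"
      by (rule ennreal_leI)
    also have "\<dots> = (\<integral>\<^sup>+z. ennreal (norm (c x) * norm (of_real (\<rho> z) * (f (x + z) - f x))) \<partial>lborel)"
      by (rule nn_integral_eq_integral[symmetric, OF ii]) auto
    also have "\<dots> = (\<integral>\<^sup>+z. ennreal (\<rho> z * (norm (c x) * norm (f (x + z) - f x))) \<partial>lborel)"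
      using \<rho>(1) by (intro nn_integral_cong) (simp add: norm_mult mult_ac)
    finally show ?thesis .
  qed
  then have "(\<integral>\<^sup>+x. ennreal (norm (c x) * norm (mollify (\<lambda>z. of_real (\<rho> z)) f x - f x)) \<partial>lborel) \<le>
    (\<integral>\<^sup>+x. \<integral>\<^sup>+z. ennreal (\<rho> z * (norm (c x) * norm (f (x + z) - f x))) \<partial>lborel \<partial>lborel)"
    by (rule nn_integral_mono)
  also have "\<dots> = (\<integral>\<^sup>+z. \<integral>\<^sup>+x. ennreal (\<rho> z * (norm (c x) * norm (f (x + z) - f x))) \<partial>lborel \<partial>lborel)"
    by (rule lborel_pair.Fubini'[symmetric]) measurable
  also have "\<dots> \<le> (\<integral>\<^sup>+z. ennreal (\<rho> z) * ennreal e \<partial>lborel)"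
  proof (rule nn_integral_mono)
    fix z
    have "(\<integral>\<^sup>+x. ennreal (\<rho> z * (norm (c x) * norm (f (x + z) - f x))) \<partial>lborel) =
       (\<integral>\<^sup>+x. ennreal (\<rho> z) * ennreal (norm (c x) * norm (f (x + z) - f x)) \<partial>lborel)"
      using \<rho>(1)[of z] by (simp add: ennreal_mult)
    also have "\<dots> = ennreal (\<rho> z) * (\<integral>\<^sup>+x. ennreal (norm (c x) * norm (f (x + z) - f x)) \<partial>lborel)"
      by (rule nn_integral_cmult) measurable
    also have "\<dots> = ennreal (\<rho> z) * ennreal (LINT x|lborel. norm (c x) * norm (f (x + z) - f x))"
      by (subst nn_integral_eq_integral[OF int]) auto
    also have "\<dots> \<le> ennreal (\<rho> z) * ennreal e"
      using le[of z] \<rho>(2)[of z] by (cases "z \<in> S") (auto intro!: mult_left_mono ennreal_leI)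
    finally show "(\<integral>\<^sup>+x. ennreal (\<rho> z * (norm (c x) * norm (f (x + z) - f x))) \<partial>lborel) \<le> ennreal (\<rho> z) * ennreal e" .
  qed
  also have "\<dots> = (\<integral>\<^sup>+z. ennreal (\<rho> z) \<partial>lborel) * ennreal e"
    by (rule nn_integral_multc) measurable
  also have "(\<integral>\<^sup>+z. ennreal (\<rho> z) \<partial>lborel) = 1"
    using nn_integral_eq_integral[OF \<rho>i] \<rho> by simp
  finally show ?thesis by simp
qed

text \<open>The exchange of integrals uses the product of two Borel measures, and the composition of a merely
Lebesgue measurable function with addition need not be measurable there. Mollification does not see the
change to a Borel version.\<close>

lemma lebesgue_complex_borel_version:
  fixes f :: "'a::euclidean_space \<Rightarrow> complex"
  assumes [measurable]: "f \<in> borel_measurable lebesgue"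
  obtains g where "g \<in> borel_measurable borel" "AE x in lebesgue. f x = g x"
proof -
  obtain p q where [measurable]: "p \<in> borel_measurable lborel" "q \<in> borel_measurable lborel"
    and ae: "AE x in lborel. Re (f x) = p x" "AE x in lborel. Im (f x) = q x"
    using completion_ex_borel_measurable_real[of "\<lambda>x. Re (f x)" lborel]
      completion_ex_borel_measurable_real[of "\<lambda>x. Im (f x)" lborel] by auto
  have "(\<lambda>x. complex_of_real (p x) + \<i> * complex_of_real (q x)) \<in> borel_measurable lborel"
    by measurable
  moreover have "AE x in lebesgue. f x = complex_of_real (p x) + \<i> * complex_of_real (q x)"
    using AE_completion[OF ae(1)] AE_completion[OF ae(2)]
    by eventually_elim (metis complex_eq)
  ultimately show thesis by (intro that) auto
qed

lemma uniform_continuous_bounded_support: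
  fixes k :: "'a::euclidean_space \<Rightarrow> 'b::real_normed_vector"
  assumes k: "continuous_on UNIV k" and R: "\<And>z. R < norm z \<Longrightarrow> k z = 0" and e: "0 < e"
  shows "\<exists>d>0. \<forall>w z. dist w z < d \<longrightarrow> dist (k w) (k z) < e"
proof -
  have "uniformly_continuous_on (cball 0 (R + 1)) k"
    by (intro compact_uniformly_continuous continuous_on_subset[OF k]) auto
  then obtain d where d: "0 < d"
    "\<And>w z. w \<in> cball 0 (R + 1) \<Longrightarrow> z \<in> cball 0 (R + 1) \<Longrightarrow> dist w z < d \<Longrightarrow> dist (k w) (k z) < e"
    using e unfolding uniformly_continuous_on_def by metis
  show ?thesis
  proof (intro exI[of _ "min d 1"] conjI allI impI)
    fix w z :: 'a assume wz: "dist w z < min d 1"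
    show "dist (k w) (k z) < e"
    proof (cases "w \<in> cball 0 (R + 1) \<and> z \<in> cball 0 (R + 1)")
      case True
      then show ?thesis using d(2) wz by simp
    next
      case False
      have "norm w \<le> norm z + dist w z" "norm z \<le> norm w + dist w z"
        using norm_triangle_sub[of w z] norm_triangle_sub[of z w] by (simp_all add: dist_norm norm_minus_commute)
      then have "R < norm w" "R < norm z" using False wz by auto
      then show ?thesis using R e by simp
    qed
  qed (use d in auto)
qed

lemma bounded_of_bounded_support:
  fixes k :: "'a::euclidean_space \<Rightarrow> 'b::real_normed_vector"
  assumes k: "continuous_on UNIV k" and R: "\<And>z. R < norm z \<Longrightarrow> k z = 0"
  shows "\<exists>B\<ge>0. \<forall>z. norm (k z) \<le> B"
proof -
  have "bounded (k ` cball 0 R)"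
    by (intro compact_imp_bounded compact_continuous_image continuous_on_subset[OF k]) auto
  then obtain B where B: "\<And>z. z \<in> cball 0 R \<Longrightarrow> norm (k z) \<le> B"
    unfolding bounded_iff by blast
  show ?thesis
  proof (intro exI[of _ "max B 0"] conjI allI)
    fix z show "norm (k z) \<le> max B 0"
      using B[of z] R[of z] by (cases "norm z \<le> R") auto
  qed simp
qed

lemma partial_deriv_zero_open:
  assumes "open U" "x \<in> U" "\<And>y. y \<in> U \<Longrightarrow> f y = 0"
  shows "partial_deriv i f x = 0"
proof -
  have "(f has_derivative (\<lambda>h. 0)) (at x)"
    by (rule has_derivative_transform_within_open[OF has_derivative_const[of 0] assms(1,2)]) (simp add: assms(3))
  from partial_deriv_eq[OF this] show ?thesis .
qed

lemma partial_deriv_support: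
  assumes R: "\<And>z. R < norm z \<Longrightarrow> k z = 0" and z: "R < norm z"
  shows "partial_deriv i k z = 0"
proof (rule partial_deriv_zero_open[of "- cball 0 R"])
  show "open (- cball 0 R :: (real^3) set)" by (simp add: open_Compl)
qed (use z R in auto)

lemma frechet_derivative_partial_sum:
  fixes k :: "real^3 \<Rightarrow> 'b::real_normed_vector"
  assumes "k differentiable (at z)"
  shows "frechet_derivative k (at z) h = (\<Sum>i\<in>UNIV. h $ i *\<^sub>R partial_deriv i k z)"
proof -
  have "bounded_linear (frechet_derivative k (at z))"
    using assms frechet_derivative_works has_derivative_bounded_linear by blast
  then have L: "linear (frechet_derivative k (at z))" by (rule bounded_linear.linear)
  have "h = (\<Sum>i\<in>UNIV. h $ i *\<^sub>R axis i 1)"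
    using basis_expansion[of h] by (simp add: scalar_mult_eq_scaleR)
  then have "frechet_derivative k (at z) h = frechet_derivative k (at z) (\<Sum>i\<in>UNIV. h $ i *\<^sub>R axis i 1)"
    by simp
  then show ?thesis
    by (simp add: linear_sum[OF L] linear_cmul[OF L] frechet_partial)
qed

text \<open>The mean value inequality on the segment from \<open>z\<close> to \<open>z + h\<close>, combined with the uniform continuity
of the partial derivatives.\<close>

lemma uniform_derivative_bounded_support:
  fixes k :: "real^3 \<Rightarrow> complex"
  assumes k: "C_k 1 k" and R: "\<And>z. R < norm z \<Longrightarrow> k z = 0" and e: "0 < e"
  shows "\<exists>d>0. \<forall>z h. norm h < d \<longrightarrow> norm (k (z + h) - k z - (\<Sum>i\<in>UNIV. h $ i *\<^sub>R partial_deriv i k z)) \<le> norm h * e"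
proof -
  have diff: "k differentiable (at z)" for z using k by simp
  have "\<exists>d>0. \<forall>w z. dist w z < d \<longrightarrow> dist (partial_deriv i k w) (partial_deriv i k z) < e / 3" for i
  proof (rule uniform_continuous_bounded_support[where R = R])
    show "continuous_on UNIV (partial_deriv i k)" using k by simp
    show "R < norm z \<Longrightarrow> partial_deriv i k z = 0" for z by (rule partial_deriv_support[OF R])
  qed (use e in simp)
  then obtain D where D: "\<And>i. 0 < D i"
    "\<And>i w z. dist w z < D i \<Longrightarrow> dist (partial_deriv i k w) (partial_deriv i k z) < e / 3" by metis
  define d where "d = Min (range D)"
  have d0: "0 < d" unfolding d_def using D(1) by (subst Min_gr_iff) auto
  have dD: "d \<le> D i" for i unfolding d_def by (rule Min_le) auto
  show ?thesis
  proof (intro exI[of _ d] conjI allI impI d0)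
    fix z h :: "real^3" assume h: "norm h < d"
    let ?S = "closed_segment z (z + h)" and ?K = "\<lambda>w. frechet_derivative k (at w)"
    have 1: "z + t *\<^sub>R (z + h - z) \<in> ?S" if "t \<in> {0..1}" for t
      using that unfolding in_segment by (intro exI[of _ t]) (simp add: algebra_simps)
    have 2: "(k has_derivative ?K w) (at w within ?S)" for w
      by (rule has_derivative_at_withinI[OF diff[unfolded frechet_derivative_works]])
    have 3: "onorm (?K w - ?K z) \<le> e" if w: "w \<in> ?S" for w
    proof (rule onorm_bound)
      fix v
      have "dist w z < d" using segment_bound1[OF w] h by (simp add: dist_norm)
      then have "dist w z < D i" for i using dD[of i] by simp
      note DD = D(2)[OF this, unfolded dist_norm]
      have "(?K w - ?K z) v = (\<Sum>i\<in>UNIV. v $ i *\<^sub>R (partial_deriv i k w - partial_deriv i k z))"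
        by (simp add: frechet_derivative_partial_sum[OF diff] sum_subtractf scaleR_diff_right)
      also have "norm \<dots> \<le> (\<Sum>i\<in>UNIV. norm (v $ i *\<^sub>R (partial_deriv i k w - partial_deriv i k z)))"
        by (rule norm_sum)
      also have "\<dots> \<le> (\<Sum>i\<in>(UNIV::3 set). norm v * (e / 3))"
      proof (rule sum_mono)
        fix i :: 3
        have "\<bar>v $ i\<bar> * norm (partial_deriv i k w - partial_deriv i k z) \<le> norm v * (e / 3)"
          using component_le_norm_cart[of v i] DD[of i] by (intro mult_mono) auto
        then show "norm (v $ i *\<^sub>R (partial_deriv i k w - partial_deriv i k z)) \<le> norm v * (e / 3)"
          by simp
      qed
      also have "\<dots> = e * norm v" by simp
      finally show "norm ((?K w - ?K z) v) \<le> e * norm v" .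
    qed (use e in simp)
    have "norm (k (z + h) - k z - ?K z (z + h - z)) \<le> norm (z + h - z) * e"
      by (rule differentiable_bound_linearization[OF 1 2 3]) auto
    then show "norm (k (z + h) - k z - (\<Sum>i\<in>UNIV. h $ i *\<^sub>R partial_deriv i k z)) \<le> norm h * e"
      by (simp add: frechet_derivative_partial_sum[OF diff])
  qed
qed

lemma integrable_mult_bounded:
  fixes f b :: "'a \<Rightarrow> complex"
  assumes f: "integrable M f" and [measurable]: "b \<in> borel_measurable M"
    and B: "AE x in M. norm (b x) \<le> B"
  shows "integrable M (\<lambda>x. f x * b x)"
proof -
  have [measurable]: "f \<in> borel_measurable M" using f by (rule borel_measurable_integrable)
  show ?thesis
  proof (rule Bochner_Integration.integrable_bound[OF integrable_mult_right[OF f, of "of_real B"]])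
    show "AE x in M. norm (f x * b x) \<le> norm (of_real B * f x)"
      using B
    proof eventually_elim
      case (elim x)
      then have "norm (b x) \<le> \<bar>B\<bar>" by linarith
      then show ?case by (simp add: norm_mult mult.commute mult_right_mono)
    qed
  qed measurable
qed

lemma continuous_lebesgue_measurable:
  fixes f :: "'a::euclidean_space \<Rightarrow> 'b::topological_space"
  assumes "continuous_on UNIV f"
  shows "f \<in> borel_measurable lebesgue"
  by (rule measurable_completion) (simp add: borel_measurable_continuous_onI[OF assms])

lemma mollify_integrable:
  fixes f k :: "'a::euclidean_space \<Rightarrow> complex"
  assumes f: "integrable lebesgue f" and k: "continuous_on UNIV k" and R: "\<And>z. R < norm z \<Longrightarrow> k z = 0"
  shows "integrable lebesgue (\<lambda>y. f y * k (y - x))"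
proof -
  obtain B where B: "0 \<le> B" "\<And>z. norm (k z) \<le> B" using bounded_of_bounded_support[OF k R] by blast
  have "continuous_on UNIV (\<lambda>y. k (y - x))"
    by (rule continuous_on_compose2[OF k]) (simp_all add: continuous_on_diff)
  then have m: "(\<lambda>y. k (y - x)) \<in> borel_measurable lebesgue"
    by (rule continuous_lebesgue_measurable)
  show ?thesis
    by (rule integrable_mult_bounded[OF f m, where B = B]) (simp add: B)
qed

text \<open>Differentiation under the integral sign: the linearisation error of the kernel is uniform, and \<open>f\<close> is
integrable. The minus sign comes from the argument \<open>y - x\<close> of the kernel.\<close>

lemma mollify_has_derivative:
  fixes k f :: "real^3 \<Rightarrow> complex"
  assumes k: "C_k 1 k" and R: "\<And>z. R < norm z \<Longrightarrow> k z = 0" and f: "integrable lebesgue f"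
  shows "(mollify k f has_derivative (\<lambda>h. \<Sum>i\<in>UNIV. h $ i *\<^sub>R mollify (\<lambda>z. - partial_deriv i k z) f x)) (at x)"
  unfolding has_derivative_at_alt
proof (intro conjI allI impI)
  show "bounded_linear (\<lambda>h::real^3. \<Sum>i\<in>UNIV. h $ i *\<^sub>R mollify (\<lambda>z. - partial_deriv i k z) f x)"
    by (rule bounded_linear_sum) (rule bounded_linear_scaleR_const[OF bounded_linear_vec_nth])
  fix e :: real assume e: "0 < e"
  define F where "F = (LINT y|lebesgue. norm (f y))"
  have F: "0 \<le> F" by (simp add: F_def)
  have e': "0 < e / (F + 1)" using e F by simp
  obtain d where d: "0 < d"
    "\<And>z h. norm h < d \<Longrightarrow> norm (k (z + h) - k z - (\<Sum>i\<in>UNIV. h $ i *\<^sub>R partial_deriv i k z)) \<le> norm h * (e / (F + 1))"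
    using uniform_derivative_bounded_support[OF k R e'] by blast
  have kc: "continuous_on UNIV k" using k by (rule C_k_continuous)
  have dkc: "continuous_on UNIV (\<lambda>z. - partial_deriv i k z)" for i
    by (rule continuous_on_minus) (use k in simp)
  have dkR: "R < norm z \<Longrightarrow> - partial_deriv i k z = 0" for i z using partial_deriv_support[OF R] by simp
  note i1 = mollify_integrable[OF f kc R]
  note i2 = mollify_integrable[OF f dkc dkR]
  show "\<exists>d>0. \<forall>y. norm (y - x) < d \<longrightarrow> norm (mollify k f y - mollify k f x -
      (\<Sum>i\<in>UNIV. (y - x) $ i *\<^sub>R mollify (\<lambda>z. - partial_deriv i k z) f x)) \<le> e * norm (y - x)"
  proof (intro exI[of _ d] conjI allI impI d(1))
    fix w :: "real^3" assume w: "norm (w - x) < d"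
    let ?E = "\<lambda>y. f y * k (y - w) - f y * k (y - x) - (\<Sum>i\<in>UNIV. (w - x) $ i *\<^sub>R (f y * - partial_deriv i k (y - x)))"
    have iw: "integrable lebesgue (\<lambda>y. f y * k (y - w))" by (rule i1)
    have ix: "integrable lebesgue (\<lambda>y. f y * k (y - x))" by (rule i1)
    have i3: "integrable lebesgue (\<lambda>y. (w - x) $ i *\<^sub>R (f y * - partial_deriv i k (y - x)))" for i
      by (intro integrable_scaleR_right i2)
    have i4: "integrable lebesgue (\<lambda>y. \<Sum>i\<in>UNIV. (w - x) $ i *\<^sub>R (f y * - partial_deriv i k (y - x)))"
      by (intro Bochner_Integration.integrable_sum i3)
    have iE: "integrable lebesgue ?E"
      by (intro Bochner_Integration.integrable_diff iw ix i4)
    have "(LINT y|lebesgue. ?E y) = (LINT y|lebesgue. f y * k (y - w)) - (LINT y|lebesgue. f y * k (y - x))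
       - (LINT y|lebesgue. (\<Sum>i\<in>UNIV. (w - x) $ i *\<^sub>R (f y * - partial_deriv i k (y - x))))"
      by (simp only: Bochner_Integration.integral_diff[OF Bochner_Integration.integrable_diff[OF iw ix] i4]
          Bochner_Integration.integral_diff[OF iw ix])
    also have "(LINT y|lebesgue. (\<Sum>i\<in>UNIV. (w - x) $ i *\<^sub>R (f y * - partial_deriv i k (y - x)))) =
      (\<Sum>i\<in>UNIV. (LINT y|lebesgue. (w - x) $ i *\<^sub>R (f y * - partial_deriv i k (y - x))))"
      by (rule Bochner_Integration.integral_sum[OF i3])
    finally have eq: "mollify k f w - mollify k f x - (\<Sum>i\<in>UNIV. (w - x) $ i *\<^sub>R mollify (\<lambda>z. - partial_deriv i k z) f x) =
      (LINT y|lebesgue. ?E y)"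
      by (simp only: mollify_def integral_scaleR_right)
    have "norm (mollify k f w - mollify k f x - (\<Sum>i\<in>UNIV. (w - x) $ i *\<^sub>R mollify (\<lambda>z. - partial_deriv i k z) f x))
        \<le> (LINT y|lebesgue. norm (?E y))"
      unfolding eq by (rule integral_norm_bound)
    also have "\<dots> \<le> (LINT y|lebesgue. norm (f y) * (norm (w - x) * (e / (F + 1))))"
    proof (rule integral_mono)
      fix y
      have *: "?E y = f y * (k ((y - x) + (x - w)) - k (y - x) - (\<Sum>i\<in>UNIV. (x - w) $ i *\<^sub>R partial_deriv i k (y - x)))"
      proof -
        have "(\<Sum>i\<in>UNIV. (w - x) $ i *\<^sub>R (f y * - partial_deriv i k (y - x))) =
            f y * (\<Sum>i\<in>UNIV. (x - w) $ i *\<^sub>R partial_deriv i k (y - x))"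
          unfolding sum_distrib_left by (rule sum.cong) (auto simp: scaleR_conv_of_real algebra_simps)
        then show ?thesis by (simp only:) (simp add: right_diff_distrib)
      qed
      show "norm (?E y) \<le> norm (f y) * (norm (w - x) * (e / (F + 1)))"
        unfolding * norm_mult using d(2)[of "x - w" "y - x"] w
        by (intro mult_left_mono) (auto simp: norm_minus_commute)
    qed (use iE f in auto)
    also have "\<dots> = F * (norm (w - x) * (e / (F + 1)))" by (simp add: F_def)
    also have "\<dots> = (F / (F + 1)) * (e * norm (w - x))" by simp
    also have "\<dots> \<le> 1 * (e * norm (w - x))"
      using F e by (intro mult_right_mono) auto
    finally show "norm (mollify k f w - mollify k f x - (\<Sum>i\<in>UNIV. (w - x) $ i *\<^sub>R mollify (\<lambda>z. - partial_deriv i k z) f x))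
        \<le> e * norm (w - x)" by simp
  qed
qed

lemma partial_deriv_mollify:
  fixes k f :: "real^3 \<Rightarrow> complex"
  assumes "C_k 1 k" "\<And>z. R < norm z \<Longrightarrow> k z = 0" "integrable lebesgue f"
  shows "partial_deriv i (mollify k f) x = mollify (\<lambda>z. - partial_deriv i k z) f x"
proof -
  have "(\<Sum>j\<in>UNIV. (axis i 1 :: real^3) $ j *\<^sub>R mollify (\<lambda>z. - partial_deriv j k z) f x) = mollify (\<lambda>z. - partial_deriv i k z) f x"
    by (subst sum.remove[of _ i]) (auto simp: axis_def intro!: sum.neutral)
  with partial_deriv_eq[OF mollify_has_derivative[OF assms]] show ?thesis by simp
qed

lemma C_k_mollify:
  fixes k f :: "real^3 \<Rightarrow> complex"
  assumes "\<And>z. R < norm z \<Longrightarrow> k z = 0" and f: "integrable lebesgue f"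
  shows "C_k (Suc m) k \<Longrightarrow> C_k m (mollify k f)"
  using assms(1)
proof (induction m arbitrary: k)
  case 0
  have "mollify k f differentiable (at x)" for x
    using mollify_has_derivative[of k R f x] 0 f by (auto simp: differentiable_def simp del: C_k.simps)
  then show ?case by (rule C_k_0I)
next
  case (Suc m)
  have k1: "C_k 1 k" using C_k_antimono[OF _ Suc.prems(1), of 1] by simp
  have "C_k m (partial_deriv i (mollify k f))" for i
  proof -
    have "partial_deriv i (mollify k f) = mollify (\<lambda>z. - partial_deriv i k z) f"
      using partial_deriv_mollify[OF k1 Suc.prems(2) f] by blast
    moreover have "C_k m (mollify (\<lambda>z. - partial_deriv i k z) f)"
    proof (rule Suc.IH)
      show "C_k (Suc m) (\<lambda>z. - partial_deriv i k z)"
        by (intro C_k_minus C_k_partial_deriv Suc.prems)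
      show "R < norm z \<Longrightarrow> - partial_deriv i k z = 0" for z
        using partial_deriv_support[OF Suc.prems(2)] by simp
    qed
    ultimately show ?thesis by simp
  qed
  moreover have "mollify k f differentiable (at x)" for x
    using mollify_has_derivative[OF k1 Suc.prems(2) f] by (auto simp: differentiable_def)
  ultimately show ?case by simp
qed

text \<open>The integral of \<open>g (y - x)\<close> over \<open>y\<close> does not depend on \<open>x\<close>; its derivative with respect to \<open>x\<close>
is minus the integral of the partial derivative. To reuse the derivative of a mollification, the integral is
written as the mollification of the indicator of a large ball, which agrees with it for small \<open>x\<close>.\<close>

lemma integral_partial_deriv_eq_0:
  fixes g :: "real^3 \<Rightarrow> complex"
  assumes g: "C_k 1 g" and R: "\<And>z. R < norm z \<Longrightarrow> g z = 0"
  shows "(LINT x|lebesgue. partial_deriv i g x) = 0"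
proof -
  define f :: "real^3 \<Rightarrow> complex" where "f = (\<lambda>y. of_real (indicator (ball 0 (R + 1)) y))"
  have f: "integrable lebesgue f"
    unfolding f_def using lmeasurable_ball[of "0 :: real^3" "R + 1"]
    by (intro integrable_of_real integrable_real_indicator) (auto simp: fmeasurable_def)
  have one: "f y = 1" if "norm y \<le> R" for y using that by (simp add: f_def)
  have const: "mollify g f x = mollify g f 0" if "x \<in> ball 0 1" for x
  proof -
    have gc: "continuous_on UNIV g" using g by (rule C_k_continuous)
    then have [measurable]: "g \<in> borel_measurable borel" by (rule borel_measurable_continuous_onI)
    have "mollify g f x = (LINT y|lebesgue. g (y - x))"
      unfolding mollify_def
    proof (rule Bochner_Integration.integral_cong)
      fix y
      have "norm y \<le> norm (y - x) + norm x" using norm_triangle_ineq[of "y - x" x] by simp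
      then show "f y * g (y - x) = g (y - x)"
        using that R[of "y - x"] by (cases "R < norm (y - x)") (auto simp: f_def)
    qed simp
    also have "\<dots> = (LINT y|lborel. g (y + - x))"
      by (subst integral_completion) auto
    also have "\<dots> = (LINT y|lborel. g y)" by (rule lborel_integral_translation)
    also have "\<dots> = (LINT y|lebesgue. f y * g y)"
      by (subst integral_completion[symmetric], measurable, rule Bochner_Integration.integral_cong)
        (use one R in \<open>auto simp: not_less[symmetric]\<close>)
    also have "\<dots> = mollify g f 0" by (simp add: mollify_def)
    finally show ?thesis .
  qed
  have "((\<lambda>x. mollify g f 0) has_derivative (\<lambda>h. \<Sum>i\<in>UNIV. h $ i *\<^sub>R mollify (\<lambda>z. - partial_deriv i g z) f 0)) (at 0)"
    by (rule has_derivative_transform_within_open[OF mollify_has_derivative[OF g R f] open_ball[of 0 1] _ const]) simp_all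
  from trans[OF partial_deriv_eq[OF this, of i, symmetric] partial_deriv_eq[OF has_derivative_const]]
  have "(\<Sum>j\<in>UNIV. (axis i 1 :: real^3) $ j *\<^sub>R mollify (\<lambda>z. - partial_deriv j g z) f 0) = 0" .
  moreover have "(\<Sum>j\<in>UNIV. (axis i 1 :: real^3) $ j *\<^sub>R mollify (\<lambda>z. - partial_deriv j g z) f 0) = mollify (\<lambda>z. - partial_deriv i g z) f 0"
    by (subst sum.remove[of _ i]) (auto simp: axis_def intro!: sum.neutral)
  ultimately have "0 = (LINT y|lebesgue. f y * - partial_deriv i g (y - 0))" by (simp add: mollify_def)
  also have "\<dots> = (LINT y|lebesgue. - partial_deriv i g y)"
  proof (rule Bochner_Integration.integral_cong)
    fix y show "f y * - partial_deriv i g (y - 0) = - partial_deriv i g y"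
      using one[of y] partial_deriv_support[where R = R and k = g and z = y and i = i, OF R] by (cases "R < norm y") auto
  qed simp
  finally show ?thesis by simp
qed

section \<open>Smoothing kernels\<close>

text \<open>Kernels are complex valued, since they serve as test functions for complex fields, but they come from real
probability densities. The centre \<open>a\<close> of the support is arbitrary.\<close>

definition smoothing_kernel :: "real^3 \<Rightarrow> real \<Rightarrow> (real^3 \<Rightarrow> complex) \<Rightarrow> bool" where
  "smoothing_kernel a r k \<longleftrightarrow> (\<exists>\<rho>. k = (\<lambda>z. of_real (\<rho> z)) \<and>
     smooth \<rho> \<and> (\<forall>z. 0 \<le> \<rho> z) \<and> (\<forall>z. z \<notin> cball a r \<longrightarrow> \<rho> z = 0) \<and> (LINT z|lborel. \<rho> z) = 1)"

lemma continuous_bounded_support_integrable: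
  fixes f :: "'a::euclidean_space \<Rightarrow> 'b::{banach, second_countable_topology}"
  assumes f: "continuous_on UNIV f" and R: "\<And>z. R < norm z \<Longrightarrow> f z = 0"
  shows "integrable lborel f"
proof -
  have "integrable lborel (\<lambda>x. indicator (cball 0 R) x *\<^sub>R f x)"
    by (rule borel_integrable_compact) (auto intro: continuous_on_subset[OF f])
  moreover have "(\<lambda>x. indicator (cball 0 R) x *\<^sub>R f x) = f"
    using R by (auto simp: indicator_def not_le)
  ultimately show ?thesis by simp
qed

lemma smooth_continuous: "smooth f \<Longrightarrow> continuous_on S f"
  unfolding smooth_def using C_k_continuous by blast

lemma smoothing_kernel_exists:
  assumes r: "0 < r"
  shows "\<exists>k. smoothing_kernel a r k"
proof -
  let ?b = "bump a r"
  have z: "?b x = 0" if "x \<notin> cball a r" for x :: "real^3"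
    using bump_eq_0[OF r, of x a] that by auto
  have c: "continuous_on UNIV ?b" by (rule smooth_continuous[OF smooth_bump])
  have i: "integrable lborel ?b"
  proof (rule continuous_bounded_support_integrable[OF c])
    fix x :: "real^3" assume "norm a + r < norm x"
    then have "x \<notin> cball a r" using norm_triangle_ineq2[of x a] by (auto simp: dist_norm norm_minus_commute)
    then show "?b x = 0" by (rule z)
  qed
  have "(LINT x|lborel. ?b x) \<noteq> 0"
  proof
    assume "(LINT x|lborel. ?b x) = 0"
    then have "AE x in lborel. ?b x = 0"
      using integral_nonneg_eq_0_iff_AE[OF i] bump_nonneg by auto
    then have "AE x in lborel. x \<notin> ball a r"
      by eventually_elim (metis bump_pos_iff[OF r] less_irrefl)
    then have "ball a r \<in> null_sets lborel"
      by (subst (asm) AE_iff_null_sets[symmetric]) auto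
    then have "negligible (ball a r)"
      by (simp add: negligible_iff_null_sets null_sets_completionI)
    then show False using open_not_negligible[of "ball a r"] r by simp
  qed
  moreover have "(LINT x|lborel. ?b x) \<ge> 0" using bump_nonneg by simp
  ultimately have pos: "0 < (LINT x|lborel. ?b x)" by linarith
  define \<rho> where "\<rho> x = inverse (LINT x|lborel. ?b x) * ?b x" for x
  have "smooth \<rho>"
    unfolding smooth_def \<rho>_def using smooth_bump unfolding smooth_def by (intro allI C_k_mult[OF C_k_const]) blast
  moreover have "0 \<le> \<rho> z" for z using pos bump_nonneg by (simp add: \<rho>_def)
  moreover have "z \<notin> cball a r \<Longrightarrow> \<rho> z = 0" for z using z by (simp add: \<rho>_def)
  moreover have "(LINT z|lborel. \<rho> z) = 1" using pos by (simp add: \<rho>_def)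
  ultimately show ?thesis unfolding smoothing_kernel_def by blast
qed

lemma smoothing_kernel_smooth: "smoothing_kernel a r k \<Longrightarrow> C_k m k"
  unfolding smoothing_kernel_def smooth_def
  using C_k_bounded_linear[OF bounded_linear_of_real] by blast

lemma smoothing_kernel_zero: "smoothing_kernel a r k \<Longrightarrow> z \<notin> cball a r \<Longrightarrow> k z = 0"
  unfolding smoothing_kernel_def by auto

lemma smoothing_kernel_zero_norm: "smoothing_kernel a r k \<Longrightarrow> norm a + r < norm z \<Longrightarrow> k z = 0"
  by (rule smoothing_kernel_zero) (use norm_triangle_ineq2[of z a] in \<open>auto simp: dist_norm norm_minus_commute\<close>)

lemma test_functionsI:
  assumes "smooth f" "compact K" "K \<subseteq> \<Omega>" "\<And>x. x \<notin> K \<Longrightarrow> f x = 0"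
  shows "f \<in> test_functions \<Omega>"
proof -
  have "closure {x. f x \<noteq> 0} \<subseteq> K"
    using assms(4) compact_imp_closed[OF assms(2)] by (intro closure_minimal) auto
  then show ?thesis
    using assms compact_Int_closed[OF assms(2) closed_closure, of "{x. f x \<noteq> 0}"]
    by (auto simp: test_functions_def Int_absorb1)
qed

lemma test_functionsE:
  assumes "f \<in> test_functions \<Omega>"
  obtains K where "compact K" "K \<subseteq> \<Omega>" "\<And>x. x \<notin> K \<Longrightarrow> f x = 0"
proof (rule that)
  show "compact (closure {x. f x \<noteq> 0})" "closure {x. f x \<noteq> 0} \<subseteq> \<Omega>"
    using assms by (auto simp: test_functions_def)
  show "x \<notin> closure {x. f x \<noteq> 0} \<Longrightarrow> f x = 0" for x
    using closure_subset[of "{x. f x \<noteq> 0}"] by blast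
qed

lemma test_functions_C_k: "f \<in> test_functions \<Omega> \<Longrightarrow> C_k m f"
  by (simp add: test_functions_def smooth_def)

lemma test_functions_differentiable: "f \<in> test_functions \<Omega> \<Longrightarrow> f differentiable (at x)"
  using test_functions_C_k[of f \<Omega> 1] by simp

lemma test_functions_zero_norm:
  assumes "f \<in> test_functions \<Omega>"
  shows "\<exists>R. \<forall>x. R < norm x \<longrightarrow> f x = 0"
proof -
  obtain K where K: "compact K" "\<And>x. x \<notin> K \<Longrightarrow> f x = 0" using test_functionsE[OF assms] by metis
  obtain R where "\<And>x. x \<in> K \<Longrightarrow> norm x \<le> R"
    using compact_imp_bounded[OF K(1)] unfolding bounded_iff by blast
  then show ?thesis using K(2) by (intro exI[of _ R]) force
qed

lemma test_functions_linear:
  assumes L: "bounded_linear L" and f: "f \<in> test_functions \<Omega>"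
  shows "(\<lambda>x. L (f x)) \<in> test_functions \<Omega>"
proof (rule test_functionsE[OF f])
  fix K assume K: "compact K" "K \<subseteq> \<Omega>" "\<And>x. x \<notin> K \<Longrightarrow> f x = 0"
  have "smooth (\<lambda>x. L (f x))"
    unfolding smooth_def using C_k_bounded_linear[OF L test_functions_C_k[OF f]] by blast
  then show ?thesis
    using K linear_0[OF bounded_linear.linear[OF L]] by (intro test_functionsI[of _ K]) auto
qed

lemma test_functions_smooth_mult:
  fixes f h :: "real^3 \<Rightarrow> complex"
  assumes h: "smooth h" and f: "f \<in> test_functions \<Omega>"
  shows "(\<lambda>x. h x * f x) \<in> test_functions \<Omega>"
proof (rule test_functionsE[OF f])
  fix K assume K: "compact K" "K \<subseteq> \<Omega>" "\<And>x. x \<notin> K \<Longrightarrow> f x = 0"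
  have "smooth (\<lambda>x. h x * f x)"
    using h test_functions_C_k[OF f] unfolding smooth_def by (intro allI C_k_mult) auto
  then show ?thesis
    using K by (intro test_functionsI[of _ K]) auto
qed

text \<open>Against this test function, weak derivatives turn into derivatives of mollifications.\<close>

lemma smoothing_kernel_test_function:
  assumes k: "smoothing_kernel a r k" and "cball (x + a) r \<subseteq> \<Omega>"
  shows "(\<lambda>y. k (y - x)) \<in> test_functions \<Omega>"
proof (rule test_functionsI[OF _ compact_cball assms(2)])
  show "smooth (\<lambda>y. k (y - x))"
    unfolding smooth_def using C_k_shift[OF smoothing_kernel_smooth[OF k]] by blast
  fix y assume "y \<notin> cball (x + a) r"
  then have "y - x \<notin> cball a r" by (simp add: dist_norm algebra_simps)
  then show "k (y - x) = 0" by (rule smoothing_kernel_zero[OF k])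
qed

text \<open>The supports shrink to the origin without having to contain it.\<close>

lemma mollification_error_tendsto_0:
  fixes c f :: "real^3 \<Rightarrow> complex"
  assumes c: "integrable lebesgue c" "integrable lebesgue (\<lambda>x. (norm (c x))\<^sup>2)"
    and f: "integrable lebesgue f" "integrable lebesgue (\<lambda>x. (norm (f x))\<^sup>2)"
    and k: "\<And>n. smoothing_kernel (a n) (r n) (k n)"
    and lim: "(\<lambda>n. norm (a n) + r n) \<longlonglongrightarrow> 0"
  shows mollification_error_integrable: "integrable lebesgue (\<lambda>x. c x * (mollify (k n) f x - f x))"
    and "(\<lambda>n. LINT x|lebesgue. norm (c x * (mollify (k n) f x - f x))) \<longlonglongrightarrow> 0"
proof -
  obtain c' where [measurable]: "c' \<in> borel_measurable borel" and c': "AE x in lebesgue. c x = c' x"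
    using lebesgue_complex_borel_version[of c] c(1) by (metis borel_measurable_integrable)
  obtain f' where [measurable]: "f' \<in> borel_measurable borel" and f': "AE x in lebesgue. f x = f' x"
    using lebesgue_complex_borel_version[of f] f(1) by (metis borel_measurable_integrable)
  have [measurable]: "c \<in> borel_measurable lebesgue" "f \<in> borel_measurable lebesgue"
    using c f by auto
  have [measurable]: "c' \<in> borel_measurable lebesgue" "f' \<in> borel_measurable lebesgue"
    by (auto intro: measurable_completion)
  have "integrable lebesgue (\<lambda>x. (norm (c' x))\<^sup>2)"
    by (rule integrable_cong_AE_imp[OF c(2)]) (use c' in auto)
  then have c2: "integrable lborel (\<lambda>x. (norm (c' x))\<^sup>2)" by (subst (asm) integrable_completion) auto
  have "integrable lebesgue (\<lambda>x. (norm (f' x))\<^sup>2)"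
    by (rule integrable_cong_AE_imp[OF f(2)]) (use f' in auto)
  then have f2: "integrable lborel (\<lambda>x. (norm (f' x))\<^sup>2)" by (subst (asm) integrable_completion) auto
  have "integrable lebesgue f'"
    by (rule integrable_cong_AE_imp[OF f(1)]) (use f' in auto)
  then have f1: "integrable lborel f'" by (subst (asm) integrable_completion) auto
  have mollify': "mollify (k n) f x = mollify (k n) f' x" for n x
  proof -
    have "continuous_on UNIV (\<lambda>y. k n (y - x))"
      using C_k_shift[OF smoothing_kernel_smooth[OF k, of 0]] by simp
    then have [measurable]: "(\<lambda>y. k n (y - x)) \<in> borel_measurable lebesgue"
      by (rule continuous_lebesgue_measurable)
    show ?thesis unfolding mollify_def
      by (rule integral_cong_AE) (use f' in auto)
  qed
  have mc: "continuous_on UNIV (mollify (k n) f)" for n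
  proof (rule C_k_continuous)
    show "C_k 0 (mollify (k n) f)"
      by (rule C_k_mollify[where R = "norm (a n) + r n", OF _ f(1) smoothing_kernel_smooth[OF k]])
        (rule smoothing_kernel_zero_norm[OF k])
  qed
  then have [measurable]: "mollify (k n) f \<in> borel_measurable borel" for n
    by (rule borel_measurable_continuous_onI)
  have [measurable]: "mollify (k n) f \<in> borel_measurable lebesgue" for n
    by (auto intro: measurable_completion)
  note int = translation_weighted_integrable[OF \<open>c' \<in> borel_measurable borel\<close> c2 f1 f2]
  have bound: "(\<integral>\<^sup>+x. ennreal (norm (c x * (mollify (k n) f x - f x))) \<partial>lebesgue) \<le> ennreal e"
    if le: "\<And>z. z \<in> cball (a n) (r n) \<Longrightarrow> (LINT x|lborel. norm (c' x) * norm (f' (x + z) - f' x)) \<le> e" for n e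
  proof -
    obtain \<rho> where \<rho>: "k n = (\<lambda>z. of_real (\<rho> z))" "smooth \<rho>" "\<And>z. 0 \<le> \<rho> z"
       "\<And>z. z \<notin> cball (a n) (r n) \<Longrightarrow> \<rho> z = 0" "(LINT z|lborel. \<rho> z) = 1"
      using k[of n] unfolding smoothing_kernel_def by blast
    have cont: "continuous_on UNIV \<rho>" by (rule smooth_continuous[OF \<rho>(2)])
    have "\<rho> z = 0" if "norm (a n) + r n < norm z" for z
      using smoothing_kernel_zero_norm[OF k that] \<rho>(1) by simp
    then obtain B where B: "\<And>z. norm (\<rho> z) \<le> B"
      using bounded_of_bounded_support[OF cont] by blast
    have B': "\<rho> z \<le> B" for z
      by (rule order_trans[OF abs_ge_self B[unfolded real_norm_def]])
    have "(\<integral>\<^sup>+x. ennreal (norm (c x * (mollify (k n) f x - f x))) \<partial>lebesgue) =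
        (\<integral>\<^sup>+x. ennreal (norm (c' x) * norm (mollify (k n) f' x - f' x)) \<partial>lebesgue)"
      by (rule nn_integral_cong_AE) (use c' f' in eventually_elim, simp add: norm_mult mollify')
    also have "\<dots> = (\<integral>\<^sup>+x. ennreal (norm (c' x) * norm (mollify (k n) f' x - f' x)) \<partial>lborel)"
      by (rule nn_integral_completion)
    also have "\<dots> \<le> ennreal e"
      unfolding \<rho>(1)
    proof (rule mollification_error_bound[where S = "cball (a n) (r n)" and B = B])
      show "\<rho> \<in> borel_measurable borel" by (rule borel_measurable_continuous_onI[OF cont])
    qed (fact f1 int le \<rho>(3) \<rho>(4) B' \<rho>(5) \<open>c' \<in> borel_measurable borel\<close>)+
    finally show ?thesis .
  qed
  show i: "integrable lebesgue (\<lambda>x. c x * (mollify (k n) f x - f x))" for n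
  proof -
    obtain B where B: "\<And>z. norm (k n z) \<le> B"
      using bounded_of_bounded_support[of "k n", OF _ smoothing_kernel_zero_norm[OF k]]
        C_k_continuous[OF smoothing_kernel_smooth[OF k]] by blast
    have "norm (mollify (k n) f x) \<le> (LINT y|lebesgue. norm (f y) * B)" for x
    proof -
      have "norm (mollify (k n) f x) \<le> (LINT y|lebesgue. norm (f y * k n (y - x)))"
        unfolding mollify_def by (rule integral_norm_bound)
      also have "\<dots> \<le> (LINT y|lebesgue. norm (f y) * B)"
      proof (rule integral_mono)
        show "integrable lebesgue (\<lambda>y. norm (f y * k n (y - x)))"
          by (intro integrable_norm mollify_integrable[OF f(1) _ smoothing_kernel_zero_norm[OF k]]
              C_k_continuous[OF smoothing_kernel_smooth[OF k]])
      qed (use f B in \<open>auto simp: norm_mult intro!: mult_left_mono\<close>)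
      finally show ?thesis .
    qed
    then have "integrable lebesgue (\<lambda>x. c x * mollify (k n) f x)"
      by (intro integrable_mult_bounded[OF c(1)]) auto
    moreover have "integrable lebesgue (\<lambda>x. c x * f x)"
      by (rule square_integrable_mult_integrable) (use c f in measurable)
    ultimately show ?thesis
      by (simp add: right_diff_distrib)
  qed
  show "(\<lambda>n. LINT x|lebesgue. norm (c x * (mollify (k n) f x - f x))) \<longlonglongrightarrow> 0"
  proof (rule tendstoI)
    fix e :: real assume e: "0 < e"
    have "((\<lambda>z. LINT x|lborel. norm (c' x) * norm (f' (x + z) - f' x)) \<longlongrightarrow> 0) (at 0)"
      by (rule translation_tendsto_weighted[OF \<open>c' \<in> borel_measurable borel\<close> c2 f1 f2])
    then have "\<forall>\<^sub>F z in at 0. (LINT x|lborel. norm (c' x) * norm (f' (x + z) - f' x)) < e / 2"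
      by (rule order_tendstoD(2)) (use e in simp)
    then obtain d where d: "0 < d"
      "\<And>z. z \<noteq> 0 \<Longrightarrow> norm z < d \<Longrightarrow> (LINT x|lborel. norm (c' x) * norm (f' (x + z) - f' x)) < e / 2"
      by (auto simp: eventually_at dist_norm)
    have "\<forall>\<^sub>F n in sequentially. norm (a n) + r n < d"
      by (rule order_tendstoD(2)[OF lim d(1)])
    then show "\<forall>\<^sub>F n in sequentially. dist (LINT x|lebesgue. norm (c x * (mollify (k n) f x - f x))) 0 < e"
    proof eventually_elim
      case (elim n)
      have "(\<integral>\<^sup>+x. ennreal (norm (c x * (mollify (k n) f x - f x))) \<partial>lebesgue) \<le> ennreal (e / 2)"
      proof (rule bound)
        fix z assume "z \<in> cball (a n) (r n)"
        then have "norm z < d" using elim norm_triangle_sub[of z "a n"] by (simp add: dist_norm norm_minus_commute)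
        then show "(LINT x|lborel. norm (c' x) * norm (f' (x + z) - f' x)) \<le> e / 2"
          using d(2)[of z] e by (cases "z = 0") auto
      qed
      then have "(LINT x|lebesgue. norm (c x * (mollify (k n) f x - f x))) \<le> e / 2"
        using e i[of n] by (subst (asm) nn_integral_eq_integral) auto
      then show ?case using e by (simp add: integral_nonneg_AE)
    qed
  qed
qed

section \<open>Square-integrable functions on bounded open sets\<close>

lemma finite_measure_lebesgue_on_open:
  assumes "open \<Omega>" "bounded \<Omega>" shows "finite_measure (lebesgue_on \<Omega>)"
proof -
  have "\<Omega> \<in> lmeasurable"
    using assms by (intro bounded_set_imp_lmeasurable) auto
  then show ?thesis
    by (rule finite_measure_lebesgue_on)
qed

lemma L2_mult_integrable:
  fixes f g :: "real^3 \<Rightarrow> complex"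
  assumes "f \<in> L2 \<Omega>" "g \<in> L2 \<Omega>"
  shows "integrable (lebesgue_on \<Omega>) (\<lambda>x. f x * g x)"
  by (rule square_integrable_mult_integrable) (use assms in \<open>auto simp: L2_def\<close>)

lemma L2_bounded_mult:
  fixes f b :: "real^3 \<Rightarrow> complex"
  assumes f: "f \<in> L2 \<Omega>" and b: "b \<in> borel_measurable (lebesgue_on \<Omega>)" "AE x in lebesgue_on \<Omega>. norm (b x) \<le> B"
  shows "(\<lambda>x. f x * b x) \<in> L2 \<Omega>"
proof -
  have "integrable (lebesgue_on \<Omega>) (\<lambda>x. (norm (f x * b x))\<^sup>2)"
  proof (rule Bochner_Integration.integrable_bound)
    show "integrable (lebesgue_on \<Omega>) (\<lambda>x. B\<^sup>2 * (norm (f x))\<^sup>2)"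
      using f by (simp add: L2_def)
    show "(\<lambda>x. (norm (f x * b x))\<^sup>2) \<in> borel_measurable (lebesgue_on \<Omega>)"
      using f b by (auto simp: L2_def)
    show "AE x in lebesgue_on \<Omega>. norm ((norm (f x * b x))\<^sup>2) \<le> norm (B\<^sup>2 * (norm (f x))\<^sup>2)"
      using b(2) by eventually_elim (simp add: norm_mult power_mult_distrib mult.commute mult_right_mono power_mono)
  qed
  then show ?thesis using f b by (auto simp: L2_def)
qed

lemma L2_add:
  fixes f g :: "real^3 \<Rightarrow> complex"
  assumes f: "f \<in> L2 \<Omega>" and g: "g \<in> L2 \<Omega>"
  shows "(\<lambda>x. f x + g x) \<in> L2 \<Omega>"
proof -
  have "integrable (lebesgue_on \<Omega>) (\<lambda>x. (norm (f x + g x))\<^sup>2)"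
  proof (rule Bochner_Integration.integrable_bound)
    show "integrable (lebesgue_on \<Omega>) (\<lambda>x. 2 * (norm (f x))\<^sup>2 + 2 * (norm (g x))\<^sup>2)"
      using f g by (simp add: L2_def)
    show "(\<lambda>x. (norm (f x + g x))\<^sup>2) \<in> borel_measurable (lebesgue_on \<Omega>)"
      using f g by (auto simp: L2_def)
    have "(norm (u + v))\<^sup>2 \<le> 2 * (norm u)\<^sup>2 + 2 * (norm v)\<^sup>2" for u v :: complex
      using order_trans[OF power_mono[OF norm_triangle_ineq norm_ge_zero] square_sum_bound, of u v] by simp
    then show "AE x in lebesgue_on \<Omega>. norm ((norm (f x + g x))\<^sup>2) \<le> norm (2 * (norm (f x))\<^sup>2 + 2 * (norm (g x))\<^sup>2)"
      by (intro AE_I2) simp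
  qed
  then show ?thesis using f g by (auto simp: L2_def)
qed

lemma L2_cmult: "f \<in> L2 \<Omega> \<Longrightarrow> (\<lambda>x. c * f x) \<in> L2 \<Omega>" for f :: "real^3 \<Rightarrow> complex"
  by (auto simp: L2_def norm_mult power_mult_distrib)

lemma L2_minus: "f \<in> L2 \<Omega> \<Longrightarrow> (\<lambda>x. - f x) \<in> L2 \<Omega>" for f :: "real^3 \<Rightarrow> complex"
  by (simp add: L2_def)

lemma L2_diff: "f \<in> L2 \<Omega> \<Longrightarrow> g \<in> L2 \<Omega> \<Longrightarrow> (\<lambda>x. f x - g x) \<in> L2 \<Omega>" for f :: "real^3 \<Rightarrow> complex"
  using L2_add[OF _ L2_minus, of f \<Omega> g] by simp

lemma bounded_linear_axis: "bounded_linear (\<lambda>c. axis i c :: complex^3)"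
  by (rule linear_conv_bounded_linear[THEN iffD1])
    (auto intro!: linearI simp: vec_eq_iff axis_def)

lemma L2_vec_iff:
  fixes v :: "real^3 \<Rightarrow> complex^3"
  shows "v \<in> L2 \<Omega> \<longleftrightarrow> (\<forall>i. (\<lambda>x. v x $ i) \<in> L2 \<Omega>)"
proof -
  have m: "v \<in> borel_measurable (lebesgue_on \<Omega>) \<longleftrightarrow> (\<forall>i. (\<lambda>x. v x $ i) \<in> borel_measurable (lebesgue_on \<Omega>))"
  proof
    assume [measurable]: "v \<in> borel_measurable (lebesgue_on \<Omega>)"
    show "\<forall>i. (\<lambda>x. v x $ i) \<in> borel_measurable (lebesgue_on \<Omega>)"
      by (intro allI measurable_compose[OF \<open>v \<in> _\<close>] borel_measurable_continuous_onI continuous_on_component continuous_on_id)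
  next
    assume *: "\<forall>i. (\<lambda>x. v x $ i) \<in> borel_measurable (lebesgue_on \<Omega>)"
    have c: "continuous_on UNIV (\<lambda>c::complex. axis i c :: complex^3)" for i
      by (rule linear_continuous_on[OF bounded_linear_axis])
    have "(\<lambda>x. \<Sum>i\<in>UNIV. axis i (v x $ i)) \<in> borel_measurable (lebesgue_on \<Omega>)"
      using * by (intro borel_measurable_sum measurable_compose[OF _ borel_measurable_continuous_onI[OF c]]) auto
    moreover have "(\<Sum>i\<in>UNIV. axis i (v x $ i)) = v x" for x
      by (simp add: vec_eq_iff axis_def if_distrib sum.delta cong: if_cong)
    ultimately show "v \<in> borel_measurable (lebesgue_on \<Omega>)" by simp
  qed
  have n: "(norm (v x))\<^sup>2 = (\<Sum>i\<in>UNIV. (norm (v x $ i))\<^sup>2)" for x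
    by (simp add: norm_vec_def L2_set_def sum_nonneg)
  show ?thesis
  proof
    assume v: "v \<in> L2 \<Omega>"
    show "\<forall>i. (\<lambda>x. v x $ i) \<in> L2 \<Omega>"
    proof
      fix i
      have mi: "(\<lambda>x. v x $ i) \<in> borel_measurable (lebesgue_on \<Omega>)" using v m by (simp add: L2_def)
      have "integrable (lebesgue_on \<Omega>) (\<lambda>x. (norm (v x $ i))\<^sup>2)"
      proof (rule Bochner_Integration.integrable_bound)
        show "integrable (lebesgue_on \<Omega>) (\<lambda>x. (norm (v x))\<^sup>2)" using v by (simp add: L2_def)
        show "AE x in lebesgue_on \<Omega>. norm ((norm (v x $ i))\<^sup>2) \<le> norm ((norm (v x))\<^sup>2)"
          by (intro AE_I2) (simp add: Finite_Cartesian_Product.norm_nth_le power_mono)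
      qed (use mi in measurable)
      then show "(\<lambda>x. v x $ i) \<in> L2 \<Omega>" using mi by (simp add: L2_def)
    qed
  next
    assume "\<forall>i. (\<lambda>x. v x $ i) \<in> L2 \<Omega>"
    then show "v \<in> L2 \<Omega>" unfolding L2_def using m by (simp add: n)
  qed
qed

lemma L2_integrable:
  fixes f :: "real^3 \<Rightarrow> complex"
  assumes O: "open \<Omega>" "bounded \<Omega>" and f: "f \<in> L2 \<Omega>"
  shows "integrable (lebesgue_on \<Omega>) f"
proof -
  interpret finite_measure "lebesgue_on \<Omega>" by (rule finite_measure_lebesgue_on_open[OF O])
  have "(\<lambda>x. 1) \<in> L2 \<Omega>" by (simp add: L2_def)
  from L2_mult_integrable[OF f this] show ?thesis by simp
qed

lemma bounded_L2:
  fixes f :: "real^3 \<Rightarrow> complex"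
  assumes O: "open \<Omega>" "bounded \<Omega>" and f: "f \<in> borel_measurable (lebesgue_on \<Omega>)" "AE x in lebesgue_on \<Omega>. norm (f x) \<le> B"
  shows "f \<in> L2 \<Omega>"
proof -
  interpret finite_measure "lebesgue_on \<Omega>" by (rule finite_measure_lebesgue_on_open[OF O])
  have "(\<lambda>x. 1) \<in> L2 \<Omega>" by (simp add: L2_def)
  from L2_bounded_mult[OF this f] show ?thesis by simp
qed

lemma L2_continuous_mult:
  fixes f b :: "real^3 \<Rightarrow> complex"
  assumes O: "bounded \<Omega>" and b: "continuous_on UNIV b" and f: "f \<in> L2 \<Omega>"
  shows "(\<lambda>x. b x * f x) \<in> L2 \<Omega>"
proof -
  have "bounded (b ` closure \<Omega>)"
    using O by (intro compact_imp_bounded compact_continuous_image continuous_on_subset[OF b]) auto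
  then obtain B where B: "\<And>x. x \<in> closure \<Omega> \<Longrightarrow> norm (b x) \<le> B" unfolding bounded_iff by blast
  have "(\<lambda>x. f x * b x) \<in> L2 \<Omega>"
  proof (rule L2_bounded_mult[OF f])
    show "b \<in> borel_measurable (lebesgue_on \<Omega>)"
      using continuous_lebesgue_measurable[OF b] by (rule measurable_restrict_space1)
    show "AE x in lebesgue_on \<Omega>. norm (b x) \<le> B"
      using B closure_subset by (intro AE_I2) auto
  qed
  then show ?thesis by (simp add: mult.commute)
qed

lemma continuous_L2:
  fixes f :: "real^3 \<Rightarrow> complex"
  assumes O: "open \<Omega>" "bounded \<Omega>" and f: "continuous_on UNIV f"
  shows "f \<in> L2 \<Omega>"
proof -
  interpret finite_measure "lebesgue_on \<Omega>" by (rule finite_measure_lebesgue_on_open[OF O])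
  have "(\<lambda>x. 1) \<in> L2 \<Omega>" by (simp add: L2_def)
  from L2_continuous_mult[OF O(2) f this] show ?thesis by simp
qed

lemma L2_extension:
  fixes f :: "real^3 \<Rightarrow> complex"
  assumes O: "open \<Omega>" "bounded \<Omega>" and f: "f \<in> L2 \<Omega>"
  shows "integrable lebesgue (\<lambda>x. indicator \<Omega> x *\<^sub>R f x)"
    and "integrable lebesgue (\<lambda>x. (norm (indicator \<Omega> x *\<^sub>R f x))\<^sup>2)"
proof -
  show "integrable lebesgue (\<lambda>x. indicator \<Omega> x *\<^sub>R f x)"
    using L2_integrable[OF O f] O by (subst (asm) integrable_restrict_space) auto
  have "integrable lebesgue (\<lambda>x. indicator \<Omega> x *\<^sub>R (norm (f x))\<^sup>2)"
    using f O unfolding L2_def by (subst (asm) integrable_restrict_space) auto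
  moreover have "(\<lambda>x. indicator \<Omega> x *\<^sub>R (norm (f x))\<^sup>2) = (\<lambda>x. (norm (indicator \<Omega> x *\<^sub>R f x))\<^sup>2)"
    by (auto simp: indicator_def)
  ultimately show "integrable lebesgue (\<lambda>x. (norm (indicator \<Omega> x *\<^sub>R f x))\<^sup>2)" by simp
qed

lemma test_functions_L2:
  fixes f :: "real^3 \<Rightarrow> complex"
  assumes "open \<Omega>" "bounded \<Omega>" "f \<in> test_functions \<Omega>"
  shows "f \<in> L2 \<Omega>" and "partial_deriv i f \<in> L2 \<Omega>"
  using assms C_k_continuous[OF test_functions_C_k[OF assms(3), of 0]]
    C_k_continuous[OF C_k_partial_deriv[OF test_functions_C_k[OF assms(3), of "Suc 0"]]]
  by (auto intro: continuous_L2)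

lemma mollify_extension_eq:
  fixes f k :: "real^3 \<Rightarrow> complex"
  assumes "open \<Omega>"
  shows "mollify k (\<lambda>x. indicator \<Omega> x *\<^sub>R f x) x = (LINT y|lebesgue_on \<Omega>. f y * k (y - x))"
  using assms by (subst integral_restrict_space) (auto simp: mollify_def)

section \<open>Uniqueness of weak derivatives\<close>

text \<open>Around a point of \<open>\<Omega>\<close>, the mollifications with small kernels are integrals of \<open>g\<close> against test functions,
hence zero; along a subsequence they converge to \<open>g\<close> almost everywhere.\<close>

lemma fundamental_lemma:
  fixes g :: "real^3 \<Rightarrow> complex"
  assumes O: "open \<Omega>" "bounded \<Omega>" and g: "g \<in> L2 \<Omega>"
    and 0: "\<And>\<theta>. \<theta> \<in> test_functions \<Omega> \<Longrightarrow> (LINT x|lebesgue_on \<Omega>. g x * \<theta> x) = 0"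
  shows "AE x in lebesgue_on \<Omega>. g x = 0"
proof -
  define f where "f x = indicator \<Omega> x *\<^sub>R g x" for x
  define c :: "real^3 \<Rightarrow> complex" where "c x = indicator \<Omega> x *\<^sub>R 1" for x
  note f = L2_extension[OF O g, folded f_def]
  have c: "integrable lebesgue c" "integrable lebesgue (\<lambda>x. (norm (c x))\<^sup>2)"
    using L2_extension[OF O continuous_L2[OF O, of "\<lambda>x. 1"]] unfolding c_def by auto
  define r where "r n = 1 / (real n + 1)" for n
  have r: "0 < r n" for n by (simp add: r_def)
  have r0: "r \<longlonglongrightarrow> 0"
    unfolding r_def using LIMSEQ_inverse_real_of_nat by (simp add: inverse_eq_divide add.commute)
  obtain k where k: "\<And>n. smoothing_kernel 0 (r n) (k n)"
    using smoothing_kernel_exists[OF r] by metis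
  have lim: "(\<lambda>n. norm (0::real^3) + r n) \<longlonglongrightarrow> 0" using r0 by simp
  note i = mollification_error_integrable[OF c f k lim]
  have 1: "(\<lambda>n. LINT x|lebesgue. norm (c x * (mollify (k n) f x - f x))) \<longlonglongrightarrow> 0"
    by (rule mollification_error_tendsto_0[OF c f k lim])
  obtain s :: "nat \<Rightarrow> nat" where s: "strict_mono s"
    "AE x in lebesgue. (\<lambda>n. c x * (mollify (k (s n)) f x - f x)) \<longlonglongrightarrow> 0"
    using tendsto_L1_AE_subseq[OF i 1] by blast
  have "AE x in lebesgue. x \<in> \<Omega> \<longrightarrow> g x = 0"
    using s(2)
  proof eventually_elim
    case (elim x)
    show ?case
    proof
      assume x: "x \<in> \<Omega>"
      then obtain d where d: "0 < d" "cball x d \<subseteq> \<Omega>" using O(1) open_contains_cball by blast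
      have "(\<lambda>n. r (s n)) \<longlonglongrightarrow> 0" using LIMSEQ_subseq_LIMSEQ[OF r0 s(1)] by (simp add: o_def)
      then have "\<forall>\<^sub>F n in sequentially. r (s n) < d" by (rule order_tendstoD(2)) (rule d(1))
      then have "\<forall>\<^sub>F n in sequentially. c x * (mollify (k (s n)) f x - f x) = - g x"
      proof eventually_elim
        case (elim n)
        have "cball (x + 0) (r (s n)) \<subseteq> \<Omega>"
          using d(2) subset_cball[of "r (s n)" d x] elim by auto
        from 0[OF smoothing_kernel_test_function[OF k this]]
        have "mollify (k (s n)) f x = 0"
          using mollify_extension_eq[OF O(1), of "k (s n)" g x] unfolding f_def by simp
        then show ?case using x by (simp add: c_def f_def)
      qed
      with elim have "(\<lambda>n. - g x) \<longlonglongrightarrow> 0" by (rule Lim_transform_eventually)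
      then show "g x = 0" by (simp add: LIMSEQ_const_iff)
    qed
  qed
  then show ?thesis using O by (simp add: AE_restrict_space_iff)
qed

lemma fundamental_lemma_vec:
  fixes g :: "real^3 \<Rightarrow> complex^3"
  assumes O: "open \<Omega>" "bounded \<Omega>" and g: "g \<in> L2 \<Omega>"
    and 0: "\<And>\<theta>. \<theta> \<in> test_functions \<Omega> \<Longrightarrow> (LINT x|lebesgue_on \<Omega>. g x \<bullet>\<^sub>c \<theta> x) = 0"
  shows "AE x in lebesgue_on \<Omega>. g x = 0"
proof -
  have "AE x in lebesgue_on \<Omega>. g x $ i = 0" for i
  proof (rule fundamental_lemma[OF O])
    show "(\<lambda>x. g x $ i) \<in> L2 \<Omega>" using g L2_vec_iff by blast
    fix \<theta> :: "real^3 \<Rightarrow> complex" assume t: "\<theta> \<in> test_functions \<Omega>"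
    have "g x \<bullet>\<^sub>c axis i (\<theta> x) = g x $ i * \<theta> x" for x
      by (simp add: cdot_def axis_def if_distrib sum.delta cong: if_cong)
    then show "(LINT x|lebesgue_on \<Omega>. g x $ i * \<theta> x) = 0"
      using 0[OF test_functions_linear[OF bounded_linear_axis t, of i]] by simp
  qed
  then have "AE x in lebesgue_on \<Omega>. \<forall>i. g x $ i = 0"
    by (subst AE_all_countable) auto
  then show ?thesis by (simp add: vec_eq_iff)
qed

lemma cdot_3: "a \<bullet>\<^sub>c b = a $ 1 * b $ 1 + a $ 2 * b $ 2 + a $ 3 * b $ 3"
  by (simp add: cdot_def sum_3)

lemma L2_cdot_integrable:
  assumes "v \<in> L2 \<Omega>" "w \<in> L2 \<Omega>" shows "integrable (lebesgue_on \<Omega>) (\<lambda>x. v x \<bullet>\<^sub>c w x)"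
  unfolding cdot_def using assms L2_vec_iff by (intro Bochner_Integration.integrable_sum L2_mult_integrable) auto

lemma L2_diff_vec: "v \<in> L2 \<Omega> \<Longrightarrow> w \<in> L2 \<Omega> \<Longrightarrow> (\<lambda>x. v x - w x) \<in> L2 \<Omega>" for v w :: "real^3 \<Rightarrow> complex^3"
  using L2_diff by (auto simp: L2_vec_iff)

lemma test_functions_vec_L2:
  fixes f :: "real^3 \<Rightarrow> complex^3"
  assumes "open \<Omega>" "bounded \<Omega>" "f \<in> test_functions \<Omega>"
  shows "f \<in> L2 \<Omega>"
  unfolding L2_vec_iff
  using assms test_functions_linear[OF bounded_linear_vec_nth] by (blast intro: test_functions_L2)

lemma weak_curl_unique:
  assumes O: "open \<Omega>" "bounded \<Omega>" and c: "c \<in> L2 \<Omega>" "has_weak_curl \<Omega> v c" and d: "d \<in> L2 \<Omega>" "has_weak_curl \<Omega> v d"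
  shows "AE x in lebesgue_on \<Omega>. c x = d x"
proof -
  have "AE x in lebesgue_on \<Omega>. c x - d x = 0"
  proof (rule fundamental_lemma_vec[OF O L2_diff_vec[OF c(1) d(1)]])
    fix \<theta> :: "real^3 \<Rightarrow> complex^3" assume t: "\<theta> \<in> test_functions \<Omega>"
    have "(LINT x|lebesgue_on \<Omega>. (c x - d x) \<bullet>\<^sub>c \<theta> x) = (LINT x|lebesgue_on \<Omega>. c x \<bullet>\<^sub>c \<theta> x - d x \<bullet>\<^sub>c \<theta> x)"
      by (simp add: cdot_3 algebra_simps)
    also have "\<dots> = 0"
      using c d t L2_cdot_integrable test_functions_vec_L2[OF O t]
      by (subst Bochner_Integration.integral_diff) (auto simp: has_weak_curl_def)
    finally show "(LINT x|lebesgue_on \<Omega>. (c x - d x) \<bullet>\<^sub>c \<theta> x) = 0" .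
  qed
  then show ?thesis by simp
qed

lemma weak_div_unique:
  assumes O: "open \<Omega>" "bounded \<Omega>" and c: "c \<in> L2 \<Omega>" "has_weak_div \<Omega> v c" and d: "d \<in> L2 \<Omega>" "has_weak_div \<Omega> v d"
  shows "AE x in lebesgue_on \<Omega>. c x = d x"
proof -
  have "AE x in lebesgue_on \<Omega>. c x - d x = 0"
  proof (rule fundamental_lemma[OF O L2_diff[OF c(1) d(1)]])
    fix \<theta> :: "real^3 \<Rightarrow> complex" assume t: "\<theta> \<in> test_functions \<Omega>"
    have "(LINT x|lebesgue_on \<Omega>. (c x - d x) * \<theta> x) = (LINT x|lebesgue_on \<Omega>. c x * \<theta> x - d x * \<theta> x)"
      by (simp add: algebra_simps)
    also have "\<dots> = (LINT x|lebesgue_on \<Omega>. c x * \<theta> x) - (LINT x|lebesgue_on \<Omega>. d x * \<theta> x)"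
      using c d L2_mult_integrable test_functions_L2[OF O t]
      by (intro Bochner_Integration.integral_diff) auto
    also have "\<dots> = 0"
      using bspec[OF c(2)[unfolded has_weak_div_def] t] bspec[OF d(2)[unfolded has_weak_div_def] t] by simp
    finally show "(LINT x|lebesgue_on \<Omega>. (c x - d x) * \<theta> x) = 0" .
  qed
  then show ?thesis by simp
qed

lemma weak_curl_spec:
  assumes "v \<in> Hcurl \<Omega>" shows "weak_curl \<Omega> v \<in> L2 \<Omega>" "has_weak_curl \<Omega> v (weak_curl \<Omega> v)"
  using assms someI_ex[of "\<lambda>c. c \<in> L2 \<Omega> \<and> has_weak_curl \<Omega> v c"]
  unfolding Hcurl_def weak_curl_def by auto

lemma weak_div_spec:
  assumes "v \<in> Hdiv \<Omega>" shows "weak_div \<Omega> v \<in> L2 \<Omega>" "has_weak_div \<Omega> v (weak_div \<Omega> v)"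
  using assms someI_ex[of "\<lambda>c. c \<in> L2 \<Omega> \<and> has_weak_div \<Omega> v c"]
  unfolding Hdiv_def weak_div_def by auto

lemma weak_grad_spec:
  assumes "v \<in> H1 \<Omega>" shows "weak_grad \<Omega> v \<in> L2 \<Omega>" "has_weak_grad \<Omega> v (weak_grad \<Omega> v)"
  using assms someI_ex[of "\<lambda>c. c \<in> L2 \<Omega> \<and> has_weak_grad \<Omega> v c"]
  unfolding H1_def weak_grad_def by auto

text \<open>The chosen weak curl may be replaced by any known one under integrals.\<close>

lemma weak_curl_AE:
  assumes O: "open \<Omega>" "bounded \<Omega>" and "v \<in> L2 \<Omega>" "c \<in> L2 \<Omega>" "has_weak_curl \<Omega> v c"
  shows "AE x in lebesgue_on \<Omega>. weak_curl \<Omega> v x = c x"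
proof -
  have "v \<in> Hcurl \<Omega>" using assms by (auto simp: Hcurl_def)
  from weak_curl_unique[OF O weak_curl_spec[OF this] assms(4,5)] show ?thesis .
qed

section \<open>Weak derivatives of differentiable functions\<close>

text \<open>Integration by parts: the product with a test function has compact support, so its partial derivatives
integrate to zero.\<close>

lemma C1_has_weak_grad:
  fixes f :: "real^3 \<Rightarrow> complex"
  assumes O: "open \<Omega>" "bounded \<Omega>" and f: "C_k 1 f"
  shows "has_weak_grad \<Omega> f (grad f)"
  unfolding has_weak_grad_def
proof (intro allI ballI)
  fix i and \<phi> :: "real^3 \<Rightarrow> complex" assume p: "\<phi> \<in> test_functions \<Omega>"
  have c1: "C_k 1 \<phi>" by (rule test_functions_C_k[OF p])
  obtain R where R: "\<And>x. R < norm x \<Longrightarrow> \<phi> x = 0" using test_functions_zero_norm[OF p] by blast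
  obtain K where K: "compact K" "K \<subseteq> \<Omega>" "\<And>x. x \<notin> K \<Longrightarrow> \<phi> x = 0" using test_functionsE[OF p] by metis
  have d: "partial_deriv i (\<lambda>x. f x * \<phi> x) x = f x * partial_deriv i \<phi> x + partial_deriv i f x * \<phi> x" for x
    using f c1 by (intro partial_deriv_mult) auto
  have "partial_deriv i (\<lambda>x. f x * \<phi> x) x = 0" if "x \<notin> \<Omega>" for x
    by (rule partial_deriv_zero_open[of "- K"]) (use K that in \<open>auto simp: compact_imp_closed open_Compl\<close>)
  then have e: "indicator \<Omega> x *\<^sub>R partial_deriv i (\<lambda>x. f x * \<phi> x) x = partial_deriv i (\<lambda>x. f x * \<phi> x) x" for x
    by (simp add: indicator_def)
  have "0 = (LINT x|lebesgue. partial_deriv i (\<lambda>x. f x * \<phi> x) x)"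
    using integral_partial_deriv_eq_0[OF C_k_mult[OF f c1], of R i] R by simp
  also have "\<dots> = (LINT x|lebesgue_on \<Omega>. partial_deriv i (\<lambda>x. f x * \<phi> x) x)"
    using O by (subst integral_restrict_space) (auto simp: e)
  also have "\<dots> = (LINT x|lebesgue_on \<Omega>. f x * partial_deriv i \<phi> x) + (LINT x|lebesgue_on \<Omega>. partial_deriv i f x * \<phi> x)"
    unfolding d
    by (intro Bochner_Integration.integral_add L2_mult_integrable test_functions_L2[OF O p] continuous_L2[OF O]
        C_k_continuous[OF f] C_k_continuous[OF C_k_partial_deriv[OF f[unfolded One_nat_def]]])
  finally show "(LINT x|lebesgue_on \<Omega>. f x * partial_deriv i \<phi> x) = - (LINT x|lebesgue_on \<Omega>. grad f x $ i * \<phi> x)"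
    by (simp add: grad_def eq_neg_iff_add_eq_0)
qed

lemma C1_grad_L2:
  fixes f :: "real^3 \<Rightarrow> complex"
  assumes O: "open \<Omega>" "bounded \<Omega>" and f: "C_k 1 f"
  shows "f \<in> L2 \<Omega>" "grad f \<in> L2 \<Omega>"
  using f continuous_L2[OF O] C_k_continuous[OF f] by (auto simp: L2_vec_iff grad_def)

lemma C1_H1:
  fixes f :: "real^3 \<Rightarrow> complex"
  assumes O: "open \<Omega>" "bounded \<Omega>" and f: "C_k 1 f"
  shows "f \<in> H1 \<Omega>"
  using C1_grad_L2[OF assms] C1_has_weak_grad[OF assms] by (auto simp: H1_def)

lemma vector_3_L2:
  fixes a b c :: "real^3 \<Rightarrow> complex"
  shows "a \<in> L2 \<Omega> \<Longrightarrow> b \<in> L2 \<Omega> \<Longrightarrow> c \<in> L2 \<Omega> \<Longrightarrow> (\<lambda>x. vector [a x, b x, c x] :: complex^3) \<in> L2 \<Omega>"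
  unfolding L2_vec_iff by (simp add: forall_3)

text \<open>The weak curl is assembled from the weak gradients of the components. This gives the weak curls of \<open>H1\<close>
fields, of test fields and of classical gradients.\<close>

lemma has_weak_curl_of_grads:
  fixes \<Phi> :: "real^3 \<Rightarrow> complex^3" and G :: "3 \<Rightarrow> real^3 \<Rightarrow> complex^3"
  assumes O: "open \<Omega>" "bounded \<Omega>"
    and G: "\<And>i. G i \<in> L2 \<Omega>" "\<And>i. has_weak_grad \<Omega> (\<lambda>x. \<Phi> x $ i) (G i)"
    and \<Phi>: "\<Phi> \<in> L2 \<Omega>"
  shows "has_weak_curl \<Omega> \<Phi> (\<lambda>x. vector [G 3 x $ 2 - G 2 x $ 3, G 1 x $ 3 - G 3 x $ 1, G 2 x $ 1 - G 1 x $ 2])"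
  unfolding has_weak_curl_def
proof
  fix \<theta> :: "real^3 \<Rightarrow> complex^3" assume t: "\<theta> \<in> test_functions \<Omega>"
  define T where "T i = (\<lambda>x. \<theta> x $ i)" for i
  have T: "T i \<in> test_functions \<Omega>" for i
    unfolding T_def by (rule test_functions_linear[OF bounded_linear_vec_nth t])
  have dT: "partial_deriv j \<theta> x $ i = partial_deriv j (T i) x" for i j x
    unfolding T_def using partial_deriv_bounded_linear[OF bounded_linear_vec_nth test_functions_differentiable[OF t]] by metis
  have \<Phi>i: "(\<lambda>x. \<Phi> x $ i) \<in> L2 \<Omega>" for i using \<Phi> L2_vec_iff by blast
  have Gi: "(\<lambda>x. G i x $ j) \<in> L2 \<Omega>" for i j using G(1) L2_vec_iff by blast
  note int [simp] = L2_mult_integrable[OF \<Phi>i test_functions_L2(2)[OF O T]] L2_mult_integrable[OF Gi test_functions_L2(1)[OF O T]]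
  have w: "(LINT x|lebesgue_on \<Omega>. \<Phi> x $ i * partial_deriv j (T l) x) = - (LINT x|lebesgue_on \<Omega>. G i x $ j * T l x)" for i j l
    using G(2) T unfolding has_weak_grad_def by blast
  have "(LINT x|lebesgue_on \<Omega>. \<Phi> x \<bullet>\<^sub>c curl \<theta> x) =
    (LINT x|lebesgue_on \<Omega>. \<Phi> x $ 1 * partial_deriv 2 (T 3) x - \<Phi> x $ 1 * partial_deriv 3 (T 2) x
      + (\<Phi> x $ 2 * partial_deriv 3 (T 1) x - \<Phi> x $ 2 * partial_deriv 1 (T 3) x)
      + (\<Phi> x $ 3 * partial_deriv 1 (T 2) x - \<Phi> x $ 3 * partial_deriv 2 (T 1) x))"
    by (simp add: cdot_3 curl_def dT right_diff_distrib)
  also have "\<dots> = (LINT x|lebesgue_on \<Omega>. G 3 x $ 2 * T 1 x - G 2 x $ 3 * T 1 x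
      + (G 1 x $ 3 * T 2 x - G 3 x $ 1 * T 2 x) + (G 2 x $ 1 * T 3 x - G 1 x $ 2 * T 3 x))"
    by (simp add: w)
  also have "\<dots> = (LINT x|lebesgue_on \<Omega>. vector [G 3 x $ 2 - G 2 x $ 3, G 1 x $ 3 - G 3 x $ 1, G 2 x $ 1 - G 1 x $ 2] \<bullet>\<^sub>c \<theta> x)"
    by (simp add: cdot_3 T_def left_diff_distrib)
  finally show "(LINT x|lebesgue_on \<Omega>. \<Phi> x \<bullet>\<^sub>c curl \<theta> x) =
    (LINT x|lebesgue_on \<Omega>. vector [G 3 x $ 2 - G 2 x $ 3, G 1 x $ 3 - G 3 x $ 1, G 2 x $ 1 - G 1 x $ 2] \<bullet>\<^sub>c \<theta> x)" .
qed

section \<open>Mixed partial derivatives commute\<close>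

lemma has_real_derivative_along_axis:
  fixes f :: "real^3 \<Rightarrow> real"
  assumes "C_k (Suc k) f"
  shows "((\<lambda>s. f (x + s *\<^sub>R axis i 1)) has_real_derivative partial_deriv i f (x + s *\<^sub>R axis i 1)) (at s)"
proof -
  let ?F = "frechet_derivative f (at (x + s *\<^sub>R axis i 1))"
  have "((\<lambda>s. x + s *\<^sub>R axis i 1) has_derivative (\<lambda>h. h *\<^sub>R axis i 1)) (at s)"
    by (auto intro!: derivative_eq_intros)
  from has_derivative_compose[OF this C_k_has_derivative[OF assms]]
  have d: "((\<lambda>s. f (x + s *\<^sub>R axis i 1)) has_derivative (\<lambda>h. ?F (h *\<^sub>R axis i 1))) (at s)" .
  have "linear ?F"
    by (rule has_derivative_linear[OF C_k_has_derivative[OF assms]])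
  then have "?F (h *\<^sub>R axis i 1) = partial_deriv i f (x + s *\<^sub>R axis i 1) * h" for h
    by (simp add: linear_cmul frechet_partial)
  then show ?thesis using d unfolding has_field_derivative_def by simp
qed

text \<open>Two applications of the mean value theorem. The second difference on the left is symmetric in the two
directions, so in the limit \<open>h \<rightarrow> 0\<close> the mixed partial derivatives agree.\<close>

lemma second_difference_mean_value:
  fixes f :: "real^3 \<Rightarrow> real" and x :: "real^3" and i j :: 3
  assumes f: "C_k 2 f" and h: "0 < h"
  defines "a \<equiv> axis i 1 :: real^3" and "b \<equiv> axis j 1 :: real^3"
  shows "\<exists>s t. 0 < s \<and> s < h \<and> 0 < t \<and> t < h \<and>
    f (x + h *\<^sub>R a + h *\<^sub>R b) - f (x + h *\<^sub>R a) - f (x + h *\<^sub>R b) + f x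
      = h * h * partial_deriv j (partial_deriv i f) (x + s *\<^sub>R a + t *\<^sub>R b)"
proof -
  have f': "C_k (Suc (Suc 0)) f" using f by (simp add: numeral_2_eq_2)
  have d1: "((\<lambda>s. f (x + h *\<^sub>R b + s *\<^sub>R a) - f (x + s *\<^sub>R a)) has_real_derivative
     partial_deriv i f (x + h *\<^sub>R b + s *\<^sub>R a) - partial_deriv i f (x + s *\<^sub>R a)) (at s)" for s
    unfolding a_def by (intro DERIV_diff has_real_derivative_along_axis[OF f'])
  obtain s where s: "0 < s" "s < h"
    "(f (x + h *\<^sub>R b + h *\<^sub>R a) - f (x + h *\<^sub>R a)) - (f (x + h *\<^sub>R b + 0 *\<^sub>R a) - f (x + 0 *\<^sub>R a)) =
      (h - 0) * (partial_deriv i f (x + h *\<^sub>R b + s *\<^sub>R a) - partial_deriv i f (x + s *\<^sub>R a))"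
    using MVT2[OF h d1] by blast
  have d2: "((\<lambda>t. partial_deriv i f (x + s *\<^sub>R a + t *\<^sub>R b)) has_real_derivative
     partial_deriv j (partial_deriv i f) (x + s *\<^sub>R a + t *\<^sub>R b)) (at t)" for t
    unfolding b_def by (rule has_real_derivative_along_axis[OF C_k_partial_deriv[OF f']])
  obtain t where t: "0 < t" "t < h"
    "partial_deriv i f (x + s *\<^sub>R a + h *\<^sub>R b) - partial_deriv i f (x + s *\<^sub>R a + 0 *\<^sub>R b) =
      (h - 0) * partial_deriv j (partial_deriv i f) (x + s *\<^sub>R a + t *\<^sub>R b)"
    using MVT2[OF h d2] by blast
  have ac: "x + h *\<^sub>R b + r *\<^sub>R a = x + r *\<^sub>R a + h *\<^sub>R b" for r by simp
  have "f (x + h *\<^sub>R a + h *\<^sub>R b) - f (x + h *\<^sub>R a) - f (x + h *\<^sub>R b) + f x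
      = h * (h * partial_deriv j (partial_deriv i f) (x + s *\<^sub>R a + t *\<^sub>R b))"
    using s(3) t(3) unfolding ac by simp
  then show ?thesis using s t by (auto simp: mult.assoc)
qed

lemma real_partial_deriv_commute:
  fixes f :: "real^3 \<Rightarrow> real"
  assumes f: "C_k 2 f"
  shows "partial_deriv j (partial_deriv i f) x = partial_deriv i (partial_deriv j f) x"
proof -
  define h where "h n = inverse (real (Suc n))" for n
  have h: "0 < h n" for n by (simp add: h_def)
  have h0: "h \<longlonglongrightarrow> 0" unfolding h_def by (rule LIMSEQ_inverse_real_of_nat)
  let ?a = "axis i 1 :: real^3" and ?b = "axis j 1 :: real^3"
  have mv: "\<exists>s t. 0 < s \<and> s < h n \<and> 0 < t \<and> t < h n \<and>
    f (x + h n *\<^sub>R axis k 1 + h n *\<^sub>R axis l 1) - f (x + h n *\<^sub>R axis k 1) - f (x + h n *\<^sub>R axis l 1) + f x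
      = h n * h n * partial_deriv l (partial_deriv k f) (x + s *\<^sub>R axis k 1 + t *\<^sub>R axis l 1)" for n k l
    by (rule second_difference_mean_value[OF f h])
  have "\<exists>s t p q. 0 < s \<and> s < h n \<and> 0 < t \<and> t < h n \<and> 0 < p \<and> p < h n \<and> 0 < q \<and> q < h n \<and>
    partial_deriv j (partial_deriv i f) (x + s *\<^sub>R ?a + t *\<^sub>R ?b) =
    partial_deriv i (partial_deriv j f) (x + p *\<^sub>R ?b + q *\<^sub>R ?a)" for n
  proof -
    obtain s t where st: "0 < s" "s < h n" "0 < t" "t < h n"
      "f (x + h n *\<^sub>R ?a + h n *\<^sub>R ?b) - f (x + h n *\<^sub>R ?a) - f (x + h n *\<^sub>R ?b) + f x
        = h n * h n * partial_deriv j (partial_deriv i f) (x + s *\<^sub>R ?a + t *\<^sub>R ?b)"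
      using mv[of n i j] by blast
    obtain p q where pq: "0 < p" "p < h n" "0 < q" "q < h n"
      "f (x + h n *\<^sub>R ?b + h n *\<^sub>R ?a) - f (x + h n *\<^sub>R ?b) - f (x + h n *\<^sub>R ?a) + f x
        = h n * h n * partial_deriv i (partial_deriv j f) (x + p *\<^sub>R ?b + q *\<^sub>R ?a)"
      using mv[of n j i] by blast
    have ac: "x + h n *\<^sub>R ?b + h n *\<^sub>R ?a = x + h n *\<^sub>R ?a + h n *\<^sub>R ?b" by simp
    have "h n * h n * partial_deriv j (partial_deriv i f) (x + s *\<^sub>R ?a + t *\<^sub>R ?b) =
      h n * h n * partial_deriv i (partial_deriv j f) (x + p *\<^sub>R ?b + q *\<^sub>R ?a)"
      using st(5) pq(5) unfolding ac by linarith
    then show ?thesis using h[of n] st pq by auto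
  qed
  then obtain s t p q where st: "\<And>n. 0 < s n" "\<And>n. s n < h n" "\<And>n. 0 < t n" "\<And>n. t n < h n"
    and pq: "\<And>n. 0 < p n" "\<And>n. p n < h n" "\<And>n. 0 < q n" "\<And>n. q n < h n"
    and eq: "\<And>n. partial_deriv j (partial_deriv i f) (x + s n *\<^sub>R ?a + t n *\<^sub>R ?b) =
      partial_deriv i (partial_deriv j f) (x + p n *\<^sub>R ?b + q n *\<^sub>R ?a)"
    by metis
  have z: "u \<longlonglongrightarrow> 0" if "\<And>n. 0 < u n" "\<And>n. u n < h n" for u :: "nat \<Rightarrow> real"
    by (rule tendsto_sandwich[OF _ _ tendsto_const h0]) (use that in \<open>auto intro!: always_eventually less_imp_le\<close>)
  have f': "C_k (Suc (Suc 0)) f" using f by (simp add: numeral_2_eq_2)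
  have cont: "isCont (partial_deriv l (partial_deriv k f)) x" for l k
    using C_k_continuous[OF C_k_partial_deriv[OF C_k_partial_deriv[OF f']], of UNIV]
    by (simp add: continuous_on_eq_continuous_at)
  have "(\<lambda>n. x + s n *\<^sub>R ?a + t n *\<^sub>R ?b) \<longlonglongrightarrow> x + 0 *\<^sub>R ?a + 0 *\<^sub>R ?b"
    by (intro tendsto_intros z st)
  then have 1: "(\<lambda>n. partial_deriv j (partial_deriv i f) (x + s n *\<^sub>R ?a + t n *\<^sub>R ?b)) \<longlonglongrightarrow> partial_deriv j (partial_deriv i f) x"
    by (intro isCont_tendsto_compose[OF cont]) simp
  have "(\<lambda>n. x + p n *\<^sub>R ?b + q n *\<^sub>R ?a) \<longlonglongrightarrow> x + 0 *\<^sub>R ?b + 0 *\<^sub>R ?a"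
    by (intro tendsto_intros z pq)
  then have 2: "(\<lambda>n. partial_deriv i (partial_deriv j f) (x + p n *\<^sub>R ?b + q n *\<^sub>R ?a)) \<longlonglongrightarrow> partial_deriv i (partial_deriv j f) x"
    by (intro isCont_tendsto_compose[OF cont]) simp
  show ?thesis
    by (rule LIMSEQ_unique[OF 1]) (use 2 in \<open>simp add: eq\<close>)
qed

lemma partial_deriv_commute:
  fixes f :: "real^3 \<Rightarrow> complex"
  assumes f: "C_k 2 f"
  shows "partial_deriv j (partial_deriv i f) x = partial_deriv i (partial_deriv j f) x"
proof -
  have f': "C_k (Suc (Suc 0)) f" using f by (simp add: numeral_2_eq_2)
  have *: "L (partial_deriv l (partial_deriv k f) x) = partial_deriv l (partial_deriv k (\<lambda>x. L (f x))) x"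
    if L: "bounded_linear L" for L :: "complex \<Rightarrow> real" and l k
  proof -
    have "partial_deriv k (\<lambda>x. L (f x)) = (\<lambda>x. L (partial_deriv k f x))"
      by (rule ext, rule partial_deriv_bounded_linear[OF L]) (rule C_k_differentiable[OF f'])
    then show ?thesis
      using partial_deriv_bounded_linear[OF L C_k_differentiable[OF C_k_partial_deriv[OF f']]] by simp
  qed
  show ?thesis
    using *[OF bounded_linear_Re] *[OF bounded_linear_Im]
      real_partial_deriv_commute[OF C_k_bounded_linear[OF bounded_linear_Re f], of j i x]
      real_partial_deriv_commute[OF C_k_bounded_linear[OF bounded_linear_Im f], of j i x]
    by (intro complex_eqI) simp_all
qed

section \<open>The curl of a field without tangential trace is orthogonal to gradients\<close>

lemma grad_H1_fields:
  fixes \<psi> :: "real^3 \<Rightarrow> complex"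
  assumes O: "open \<Omega>" "bounded \<Omega>" and \<psi>: "C_k 2 \<psi>"
  shows "grad \<psi> \<in> H1_fields \<Omega>" "grad \<psi> \<in> L2 \<Omega>" "has_weak_curl \<Omega> (grad \<psi>) (\<lambda>x. 0)"
proof -
  have p': "C_k (Suc (Suc 0)) \<psi>" using \<psi> by (simp add: numeral_2_eq_2)
  then have p1: "C_k 1 \<psi>" by (simp only: C_k_SucD One_nat_def)
  have d: "C_k 1 (partial_deriv i \<psi>)" for i using C_k_partial_deriv[OF p'] by simp
  show "grad \<psi> \<in> H1_fields \<Omega>"
    unfolding H1_fields_def grad_def using C1_H1[OF O d] by simp
  show L2: "grad \<psi> \<in> L2 \<Omega>" by (rule C1_grad_L2[OF O p1])
  have "has_weak_curl \<Omega> (grad \<psi>) (\<lambda>x. vector [grad (partial_deriv 3 \<psi>) x $ 2 - grad (partial_deriv 2 \<psi>) x $ 3,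
      grad (partial_deriv 1 \<psi>) x $ 3 - grad (partial_deriv 3 \<psi>) x $ 1,
      grad (partial_deriv 2 \<psi>) x $ 1 - grad (partial_deriv 1 \<psi>) x $ 2])"
  proof (rule has_weak_curl_of_grads[OF O])
    fix i
    show "grad (partial_deriv i \<psi>) \<in> L2 \<Omega>" by (rule C1_grad_L2[OF O d])
    show "has_weak_grad \<Omega> (\<lambda>x. grad \<psi> x $ i) (grad (partial_deriv i \<psi>))"
      using C1_has_weak_grad[OF O d] by (simp add: grad_def)
  qed (rule L2)
  moreover have "vector [grad (partial_deriv 3 \<psi>) x $ 2 - grad (partial_deriv 2 \<psi>) x $ 3,
      grad (partial_deriv 1 \<psi>) x $ 3 - grad (partial_deriv 3 \<psi>) x $ 1,
      grad (partial_deriv 2 \<psi>) x $ 1 - grad (partial_deriv 1 \<psi>) x $ 2] = (0 :: complex^3)" for x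
    using partial_deriv_commute[OF \<psi>] by (simp add: grad_def vec_eq_iff forall_3)
  ultimately show "has_weak_curl \<Omega> (grad \<psi>) (\<lambda>x. 0)" by simp
qed

lemma H0curl_Hcurl: "w \<in> H0curl \<Omega> \<Longrightarrow> w \<in> Hcurl \<Omega>" by (simp add: H0curl_def)

lemma Hcurl_L2: "w \<in> Hcurl \<Omega> \<Longrightarrow> w \<in> L2 \<Omega>" by (simp add: Hcurl_def)

text \<open>The tangential trace of \<open>w\<close> vanishes on \<open>grad \<psi>\<close>, whose weak curl is zero; only the term with the weak
curl of \<open>w\<close> is left. In this form the boundary condition says that \<open>curl w\<close> is divergence free and has no normal
component on the boundary.\<close>

lemma weak_curl_orthogonal_grad:
  assumes O: "open \<Omega>" "bounded \<Omega>" and w: "w \<in> H0curl \<Omega>" and \<psi>: "C_k 2 \<psi>"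
  shows "(LINT x|lebesgue_on \<Omega>. weak_curl \<Omega> w x \<bullet>\<^sub>c grad \<psi> x) = 0"
proof -
  note g = grad_H1_fields[OF O \<psi>]
  have zero: "(\<lambda>x. 0 :: complex^3) \<in> L2 \<Omega>" by (simp add: L2_def)
  have ae: "AE x in lebesgue_on \<Omega>. weak_curl \<Omega> (grad \<psi>) x = 0"
    by (rule weak_curl_AE[OF O g(2) zero g(3)])
  have "grad \<psi> \<in> Hcurl \<Omega>" using g(2,3) zero by (auto simp: Hcurl_def)
  note wg = weak_curl_spec(1)[OF this]
  note wL = Hcurl_L2[OF H0curl_Hcurl[OF w]] weak_curl_spec(1)[OF H0curl_Hcurl[OF w]]
  note i = L2_cdot_integrable[OF wL(1) wg] L2_cdot_integrable[OF wL(2) g(2)]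
  have "0 = tangential_trace \<Omega> w (grad \<psi>)"
    using w g(1) by (simp add: H0curl_def)
  also have "\<dots> = (LINT x|lebesgue_on \<Omega>. - (weak_curl \<Omega> w x \<bullet>\<^sub>c grad \<psi> x))"
    unfolding tangential_trace_def
  proof (rule integral_cong_AE)
    show "AE x in lebesgue_on \<Omega>. w x \<bullet>\<^sub>c weak_curl \<Omega> (grad \<psi>) x - weak_curl \<Omega> w x \<bullet>\<^sub>c grad \<psi> x
      = - (weak_curl \<Omega> w x \<bullet>\<^sub>c grad \<psi> x)"
      using ae by eventually_elim (simp add: cdot_def)
  qed (use i in \<open>auto intro!: borel_measurable_diff borel_measurable_integrable\<close>)
  finally show ?thesis by simp
qed

section \<open>Test fields in the variational equation\<close>

lemma C1_has_weak_curl: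
  fixes \<Phi> :: "real^3 \<Rightarrow> complex^3"
  assumes O: "open \<Omega>" "bounded \<Omega>" and \<Phi>: "C_k 1 \<Phi>"
  shows "\<Phi> \<in> L2 \<Omega>" "curl \<Phi> \<in> L2 \<Omega>" "has_weak_curl \<Omega> \<Phi> (curl \<Phi>)"
proof -
  have c: "C_k 1 (\<lambda>x. \<Phi> x $ i)" for i by (rule C_k_bounded_linear[OF bounded_linear_vec_nth \<Phi>])
  note g = C1_grad_L2[OF O c]
  have d: "partial_deriv j \<Phi> x $ i = grad (\<lambda>x. \<Phi> x $ i) x $ j" for i j x
    using partial_deriv_bounded_linear[OF bounded_linear_vec_nth C_k_differentiable[OF \<Phi>[unfolded One_nat_def]]]
    by (simp add: grad_def)
  have gi: "(\<lambda>x. grad (\<lambda>x. \<Phi> x $ i) x $ j) \<in> L2 \<Omega>" for i j using g(2) L2_vec_iff by blast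
  show L2: "\<Phi> \<in> L2 \<Omega>" using g(1) L2_vec_iff by blast
  have curl: "curl \<Phi> = (\<lambda>x. vector [grad (\<lambda>x. \<Phi> x $ 3) x $ 2 - grad (\<lambda>x. \<Phi> x $ 2) x $ 3,
    grad (\<lambda>x. \<Phi> x $ 1) x $ 3 - grad (\<lambda>x. \<Phi> x $ 3) x $ 1,
    grad (\<lambda>x. \<Phi> x $ 2) x $ 1 - grad (\<lambda>x. \<Phi> x $ 1) x $ 2])"
    by (rule ext) (simp add: curl_def d)
  show "curl \<Phi> \<in> L2 \<Omega>" unfolding curl by (intro vector_3_L2 L2_diff gi)
  show "has_weak_curl \<Omega> \<Phi> (curl \<Phi>)"
    unfolding curl by (rule has_weak_curl_of_grads[OF O g(2) C1_has_weak_grad[OF O c] L2])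
qed

lemma H1_fields_Hcurl:
  assumes O: "open \<Omega>" "bounded \<Omega>" and \<phi>: "\<phi> \<in> H1_fields \<Omega>"
  shows "\<phi> \<in> Hcurl \<Omega>"
proof -
  define G where "G i = weak_grad \<Omega> (\<lambda>x. \<phi> x $ i)" for i
  have h: "(\<lambda>x. \<phi> x $ i) \<in> H1 \<Omega>" for i using \<phi> by (simp add: H1_fields_def)
  note G = weak_grad_spec[OF h, folded G_def]
  have L2: "\<phi> \<in> L2 \<Omega>" unfolding L2_vec_iff using h by (auto simp: H1_def)
  have Gi: "(\<lambda>x. G i x $ j) \<in> L2 \<Omega>" for i j using G(1) L2_vec_iff by blast
  have "(\<lambda>x. vector [G 3 x $ 2 - G 2 x $ 3, G 1 x $ 3 - G 3 x $ 1, G 2 x $ 1 - G 1 x $ 2] :: complex^3) \<in> L2 \<Omega>"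
    by (intro vector_3_L2 L2_diff Gi)
  then show ?thesis
    using has_weak_curl_of_grads[OF O G L2] L2 unfolding Hcurl_def by blast
qed

text \<open>The trace functional of a test field \<open>\<theta>\<close> at \<open>\<phi>\<close> is the defining identity of the weak curl of \<open>\<phi>\<close>,
tested with \<open>\<theta>\<close>.\<close>

lemma test_functions_H0curl:
  fixes \<theta> :: "real^3 \<Rightarrow> complex^3"
  assumes O: "open \<Omega>" "bounded \<Omega>" and t: "\<theta> \<in> test_functions \<Omega>"
  shows "\<theta> \<in> H0curl \<Omega>" "AE x in lebesgue_on \<Omega>. weak_curl \<Omega> \<theta> x = curl \<theta> x"
proof -
  note c = C1_has_weak_curl[OF O test_functions_C_k[OF t]]
  show ae: "AE x in lebesgue_on \<Omega>. weak_curl \<Omega> \<theta> x = curl \<theta> x"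
    by (rule weak_curl_AE[OF O c])
  have H: "\<theta> \<in> Hcurl \<Omega>" using c by (auto simp: Hcurl_def)
  have "tangential_trace \<Omega> \<theta> \<phi> = 0" if p: "\<phi> \<in> H1_fields \<Omega>" for \<phi>
  proof -
    note pH = H1_fields_Hcurl[OF O p]
    note i1 = L2_cdot_integrable[OF c(1) weak_curl_spec(1)[OF pH]]
    note i2 = L2_cdot_integrable[OF c(2) Hcurl_L2[OF pH]]
    note i3 = L2_cdot_integrable[OF weak_curl_spec(1)[OF H] Hcurl_L2[OF pH]]
    have "tangential_trace \<Omega> \<theta> \<phi> = (LINT x|lebesgue_on \<Omega>. \<theta> x \<bullet>\<^sub>c weak_curl \<Omega> \<phi> x - curl \<theta> x \<bullet>\<^sub>c \<phi> x)"
      unfolding tangential_trace_def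
    proof (rule integral_cong_AE)
      show "AE x in lebesgue_on \<Omega>. \<theta> x \<bullet>\<^sub>c weak_curl \<Omega> \<phi> x - weak_curl \<Omega> \<theta> x \<bullet>\<^sub>c \<phi> x =
          \<theta> x \<bullet>\<^sub>c weak_curl \<Omega> \<phi> x - curl \<theta> x \<bullet>\<^sub>c \<phi> x"
        using ae by eventually_elim simp
    qed (use i1 i2 i3 in \<open>auto intro!: borel_measurable_diff borel_measurable_integrable\<close>)
    also have "\<dots> = (LINT x|lebesgue_on \<Omega>. \<theta> x \<bullet>\<^sub>c weak_curl \<Omega> \<phi> x) - (LINT x|lebesgue_on \<Omega>. curl \<theta> x \<bullet>\<^sub>c \<phi> x)"
      by (rule Bochner_Integration.integral_diff[OF i1 i2])
    also have "\<dots> = 0"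
      using bspec[OF weak_curl_spec(2)[OF pH, unfolded has_weak_curl_def] t]
      by (simp add: cdot_def mult.commute)
    finally show ?thesis .
  qed
  then show "\<theta> \<in> H0curl \<Omega>" using H by (simp add: H0curl_def)
qed

lemma bounded_linear_vec_cnj: "bounded_linear vec_cnj"
  by (rule linear_conv_bounded_linear[THEN iffD1])
    (auto intro!: linearI simp: vec_eq_iff vec_cnj_def)

lemma vec_cnj_vec_cnj: "vec_cnj (vec_cnj a) = a"
  by (simp add: vec_cnj_def vec_eq_iff)

lemma curl_vec_cnj:
  assumes "\<theta> differentiable (at x)"
  shows "curl (\<lambda>x. vec_cnj (\<theta> x)) x = vec_cnj (curl \<theta> x)"
  unfolding curl_def partial_deriv_bounded_linear[OF bounded_linear_vec_cnj assms]
  by (simp add: vec_cnj_def vec_eq_iff forall_3)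

lemma bounded_coefficient_L2:
  fixes a :: "real^3 \<Rightarrow> real" and v :: "real^3 \<Rightarrow> complex^3"
  assumes v: "v \<in> L2 \<Omega>" and a: "a \<in> borel_measurable (lebesgue_on \<Omega>)" "AE x in lebesgue_on \<Omega>. \<bar>a x\<bar> \<le> B"
  shows "(\<lambda>x. a x *\<^sub>R v x) \<in> L2 \<Omega>"
  unfolding L2_vec_iff
proof
  fix i
  have "(\<lambda>x. v x $ i * of_real (a x)) \<in> L2 \<Omega>"
    by (rule L2_bounded_mult[where B = B]) (use v a L2_vec_iff in auto)
  then show "(\<lambda>x. (a x *\<^sub>R v x) $ i) \<in> L2 \<Omega>"
    unfolding vector_scaleR_component by (simp add: scaleR_conv_of_real mult.commute)
qed

lemma coefficient_inverse_bounded: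
  assumes "ae_bounded_below \<Omega> a" "a \<in> borel_measurable (lebesgue_on \<Omega>)"
  shows "\<exists>B. AE x in lebesgue_on \<Omega>. \<bar>inverse (a x)\<bar> \<le> B" "(\<lambda>x. inverse (a x)) \<in> borel_measurable (lebesgue_on \<Omega>)"
proof -
  obtain m where m: "0 < m" "AE x in lebesgue_on \<Omega>. m \<le> a x" using assms(1) by (auto simp: ae_bounded_below_def)
  have "AE x in lebesgue_on \<Omega>. \<bar>inverse (a x)\<bar> \<le> inverse m"
    using m(2) by eventually_elim (use m(1) in \<open>simp add: le_imp_inverse_le\<close>)
  then show "\<exists>B. AE x in lebesgue_on \<Omega>. \<bar>inverse (a x)\<bar> \<le> B" by blast
  show "(\<lambda>x. inverse (a x)) \<in> borel_measurable (lebesgue_on \<Omega>)" using assms(2) by measurable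
qed

lemma W1inf_bounded:
  assumes "a \<in> W1inf \<Omega>"
  shows "a \<in> borel_measurable (lebesgue_on \<Omega>)" "\<exists>B. AE x in lebesgue_on \<Omega>. \<bar>a x\<bar> \<le> B"
  using assms by (auto simp: W1inf_def Linf_def)

text \<open>The equation is tested with the conjugate field, since it is sesquilinear whereas weak derivatives are
defined by a bilinear product.\<close>

lemma adjoint_solution_flux_weak_curl:
  fixes \<mu> \<kappa> :: "real^3 \<Rightarrow> real"
  assumes O: "open \<Omega>" "bounded \<Omega>"
    and \<mu>: "(\<lambda>x. inverse (\<mu> x) *\<^sub>R weak_curl \<Omega> w x) \<in> L2 \<Omega>"
    and \<kappa>: "(\<lambda>x. \<kappa> x *\<^sub>R w x) \<in> L2 \<Omega>"
    and f: "f \<in> L2 \<Omega>"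
    and sol: "adjoint_solution \<Omega> \<mu> \<kappa> \<omega> f w"
  shows "has_weak_curl \<Omega> (\<lambda>x. inverse (\<mu> x) *\<^sub>R weak_curl \<Omega> w x)
     (\<lambda>x. \<chi> i. f x $ i + \<i> * of_real \<omega> * (\<kappa> x *\<^sub>R w x) $ i)"
  unfolding has_weak_curl_def
proof
  fix \<theta> :: "real^3 \<Rightarrow> complex^3" assume t: "\<theta> \<in> test_functions \<Omega>"
  let ?u = "\<lambda>x. inverse (\<mu> x) *\<^sub>R weak_curl \<Omega> w x"
  define v where "v x = vec_cnj (\<theta> x)" for x
  have v: "v \<in> test_functions \<Omega>"
    unfolding v_def by (rule test_functions_linear[OF bounded_linear_vec_cnj t])
  note vH = test_functions_H0curl[OF O v]
  have cv: "vec_cnj (curl v x) = curl \<theta> x" for x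
    unfolding v_def by (simp add: curl_vec_cnj test_functions_differentiable[OF t] vec_cnj_vec_cnj)
  have vcL2: "(\<lambda>x. vec_cnj (weak_curl \<Omega> v x)) \<in> L2 \<Omega>"
  proof -
    have *: "(\<lambda>x. weak_curl \<Omega> v x $ i) \<in> L2 \<Omega>" for i
      using weak_curl_spec(1)[OF H0curl_Hcurl[OF vH(1)]] L2_vec_iff by blast
    have "(\<lambda>x. cnj (weak_curl \<Omega> v x $ i)) \<in> L2 \<Omega>" for i
      using *[of i] measurable_compose[OF _ borel_measurable_continuous_onI[OF continuous_on_cnj[OF continuous_on_id]]]
      by (auto simp: L2_def)
    then show ?thesis by (simp add: L2_vec_iff vec_cnj_def)
  qed
  note tL2 = test_functions_vec_L2[OF O t]
  note cL2 = C1_has_weak_curl(2)[OF O test_functions_C_k[OF t]]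
  have 1: "(LINT x|lebesgue_on \<Omega>. ?u x \<bullet>\<^sub>c vec_cnj (weak_curl \<Omega> v x)) = (LINT x|lebesgue_on \<Omega>. ?u x \<bullet>\<^sub>c curl \<theta> x)"
  proof (rule integral_cong_AE)
    show "AE x in lebesgue_on \<Omega>. ?u x \<bullet>\<^sub>c vec_cnj (weak_curl \<Omega> v x) = ?u x \<bullet>\<^sub>c curl \<theta> x"
      using vH(2) by eventually_elim (simp add: cv)
  qed (auto intro!: borel_measurable_integrable L2_cdot_integrable \<mu> vcL2 cL2)
  have "(LINT x|lebesgue_on \<Omega>. (\<chi> i. f x $ i + \<i> * of_real \<omega> * (\<kappa> x *\<^sub>R w x) $ i) \<bullet>\<^sub>c \<theta> x) =
      (LINT x|lebesgue_on \<Omega>. f x \<bullet>\<^sub>c \<theta> x + \<i> * of_real \<omega> * ((\<kappa> x *\<^sub>R w x) \<bullet>\<^sub>c \<theta> x))"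
    by (simp add: cdot_3 algebra_simps)
  also have "\<dots> = (LINT x|lebesgue_on \<Omega>. f x \<bullet>\<^sub>c \<theta> x) + \<i> * of_real \<omega> * (LINT x|lebesgue_on \<Omega>. (\<kappa> x *\<^sub>R w x) \<bullet>\<^sub>c \<theta> x)"
    using L2_cdot_integrable[OF f tL2] L2_cdot_integrable[OF \<kappa> tL2]
    by (simp del: vector_scaleR_component)
  also have "\<dots> = (LINT x|lebesgue_on \<Omega>. ?u x \<bullet>\<^sub>c curl \<theta> x)"
    using sol vH(1) 1 unfolding adjoint_solution_def
    by (auto simp: v_def vec_cnj_vec_cnj algebra_simps dest!: bspec[where x = v])
  finally show "(LINT x|lebesgue_on \<Omega>. ?u x \<bullet>\<^sub>c curl \<theta> x) =
     (LINT x|lebesgue_on \<Omega>. (\<chi> i. f x $ i + \<i> * of_real \<omega> * (\<kappa> x *\<^sub>R w x) $ i) \<bullet>\<^sub>c \<theta> x)" by simp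
qed

section \<open>The interior cone condition\<close>

text \<open>Near a boundary point, \<open>\<Omega>\<close> lies strictly above the graph of a function \<open>g\<close> with Lipschitz constant \<open>L\<close>
over the plane orthogonal to \<open>e\<close>. Moving from \<open>x\<close> by \<open>t z\<close> with \<open>|z - e| \<le> d\<close> raises the height by at least
\<open>t (1 - d)\<close> and \<open>g\<close> by at most \<open>2 L t d\<close>. At an interior point every direction is admissible.\<close>

lemma cone_condition:
  assumes O: "open \<Omega>" and lip: "lipschitz_boundary \<Omega>" and p: "p \<in> closure \<Omega>"
  shows "\<exists>r>0. \<exists>e. \<exists>d>0. \<forall>x\<in>\<Omega> \<inter> ball p r. \<forall>t>0. \<forall>z\<in>cball e d.
    x + t *\<^sub>R z \<in> ball p r \<longrightarrow> x + t *\<^sub>R z \<in> \<Omega>"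
proof (cases "p \<in> \<Omega>")
  case True
  then obtain r where r: "0 < r" and sub: "ball p r \<subseteq> \<Omega>" using O open_contains_ball by blast
  show ?thesis
  proof (rule exI[of _ r], rule conjI[OF r], rule exI[of _ 0], rule exI[of _ 1], rule conjI[OF zero_less_one])
    show "\<forall>x\<in>\<Omega> \<inter> ball p r. \<forall>t>0. \<forall>z\<in>cball 0 1. x + t *\<^sub>R z \<in> ball p r \<longrightarrow> x + t *\<^sub>R z \<in> \<Omega>"
      using sub by (intro ballI allI impI) (rule subsetD)
  qed
next
  case False
  then have "p \<in> frontier \<Omega>" using p O by (simp add: frontier_def interior_open)
  from bspec[OF lip[unfolded lipschitz_boundary_def] this]
  obtain r e L and g :: "real^3 \<Rightarrow> real" where r: "0 < r" and e: "norm e = 1" and g: "L-lipschitz_on UNIV g"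
    and epi: "\<Omega> \<inter> ball p r = {x \<in> ball p r. g (x - (x \<bullet> e) *\<^sub>R e) < x \<bullet> e}"
    by (elim exE conjE)
  have L: "0 \<le> L" using g lipschitz_on_nonneg by blast
  \<comment> \<open>Solves \<open>2 L d = 1 - d\<close>.\<close>
  define d where "d = 1 / (2 * L + 1)"
  have d: "0 < d" "(2 * L + 1) * d = 1" using L by (simp_all add: d_def add_nonneg_pos)
  have ee: "e \<bullet> e = 1" using e by (simp add: dot_square_norm)
  have "x + t *\<^sub>R z \<in> \<Omega>"
    if x: "x \<in> \<Omega>" "x \<in> ball p r" and t: "0 < t" and z: "z \<in> cball e d" and b: "x + t *\<^sub>R z \<in> ball p r" for x t z
  proof -
    define y where "y = z - e"
    have y: "norm y \<le> d" using z by (simp add: y_def dist_norm norm_minus_commute)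
    have ye: "\<bar>y \<bullet> e\<bar> \<le> d" using Cauchy_Schwarz_ineq2[of y e] e y by simp
    have ze: "z = e + y" by (simp add: y_def)
    define x' where "x' = x - (x \<bullet> e) *\<^sub>R e"
    have pr: "(x + t *\<^sub>R z) - ((x + t *\<^sub>R z) \<bullet> e) *\<^sub>R e = x' + t *\<^sub>R (y - (y \<bullet> e) *\<^sub>R e)"
      by (simp add: ze x'_def inner_add_left ee algebra_simps)
    have n: "norm (y - (y \<bullet> e) *\<^sub>R e) \<le> 2 * d"
      using norm_triangle_ineq4[of y "(y \<bullet> e) *\<^sub>R e"] e y ye by simp
    have "dist (g (x' + t *\<^sub>R (y - (y \<bullet> e) *\<^sub>R e))) (g x') \<le> L * dist (x' + t *\<^sub>R (y - (y \<bullet> e) *\<^sub>R e)) x'"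
      by (rule lipschitz_onD[OF g]) auto
    also have "\<dots> \<le> L * (t * (2 * d))"
      using n t L by (intro mult_left_mono) (auto simp: dist_norm)
    finally have "g (x' + t *\<^sub>R (y - (y \<bullet> e) *\<^sub>R e)) \<le> g x' + L * (t * (2 * d))"
      unfolding dist_real_def by linarith
    also have "g x' < x \<bullet> e"
    proof -
      have "x \<in> \<Omega> \<inter> ball p r" using x by (rule IntI)
      then show ?thesis unfolding epi x'_def by simp
    qed
    finally have 1: "g (x' + t *\<^sub>R (y - (y \<bullet> e) *\<^sub>R e)) < x \<bullet> e + L * (t * (2 * d))" by simp
    have "t * d \<ge> t * - (y \<bullet> e)" using ye t by (intro mult_left_mono) auto
    moreover have "L * (t * (2 * d)) + t * d = t"
    proof -
      have "L * (t * (2 * d)) + t * d = t * ((2 * L + 1) * d)" by (simp add: algebra_simps)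
      then show ?thesis using d(2) by simp
    qed
    ultimately have "L * (t * (2 * d)) \<le> t + t * (y \<bullet> e)" by simp
    then have "g (x' + t *\<^sub>R (y - (y \<bullet> e) *\<^sub>R e)) < (x + t *\<^sub>R z) \<bullet> e"
      using 1 by (simp add: ze inner_add_left ee algebra_simps)
    then have "x + t *\<^sub>R z \<in> {x \<in> ball p r. g (x - (x \<bullet> e) *\<^sub>R e) < x \<bullet> e}"
      using b unfolding pr[symmetric] by simp
    then have "x + t *\<^sub>R z \<in> \<Omega> \<inter> ball p r" unfolding epi .
    then show ?thesis by (rule IntD1)
  qed
  then show ?thesis using r d(1) by (intro exI[of _ r] conjI exI[of _ e] exI[of _ d]) auto
qed

section \<open>Mollification and weak gradients\<close>

text \<open>The product of a test function with a smooth function is a test function.\<close>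

lemma has_weak_grad_smooth_mult:
  fixes \<phi> h :: "real^3 \<Rightarrow> complex"
  assumes O: "open \<Omega>" "bounded \<Omega>" and \<phi>: "\<phi> \<in> L2 \<Omega>" and G: "G \<in> L2 \<Omega>" "has_weak_grad \<Omega> \<phi> G" and h: "smooth h"
  shows "(\<lambda>x. h x * \<phi> x) \<in> L2 \<Omega>"
    and "(\<lambda>x. \<chi> i. h x * G x $ i + partial_deriv i h x * \<phi> x) \<in> L2 \<Omega>"
    and "has_weak_grad \<Omega> (\<lambda>x. h x * \<phi> x) (\<lambda>x. \<chi> i. h x * G x $ i + partial_deriv i h x * \<phi> x)"
proof -
  have hk: "C_k m h" for m using h by (simp add: smooth_def)
  note bd = L2_continuous_mult[OF O(2)]
  have hc: "continuous_on UNIV h" by (rule C_k_continuous[OF hk])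
  have dhc: "continuous_on UNIV (partial_deriv i h)" for i by (rule C_k_continuous[OF C_k_partial_deriv[OF hk]])
  have Gi: "(\<lambda>x. G x $ i) \<in> L2 \<Omega>" for i using G(1) L2_vec_iff by blast
  show "(\<lambda>x. h x * \<phi> x) \<in> L2 \<Omega>" by (rule bd[OF hc \<phi>])
  show "(\<lambda>x. \<chi> i. h x * G x $ i + partial_deriv i h x * \<phi> x) \<in> L2 \<Omega>"
    unfolding L2_vec_iff by (auto intro!: L2_add bd hc dhc \<phi> Gi)
  show "has_weak_grad \<Omega> (\<lambda>x. h x * \<phi> x) (\<lambda>x. \<chi> i. h x * G x $ i + partial_deriv i h x * \<phi> x)"
    unfolding has_weak_grad_def
  proof (intro allI ballI)
    fix i and \<theta> :: "real^3 \<Rightarrow> complex" assume t: "\<theta> \<in> test_functions \<Omega>"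
    note ht = test_functions_smooth_mult[OF h t]
    have d: "partial_deriv i (\<lambda>x. h x * \<theta> x) x = h x * partial_deriv i \<theta> x + partial_deriv i h x * \<theta> x" for x
      by (rule partial_deriv_mult[OF C_k_differentiable[OF hk] test_functions_differentiable[OF t]])
    note i1 = L2_mult_integrable[OF bd[OF hc \<phi>] test_functions_L2(2)[OF O t]]
    note i2 = L2_mult_integrable[OF bd[OF dhc \<phi>] test_functions_L2(1)[OF O t]]
    note i3 = L2_mult_integrable[OF bd[OF hc Gi] test_functions_L2(1)[OF O t]]
    have "(LINT x|lebesgue_on \<Omega>. h x * \<phi> x * partial_deriv i \<theta> x) + (LINT x|lebesgue_on \<Omega>. partial_deriv i h x * \<phi> x * \<theta> x)
        = (LINT x|lebesgue_on \<Omega>. h x * \<phi> x * partial_deriv i \<theta> x + partial_deriv i h x * \<phi> x * \<theta> x)"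
      by (rule Bochner_Integration.integral_add[OF i1 i2, symmetric])
    also have "\<dots> = (LINT x|lebesgue_on \<Omega>. \<phi> x * partial_deriv i (\<lambda>x. h x * \<theta> x) x)"
      unfolding d by (simp add: algebra_simps)
    also have "\<dots> = - (LINT x|lebesgue_on \<Omega>. G x $ i * (h x * \<theta> x))"
      using G(2) ht unfolding has_weak_grad_def by blast
    also have "\<dots> = - (LINT x|lebesgue_on \<Omega>. h x * G x $ i * \<theta> x)"
      by (simp add: mult_ac)
    finally have "(LINT x|lebesgue_on \<Omega>. h x * \<phi> x * partial_deriv i \<theta> x) =
       - ((LINT x|lebesgue_on \<Omega>. h x * G x $ i * \<theta> x) + (LINT x|lebesgue_on \<Omega>. partial_deriv i h x * \<phi> x * \<theta> x))"
      by (simp add: eq_neg_iff_add_eq_0 algebra_simps)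
    also have "\<dots> = - (LINT x|lebesgue_on \<Omega>. h x * G x $ i * \<theta> x + partial_deriv i h x * \<phi> x * \<theta> x)"
      by (simp only: Bochner_Integration.integral_add[OF i3 i2])
    finally show "(LINT x|lebesgue_on \<Omega>. h x * \<phi> x * partial_deriv i \<theta> x) =
       - (LINT x|lebesgue_on \<Omega>. (\<chi> i. h x * G x $ i + partial_deriv i h x * \<phi> x) $ i * \<theta> x)"
      by (simp add: distrib_right)
  qed
qed

text \<open>The real coefficient is differentiated against real test functions; the real and imaginary parts of a
complex test function are such.\<close>

lemma has_weak_grad_of_real:
  fixes a :: "real^3 \<Rightarrow> real" and Ga :: "real^3 \<Rightarrow> real^3"
  assumes O: "open \<Omega>" "bounded \<Omega>"
    and a: "a \<in> borel_measurable (lebesgue_on \<Omega>)" "AE x in lebesgue_on \<Omega>. \<bar>a x\<bar> \<le> B"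
    and Ga: "\<And>i. (\<lambda>x. Ga x $ i) \<in> borel_measurable (lebesgue_on \<Omega>)" "\<And>i. AE x in lebesgue_on \<Omega>. \<bar>Ga x $ i\<bar> \<le> B"
    and w: "has_weak_grad \<Omega> a Ga"
  shows "has_weak_grad \<Omega> (\<lambda>x. complex_of_real (a x)) (\<lambda>x. \<chi> i. complex_of_real (Ga x $ i))"
  unfolding has_weak_grad_def
proof (intro allI ballI)
  fix i and \<theta> :: "real^3 \<Rightarrow> complex" assume t: "\<theta> \<in> test_functions \<Omega>"
  have ac: "(\<lambda>x. complex_of_real (a x)) \<in> L2 \<Omega>" by (rule bounded_L2[OF O, where B = B]) (use a in auto)
  have gc: "(\<lambda>x. complex_of_real (Ga x $ i)) \<in> L2 \<Omega>" by (rule bounded_L2[OF O, where B = B]) (use Ga in auto)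
  note i1 = L2_mult_integrable[OF ac test_functions_L2(2)[OF O t]]
  note i2 = L2_mult_integrable[OF gc test_functions_L2(1)[OF O t]]
  have part: "L (LINT x|lebesgue_on \<Omega>. complex_of_real (a x) * partial_deriv i \<theta> x) =
     - L (LINT x|lebesgue_on \<Omega>. complex_of_real (Ga x $ i) * \<theta> x)"
    if L: "bounded_linear L" and Lr: "\<And>u z. L (complex_of_real u * z) = u * L z" for L :: "complex \<Rightarrow> real"
  proof -
    have "L (LINT x|lebesgue_on \<Omega>. complex_of_real (a x) * partial_deriv i \<theta> x) =
       (LINT x|lebesgue_on \<Omega>. L (complex_of_real (a x) * partial_deriv i \<theta> x))"
      by (rule integral_bounded_linear[OF L i1, symmetric])
    also have "\<dots> = (LINT x|lebesgue_on \<Omega>. a x * partial_deriv i (\<lambda>x. L (\<theta> x)) x)"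
      by (simp add: Lr partial_deriv_bounded_linear[OF L test_functions_differentiable[OF t]])
    also have "\<dots> = - (LINT x|lebesgue_on \<Omega>. Ga x $ i * L (\<theta> x))"
      using w test_functions_linear[OF L t] unfolding has_weak_grad_def by blast
    also have "(LINT x|lebesgue_on \<Omega>. Ga x $ i * L (\<theta> x)) = (LINT x|lebesgue_on \<Omega>. L (complex_of_real (Ga x $ i) * \<theta> x))"
      by (simp add: Lr)
    also have "\<dots> = L (LINT x|lebesgue_on \<Omega>. complex_of_real (Ga x $ i) * \<theta> x)"
      by (rule integral_bounded_linear[OF L i2])
    finally show ?thesis .
  qed
  have "(LINT x|lebesgue_on \<Omega>. complex_of_real (a x) * partial_deriv i \<theta> x) =
     - (LINT x|lebesgue_on \<Omega>. complex_of_real (Ga x $ i) * \<theta> x)"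
    by (rule complex_eqI) (use part[OF bounded_linear_Re] part[OF bounded_linear_Im] in simp_all)
  then show "(LINT x|lebesgue_on \<Omega>. complex_of_real (a x) * partial_deriv i \<theta> x) =
     - (LINT x|lebesgue_on \<Omega>. (\<chi> i. complex_of_real (Ga x $ i)) $ i * \<theta> x)" by simp
qed

lemma smoothing_kernel_partial_zero:
  assumes k: "smoothing_kernel a r k" and z: "z \<notin> cball a r"
  shows "partial_deriv i k z = 0"
  by (rule partial_deriv_zero_open[of "- cball a r"]) (use z smoothing_kernel_zero[OF k] in \<open>auto simp: open_Compl\<close>)

lemma mollify_eq_0:
  assumes "\<And>z. z \<notin> cball a r \<Longrightarrow> k z = 0" and "\<And>y. y \<in> cball (x + a) r \<Longrightarrow> f y = 0"
  shows "mollify k f x = 0"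
proof -
  have *: "f y * k (y - x) = 0" for y
  proof (cases "y \<in> cball (x + a) r")
    case False
    then have "y - x \<notin> cball a r" by (simp add: dist_norm algebra_simps)
    then show ?thesis using assms(1) by simp
  qed (use assms(2) in simp)
  show ?thesis unfolding mollify_def * by simp
qed

lemma partial_deriv_mollify_kernel:
  assumes k: "smoothing_kernel a r k" and f: "integrable lebesgue f"
  shows "partial_deriv i (mollify k f) x = mollify (\<lambda>z. - partial_deriv i k z) f x"
  by (rule partial_deriv_mollify[OF smoothing_kernel_smooth[OF k] smoothing_kernel_zero_norm[OF k] f])

lemma C_k_mollify_kernel:
  assumes k: "smoothing_kernel a r k" and f: "integrable lebesgue f"
  shows "C_k m (mollify k f)"
  by (rule C_k_mollify[where R = "norm a + r", OF _ f smoothing_kernel_smooth[OF k]]) (rule smoothing_kernel_zero_norm[OF k])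

text \<open>As a function of \<open>y\<close>, the kernel \<open>k (y - x)\<close> is a test function on \<open>\<Omega>\<close>, so the jump of the extension
across the boundary is invisible at \<open>x\<close>.\<close>

lemma partial_deriv_mollify_extension:
  fixes \<phi> :: "real^3 \<Rightarrow> complex"
  assumes O: "open \<Omega>" "bounded \<Omega>" and \<phi>: "\<phi> \<in> L2 \<Omega>" and G: "has_weak_grad \<Omega> \<phi> G"
    and k: "smoothing_kernel a r k" and sub: "cball (x + a) r \<subseteq> \<Omega>"
  shows "partial_deriv i (mollify k (\<lambda>x. indicator \<Omega> x *\<^sub>R \<phi> x)) x = mollify k (\<lambda>x. indicator \<Omega> x *\<^sub>R (G x $ i)) x"
proof -
  have d: "partial_deriv i (\<lambda>y. k (y - x)) y = partial_deriv i k (y - x)" for y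
    by (rule partial_deriv_shift) (rule C_k_differentiable[OF smoothing_kernel_smooth[OF k, of "Suc 0"]])
  have "partial_deriv i (mollify k (\<lambda>x. indicator \<Omega> x *\<^sub>R \<phi> x)) x = (LINT y|lebesgue_on \<Omega>. \<phi> y * - partial_deriv i k (y - x))"
    unfolding partial_deriv_mollify_kernel[OF k L2_extension(1)[OF O \<phi>]] by (rule mollify_extension_eq[OF O(1)])
  also have "\<dots> = - (LINT y|lebesgue_on \<Omega>. \<phi> y * partial_deriv i (\<lambda>y. k (y - x)) y)"
    by (simp add: d)
  also have "\<dots> = (LINT y|lebesgue_on \<Omega>. G y $ i * k (y - x))"
    using G smoothing_kernel_test_function[OF k sub] unfolding has_weak_grad_def by simp
  also have "\<dots> = mollify k (\<lambda>x. indicator \<Omega> x *\<^sub>R (G x $ i)) x"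
    by (rule mollify_extension_eq[OF O(1), symmetric])
  finally show ?thesis .
qed

lemma smoothing_kernel_shift_integral:
  assumes k: "smoothing_kernel a r k"
  shows "integrable lebesgue (\<lambda>y. Re (k (y - x)))" "(LINT y|lebesgue. Re (k (y - x))) = 1"
    "\<And>z. 0 \<le> Re (k z)" "\<And>z. k z = of_real (Re (k z))" "\<And>z. norm (k z) = Re (k z)"
proof -
  obtain \<rho> where \<rho>: "k = (\<lambda>z. of_real (\<rho> z))" "smooth \<rho>" "\<And>z. 0 \<le> \<rho> z" "(LINT z|lborel. \<rho> z) = 1"
    using k unfolding smoothing_kernel_def by blast
  have [measurable]: "\<rho> \<in> borel_measurable borel"
    by (rule borel_measurable_continuous_onI[OF smooth_continuous[OF \<rho>(2)]])
  have i: "integrable lborel \<rho>" using \<rho>(4) not_integrable_integral_eq by fastforce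
  have "integrable lborel (\<lambda>y. \<rho> (y + - x))" using i by (simp only: lborel_integrable_translation)
  then show "integrable lebesgue (\<lambda>y. Re (k (y - x)))"
    by (subst integrable_completion) (auto simp: \<rho>(1))
  have "(LINT y|lborel. \<rho> (y + - x)) = 1" using \<rho>(4) by (simp only: lborel_integral_translation)
  then show "(LINT y|lebesgue. Re (k (y - x))) = 1"
    by (subst integral_completion) (auto simp: \<rho>(1))
qed (use k in \<open>auto simp: smoothing_kernel_def\<close>)

lemma mollify_norm_bound:
  assumes k: "smoothing_kernel a r k" and f: "integrable lebesgue f" and B: "AE y in lebesgue. norm (f y) \<le> B"
  shows "norm (mollify k f x) \<le> B"
proof -
  note K = smoothing_kernel_shift_integral[OF k]
  have "norm (mollify k f x) \<le> (LINT y|lebesgue. norm (f y * k (y - x)))"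
    unfolding mollify_def by (rule integral_norm_bound)
  also have "\<dots> \<le> (LINT y|lebesgue. B * Re (k (y - x)))"
  proof (rule integral_mono_AE)
    show "integrable lebesgue (\<lambda>y. norm (f y * k (y - x)))"
      by (intro integrable_norm mollify_integrable[OF f _ smoothing_kernel_zero_norm[OF k]] C_k_continuous[OF smoothing_kernel_smooth[OF k]])
    show "integrable lebesgue (\<lambda>y. B * Re (k (y - x)))" using K(1) by simp
    show "AE y in lebesgue. norm (f y * k (y - x)) \<le> B * Re (k (y - x))"
      using B by eventually_elim (use K(3,5) in \<open>simp add: norm_mult mult_right_mono\<close>)
  qed
  also have "\<dots> = B" using K(2) by simp
  finally show ?thesis .
qed

text \<open>Lower bounds survive averaging; this keeps the mollified coefficient away from zero.\<close>

lemma mollify_Re_lower_bound: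
  assumes k: "smoothing_kernel a r k" and f: "integrable lebesgue f" and B: "AE y in lebesgue. B \<le> Re (f y)"
  shows "B \<le> Re (mollify k f x)"
proof -
  note K = smoothing_kernel_shift_integral[OF k]
  have i: "integrable lebesgue (\<lambda>y. f y * k (y - x))"
    by (intro mollify_integrable[OF f _ smoothing_kernel_zero_norm[OF k]] C_k_continuous[OF smoothing_kernel_smooth[OF k]])
  have "B = (LINT y|lebesgue. B * Re (k (y - x)))" using K(2) by simp
  also have "\<dots> \<le> (LINT y|lebesgue. Re (f y * k (y - x)))"
  proof (rule integral_mono_AE)
    show "integrable lebesgue (\<lambda>y. B * Re (k (y - x)))" using K(1) by simp
    show "integrable lebesgue (\<lambda>y. Re (f y * k (y - x)))" using i by (rule integrable_Re)
    show "AE y in lebesgue. B * Re (k (y - x)) \<le> Re (f y * k (y - x))"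
      using B
    proof eventually_elim
      case (elim y)
      have "Im (k (y - x)) = 0" by (metis K(4) Im_complex_of_real)
      then have eq: "Re (f y * k (y - x)) = Re (f y) * Re (k (y - x))" by simp
      show ?case unfolding eq by (rule mult_right_mono[OF elim K(3)])
    qed
  qed
  also have "\<dots> = Re (mollify k f x)" unfolding mollify_def using i by (rule integral_Re)
  finally show ?thesis .
qed

section \<open>Products and quotients of limits in mean\<close>

definition L1_lim :: "'a measure \<Rightarrow> (nat \<Rightarrow> 'a \<Rightarrow> complex) \<Rightarrow> ('a \<Rightarrow> complex) \<Rightarrow> bool" where
  "L1_lim M u v \<longleftrightarrow> (\<forall>n. integrable M (u n)) \<and> integrable M v \<and> (\<lambda>n. LINT x|M. norm (u n x - v x)) \<longlonglongrightarrow> 0"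

lemma L1_lim_integral: "L1_lim M u v \<Longrightarrow> (\<lambda>n. LINT x|M. u n x) \<longlonglongrightarrow> (LINT x|M. v x)"
  unfolding L1_lim_def
proof (elim conjE)
  assume u: "\<forall>n. integrable M (u n)" and v: "integrable M v" and lim: "(\<lambda>n. LINT x|M. norm (u n x - v x)) \<longlonglongrightarrow> 0"
  have "norm ((LINT x|M. u n x) - (LINT x|M. v x)) \<le> (LINT x|M. norm (u n x - v x))" for n
    using u v integral_norm_bound[of M "\<lambda>x. u n x - v x"] by (simp add: Bochner_Integration.integral_diff)
  then have "(\<lambda>n. (LINT x|M. u n x) - (LINT x|M. v x)) \<longlonglongrightarrow> 0"
    by (intro Lim_null_comparison[OF _ lim] always_eventually) blast
  then show ?thesis by (rule LIM_zero_cancel)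
qed

lemma L1_lim_add: "L1_lim M u v \<Longrightarrow> L1_lim M u' v' \<Longrightarrow> L1_lim M (\<lambda>n x. u n x + u' n x) (\<lambda>x. v x + v' x)"
  unfolding L1_lim_def
proof (elim conjE, intro conjI allI)
  assume u: "\<forall>n. integrable M (u n)" "\<forall>n. integrable M (u' n)" and v: "integrable M v" "integrable M v'"
    and lim: "(\<lambda>n. LINT x|M. norm (u n x - v x)) \<longlonglongrightarrow> 0" "(\<lambda>n. LINT x|M. norm (u' n x - v' x)) \<longlonglongrightarrow> 0"
  show "(\<lambda>n. LINT x|M. norm (u n x + u' n x - (v x + v' x))) \<longlonglongrightarrow> 0"
  proof (rule Lim_null_comparison[OF always_eventually, rule_format])
    fix n
    have "(LINT x|M. norm (u n x + u' n x - (v x + v' x))) \<le> (LINT x|M. norm (u n x - v x) + norm (u' n x - v' x))"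
      using u v by (intro integral_mono) (auto simp: add_diff_add norm_triangle_ineq)
    also have "\<dots> = (LINT x|M. norm (u n x - v x)) + (LINT x|M. norm (u' n x - v' x))"
      using u v by simp
    finally show "norm (LINT x|M. norm (u n x + u' n x - (v x + v' x))) \<le> (LINT x|M. norm (u n x - v x)) + (LINT x|M. norm (u' n x - v' x))"
      by simp
    show "(\<lambda>n. (LINT x|M. norm (u n x - v x)) + (LINT x|M. norm (u' n x - v' x))) \<longlonglongrightarrow> 0"
      using tendsto_add[OF lim] by simp
  qed
qed auto

lemma L1_lim_sum:
  assumes "\<And>i. i \<in> I \<Longrightarrow> L1_lim M (u i) (v i)"
  shows "L1_lim M (\<lambda>n x. \<Sum>i\<in>I. u i n x) (\<lambda>x. \<Sum>i\<in>I. v i x)"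
  using assms
proof (induction I rule: infinite_finite_induct)
  case (insert i I)
  then show ?case using L1_lim_add[of M "u i" "v i" "\<lambda>n x. \<Sum>i\<in>I. u i n x" "\<lambda>x. \<Sum>i\<in>I. v i x"] by simp
qed (simp_all add: L1_lim_def)

lemma L1_lim_minus: "L1_lim M u v \<Longrightarrow> L1_lim M (\<lambda>n x. - u n x) (\<lambda>x. - v x)"
  unfolding L1_lim_def by (simp add: norm_minus_commute)

text \<open>In \<open>u b - v c = (u - v) b + v (b - c)\<close> the first term is bounded by \<open>B |u - v|\<close>. The second one is at
most \<open>N |b - c|\<close> where \<open>|v| \<le> N\<close>, and its remaining part is controlled by the tail of \<open>|v|\<close>.\<close>

lemma L1_lim_mult:
  assumes u: "L1_lim M u v" and b: "L1_lim M b c"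
    and B: "\<And>n. AE x in M. norm (b n x) \<le> B" "AE x in M. norm (c x) \<le> B"
  shows "L1_lim M (\<lambda>n x. u n x * b n x) (\<lambda>x. v x * c x)"
proof -
  have ui: "integrable M (u n)" and vi: "integrable M v" and ul: "(\<lambda>n. LINT x|M. norm (u n x - v x)) \<longlonglongrightarrow> 0" for n
    using u by (auto simp: L1_lim_def)
  have bi: "integrable M (b n)" and ci: "integrable M c" and bl: "(\<lambda>n. LINT x|M. norm (b n x - c x)) \<longlonglongrightarrow> 0" for n
    using b by (auto simp: L1_lim_def)
  note [measurable] = borel_measurable_integrable[OF ui] borel_measurable_integrable[OF vi]
    borel_measurable_integrable[OF bi] borel_measurable_integrable[OF ci]
  have 1: "integrable M (\<lambda>x. u n x * b n x)" for n by (rule integrable_mult_bounded[OF ui _ B(1)]) measurable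
  have 2: "integrable M (\<lambda>x. v x * c x)" by (rule integrable_mult_bounded[OF vi _ B(2)]) measurable
  define R where "R N x = indicator {x. real N < norm (v x)} x * norm (v x)" for N x
  have Ri: "integrable M (R N)" for N
    using integral_tail_tendsto_0(1)[OF integrable_norm[OF vi], of "\<lambda>x. norm (v x)" N] by (simp add: R_def[abs_def])
  have "(\<lambda>N. LINT x|M. R N x) \<longlonglongrightarrow> 0"
    using integral_tail_tendsto_0(2)[OF integrable_norm[OF vi], of "\<lambda>x. norm (v x)"] by (simp add: R_def)
  then have Rl: "(\<lambda>N. 2 * \<bar>B\<bar> * (LINT x|M. R N x)) \<longlonglongrightarrow> 2 * \<bar>B\<bar> * 0"
    by (intro tendsto_intros)
  have est: "(LINT x|M. norm (u n x * b n x - v x * c x)) \<le>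
     \<bar>B\<bar> * (LINT x|M. norm (u n x - v x)) + real N * (LINT x|M. norm (b n x - c x)) + 2 * \<bar>B\<bar> * (LINT x|M. R N x)" for n N
  proof -
    have "(LINT x|M. norm (u n x * b n x - v x * c x)) \<le>
       (LINT x|M. \<bar>B\<bar> * norm (u n x - v x) + real N * norm (b n x - c x) + 2 * \<bar>B\<bar> * R N x)"
    proof (rule integral_mono_AE)
      show "AE x in M. norm (u n x * b n x - v x * c x) \<le> \<bar>B\<bar> * norm (u n x - v x) + real N * norm (b n x - c x) + 2 * \<bar>B\<bar> * R N x"
        using B(1)[of n] B(2)
      proof eventually_elim
        case (elim x)
        have bB: "norm (b n x) \<le> \<bar>B\<bar>" "norm (c x) \<le> \<bar>B\<bar>" using elim by linarith+
        have "u n x * b n x - v x * c x = (u n x - v x) * b n x + v x * (b n x - c x)" by (simp add: algebra_simps)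
        then have "norm (u n x * b n x - v x * c x) \<le> norm (u n x - v x) * norm (b n x) + norm (v x) * norm (b n x - c x)"
          using norm_triangle_ineq[of "(u n x - v x) * b n x" "v x * (b n x - c x)"] by (simp add: norm_mult)
        moreover have "norm (u n x - v x) * norm (b n x) \<le> \<bar>B\<bar> * norm (u n x - v x)"
          using bB(1) by (subst mult.commute) (rule mult_right_mono, auto)
        moreover have "norm (v x) * norm (b n x - c x) \<le> real N * norm (b n x - c x) + 2 * \<bar>B\<bar> * R N x"
        proof (cases "real N < norm (v x)")
          case True
          have "norm (b n x - c x) \<le> 2 * \<bar>B\<bar>" using norm_triangle_ineq4[of "b n x" "c x"] bB by linarith
          then have 1: "norm (v x) * norm (b n x - c x) \<le> norm (v x) * (2 * \<bar>B\<bar>)" by (rule mult_left_mono) simp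
          have R: "R N x = norm (v x)" using True by (simp add: R_def)
          have 2: "0 \<le> real N * norm (b n x - c x)" by simp
          have 3: "norm (v x) * (2 * \<bar>B\<bar>) = 2 * \<bar>B\<bar> * norm (v x)" by simp
          show ?thesis using 1 2 unfolding R 3 by linarith
        next
          case False
          then show ?thesis by (simp add: R_def mult_right_mono)
        qed
        ultimately show ?case by linarith
      qed
    qed (use 1 2 ui vi bi ci Ri in auto)
    also have "\<dots> = \<bar>B\<bar> * (LINT x|M. norm (u n x - v x)) + real N * (LINT x|M. norm (b n x - c x)) + 2 * \<bar>B\<bar> * (LINT x|M. R N x)"
      using ui vi bi ci Ri by simp
    finally show ?thesis .
  qed
  have "(\<lambda>n. LINT x|M. norm (u n x * b n x - v x * c x)) \<longlonglongrightarrow> 0"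
  proof (rule tendstoI)
    fix e :: real assume e: "0 < e"
    have "\<forall>\<^sub>F N in sequentially. 2 * \<bar>B\<bar> * (LINT x|M. R N x) < e / 2"
      by (rule order_tendstoD(2)[OF Rl]) (use e in simp)
    then obtain N where N: "2 * \<bar>B\<bar> * (LINT x|M. R N x) < e / 2" by (auto simp: eventually_sequentially)
    have "(\<lambda>n. \<bar>B\<bar> * (LINT x|M. norm (u n x - v x)) + real N * (LINT x|M. norm (b n x - c x))) \<longlonglongrightarrow> \<bar>B\<bar> * 0 + real N * 0"
      by (intro tendsto_intros ul bl)
    then have "\<forall>\<^sub>F n in sequentially. \<bar>B\<bar> * (LINT x|M. norm (u n x - v x)) + real N * (LINT x|M. norm (b n x - c x)) < e / 2"
      by (rule order_tendstoD(2)) (use e in simp)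
    then show "\<forall>\<^sub>F n in sequentially. dist (LINT x|M. norm (u n x * b n x - v x * c x)) 0 < e"
    proof eventually_elim
      case (elim n)
      then show ?case using est[of n N] N by (simp add: integral_nonneg_AE)
    qed
  qed
  then show ?thesis using 1 2 by (simp add: L1_lim_def)
qed

lemma L1_lim_inverse:
  fixes b :: "nat \<Rightarrow> 'a \<Rightarrow> complex"
  assumes b: "L1_lim M b c" and fin: "finite_measure M" and m: "0 < m" "\<And>n x. m \<le> norm (b n x)" "AE x in M. m \<le> norm (c x)"
  shows "L1_lim M (\<lambda>n x. inverse (b n x)) (\<lambda>x. inverse (c x))"
proof -
  interpret finite_measure M by fact
  have bi: "integrable M (b n)" and ci: "integrable M c" and bl: "(\<lambda>n. LINT x|M. norm (b n x - c x)) \<longlonglongrightarrow> 0" for n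
    using b by (auto simp: L1_lim_def)
  note [measurable] = borel_measurable_integrable[OF bi] borel_measurable_integrable[OF ci]
  have inv: "norm (inverse z) \<le> inverse m" if "m \<le> norm z" for z :: complex
    using that m(1) by (simp add: norm_inverse le_imp_inverse_le)
  have 1: "integrable M (\<lambda>x. inverse (b n x))" for n
    by (rule integrable_const_bound[of _ "inverse m"]) (auto intro!: inv m)
  have 2: "integrable M (\<lambda>x. inverse (c x))"
    by (rule integrable_const_bound[of _ "inverse m"]) (use m(3) inv in \<open>auto elim: eventually_mono\<close>)
  have "(\<lambda>n. LINT x|M. norm (inverse (b n x) - inverse (c x))) \<longlonglongrightarrow> 0"
  proof (rule Lim_null_comparison[OF always_eventually, rule_format])
    fix n
    have "(LINT x|M. norm (inverse (b n x) - inverse (c x))) \<le> (LINT x|M. inverse m * inverse m * norm (b n x - c x))"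
    proof (rule integral_mono_AE)
      show "AE x in M. norm (inverse (b n x) - inverse (c x)) \<le> inverse m * inverse m * norm (b n x - c x)"
        using m(3)
      proof eventually_elim
        case (elim x)
        have nz: "b n x \<noteq> 0" "c x \<noteq> 0" using m(1) m(2)[of n x] elim by auto
        have "inverse (b n x) - inverse (c x) = inverse (b n x) * (c x - b n x) * inverse (c x)"
          using nz by (simp add: field_simps)
        then have "norm (inverse (b n x) - inverse (c x)) = (norm (inverse (b n x)) * norm (inverse (c x))) * norm (b n x - c x)"
          by (simp add: norm_mult norm_minus_commute)
        also have "\<dots> \<le> (inverse m * inverse m) * norm (b n x - c x)"
          by (intro mult_right_mono mult_mono inv m elim) (use m(1) in auto)
        finally show ?case .
      qed
    qed (use 1 2 bi ci in auto)
    then show "norm (LINT x|M. norm (inverse (b n x) - inverse (c x))) \<le> inverse m * inverse m * (LINT x|M. norm (b n x - c x))"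
      by simp
    show "(\<lambda>n. inverse m * inverse m * (LINT x|M. norm (b n x - c x))) \<longlonglongrightarrow> 0"
    proof -
      have "(\<lambda>n. inverse m * inverse m * (LINT x|M. norm (b n x - c x))) \<longlonglongrightarrow> inverse m * inverse m * 0"
        by (intro tendsto_intros bl)
      then show ?thesis by simp
    qed
  qed
  then show ?thesis using 1 2 by (simp add: L1_lim_def)
qed

lemma mollification_L1_lim:
  fixes c f :: "real^3 \<Rightarrow> complex"
  assumes O: "open \<Omega>" "bounded \<Omega>" and c: "c \<in> L2 \<Omega>" and f: "f \<in> L2 \<Omega>"
    and k: "\<And>n. smoothing_kernel (a n) (r n) (k n)"
    and lim: "(\<lambda>n. norm (a n) + r n) \<longlonglongrightarrow> 0"
  shows "L1_lim (lebesgue_on \<Omega>) (\<lambda>n x. c x * mollify (k n) (\<lambda>x. indicator \<Omega> x *\<^sub>R f x) x) (\<lambda>x. c x * f x)"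
proof -
  let ?c = "\<lambda>x. indicator \<Omega> x *\<^sub>R c x" and ?f = "\<lambda>x. indicator \<Omega> x *\<^sub>R f x"
  note C = L2_extension[OF O c] and F = L2_extension[OF O f]
  note i = mollification_error_integrable[OF C F k lim]
  have eq: "?c x * (mollify (k n) ?f x - ?f x) = indicator \<Omega> x *\<^sub>R (c x * mollify (k n) ?f x - c x * f x)" for n x
    by (simp add: indicator_def right_diff_distrib)
  have i': "integrable (lebesgue_on \<Omega>) (\<lambda>x. c x * mollify (k n) ?f x - c x * f x)" for n
  proof -
    have "integrable lebesgue (\<lambda>x. indicator \<Omega> x *\<^sub>R (c x * mollify (k n) ?f x - c x * f x))"
      using i[of n] unfolding eq .
    then show ?thesis using O by (subst integrable_restrict_space) auto
  qed
  have cf: "integrable (lebesgue_on \<Omega>) (\<lambda>x. c x * f x)" by (rule L2_mult_integrable[OF c f])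
  have "integrable (lebesgue_on \<Omega>) (\<lambda>x. c x * mollify (k n) ?f x)" for n
    using Bochner_Integration.integrable_add[OF i'[of n] cf] by simp
  moreover have "(LINT x|lebesgue_on \<Omega>. norm (c x * mollify (k n) ?f x - c x * f x)) =
      (LINT x|lebesgue. norm (?c x * (mollify (k n) ?f x - ?f x)))" for n
    unfolding eq using O by (subst integral_restrict_space) (auto intro!: Bochner_Integration.integral_cong simp: indicator_def)
  ultimately show ?thesis
    using mollification_error_tendsto_0[OF C F k lim] cf by (simp add: L1_lim_def)
qed

section \<open>Partitions of unity\<close>

text \<open>Bump functions around finitely many points have a sum \<open>s\<close> that is at least its minimum \<open>s x0 > 0\<close> on
\<open>K\<close>, but \<open>s\<close> may vanish elsewhere. Adding \<open>exp (- 1 / (s x0 - s))\<close> where \<open>s < s x0\<close> gives a denominator that is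
smooth and positive everywhere and equals \<open>s\<close> on \<open>K\<close>.\<close>

lemma smooth_partition_of_unity:
  fixes K :: "(real^3) set"
  assumes K: "compact K" and r: "\<And>p. p \<in> K \<Longrightarrow> 0 < r p"
  shows "\<exists>D h. finite D \<and> D \<subseteq> K \<and> (\<forall>p\<in>D. smooth (h p) \<and> (\<forall>x. x \<notin> ball p (r p) \<longrightarrow> h p x = 0)) \<and>
     (\<forall>x\<in>K. (\<Sum>p\<in>D. h p x) = (1::real))"
proof (cases "K = {}")
  case True
  then show ?thesis by (intro exI[of _ "{}"]) auto
next
  case False
  have "K \<subseteq> (\<Union>p\<in>K. ball p (r p))" using r by force
  then obtain D where D: "D \<subseteq> K" "finite D" "K \<subseteq> (\<Union>p\<in>D. ball p (r p))"
    using compactE_image[OF K, of K "\<lambda>p. ball p (r p)"] by auto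
  define s where "s x = (\<Sum>p\<in>D. bump p (r p) x)" for x
  have sk: "C_k m s" for m
    unfolding s_def[abs_def] using smooth_bump by (intro C_k_sum) (simp add: smooth_def del: C_k.simps)
  have s0: "0 \<le> s x" for x unfolding s_def by (intro sum_nonneg bump_nonneg)
  have spos: "0 < s x" if x: "x \<in> K" for x
  proof -
    obtain p where p: "p \<in> D" "x \<in> ball p (r p)" using D(3) x by blast
    then have "0 < bump p (r p) x" using bump_pos_iff r D(1) by blast
    then show ?thesis unfolding s_def using p(1) D(2) bump_nonneg by (intro sum_pos2[of D p]) auto
  qed
  obtain x0 where x0: "x0 \<in> K" "\<And>x. x \<in> K \<Longrightarrow> s x0 \<le> s x"
    using continuous_attains_inf[OF K False C_k_continuous[OF sk]] by blast
  define t where "t x = s x + flat_exp 1 (s x0 - s x)" for x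
  have tk: "C_k m t" for m
    unfolding t_def[abs_def] by (intro C_k_add sk C_k_flat_exp C_k_diff C_k_const)
  have tpos: "0 < t x" for x
  proof (cases "s x < s x0")
    case True
    then show ?thesis using s0[of x] by (simp add: t_def flat_exp_def add_nonneg_pos)
  next
    case False
    then show ?thesis using spos[OF x0(1)] by (simp add: t_def flat_exp_def)
  qed
  have ts: "t x = s x" if "x \<in> K" for x using x0(2)[OF that] by (simp add: t_def flat_exp_def)
  have "smooth (\<lambda>x. bump p (r p) x / t x)" for p
    unfolding smooth_def using tpos smooth_bump[of p "r p"] tk
    by (intro allI C_k_divide) (auto simp: smooth_def less_imp_neq[symmetric] simp del: C_k.simps)
  moreover have "bump p (r p) x / t x = 0" if "p \<in> D" "x \<notin> ball p (r p)" for p x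
    using bump_eq_0[OF _ that(2)] r D(1) that(1) by auto
  moreover have "(\<Sum>p\<in>D. bump p (r p) x / t x) = 1" if "x \<in> K" for x
    using spos[OF that] ts[OF that] by (simp add: sum_divide_distrib[symmetric] s_def)
  ultimately show ?thesis using D by (intro exI[of _ D] exI[of _ "\<lambda>p x. bump p (r p) x / t x"]) auto
qed

section \<open>The quotient identity\<close>

text \<open>The product \<open>c \<cdot> grad (\<phi> / b)\<close>, expanded by the quotient rule with weak gradients \<open>G\<close> of \<open>\<phi>\<close> and \<open>g\<close> of \<open>b\<close>.\<close>

definition quotient_form ::
  "(real^3 \<Rightarrow> complex^3) \<Rightarrow> (real^3 \<Rightarrow> complex) \<Rightarrow> (3 \<Rightarrow> real^3 \<Rightarrow> complex) \<Rightarrow> (real^3 \<Rightarrow> complex) \<Rightarrow> (real^3 \<Rightarrow> complex^3) \<Rightarrow> real^3 \<Rightarrow> complex" where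
  "quotient_form c b g \<phi> G x =
     (\<Sum>i\<in>UNIV. c x $ i * G x $ i * inverse (b x) + - (c x $ i * \<phi> x * g i x * inverse (b x) * inverse (b x)))"

text \<open>The quotient identity for \<open>\<phi>\<close> vanishing outside a ball in which the cone condition holds. The orthogonality of
\<open>c\<close> to gradients applies to the smooth quotient of the mollifications of \<open>\<phi>\<close> and \<open>b\<close>, all taken with the same
kernels, supported in the cone at distance of order \<open>t n\<close>. On \<open>\<Omega>\<close> the gradient of this quotient contains only
mollifications of the weak gradients: near \<open>p\<close> because the kernels stay inside \<open>\<Omega>\<close>, and elsewhere because \<open>\<phi>\<close>
and \<open>G\<close> vanish on the sampled set.\<close>

lemma local_quotient_identity:
  fixes c :: "real^3 \<Rightarrow> complex^3" and b \<phi> :: "real^3 \<Rightarrow> complex" and g :: "3 \<Rightarrow> real^3 \<Rightarrow> complex" and G :: "real^3 \<Rightarrow> complex^3"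
  assumes O: "open \<Omega>" "bounded \<Omega>"
    and c: "c \<in> L2 \<Omega>" "\<And>\<psi>. C_k 2 \<psi> \<Longrightarrow> (LINT x|lebesgue_on \<Omega>. c x \<bullet>\<^sub>c grad \<psi> x) = 0"
    and b: "b \<in> borel_measurable (lebesgue_on \<Omega>)" "AE x in lebesgue_on \<Omega>. norm (b x) \<le> B"
      "AE x in lebesgue_on \<Omega>. m \<le> Re (b x)" "0 < m"
    and g: "\<And>i. g i \<in> borel_measurable (lebesgue_on \<Omega>)" "\<And>i. AE x in lebesgue_on \<Omega>. norm (g i x) \<le> B"
      "has_weak_grad \<Omega> b (\<lambda>x. \<chi> i. g i x)"
    and \<phi>: "\<phi> \<in> L2 \<Omega>" "G \<in> L2 \<Omega>" "has_weak_grad \<Omega> \<phi> G"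
    and vanish: "\<And>x. x \<notin> ball p s \<Longrightarrow> \<phi> x = 0" "\<And>x. x \<notin> ball p s \<Longrightarrow> G x = 0"
    and s: "s < r"
    and cone: "0 < d" "\<And>x t z. x \<in> \<Omega> \<Longrightarrow> x \<in> ball p r \<Longrightarrow> 0 < t \<Longrightarrow> z \<in> cball e d \<Longrightarrow>
       x + t *\<^sub>R z \<in> ball p r \<Longrightarrow> x + t *\<^sub>R z \<in> \<Omega>"
  shows "integrable (lebesgue_on \<Omega>) (quotient_form c b g \<phi> G)"
    and "(LINT x|lebesgue_on \<Omega>. quotient_form c b g \<phi> G x) = 0"
proof -
  interpret finite_measure "lebesgue_on \<Omega>" by (rule finite_measure_lebesgue_on_open[OF O])
  define m' where "m' = min m 1"
  have m': "0 < m'" "m' \<le> m" "m' \<le> 1" using b(4) by (auto simp: m'_def)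
  \<comment> \<open>The factor keeps every sampled point within \<open>(r - s) / 2\<close> of \<open>x\<close>, so that points with \<open>|x - p| < (r + s) / 2\<close>
      do not sample outside \<open>ball p r\<close>, and other points do not sample \<open>ball p s\<close>.\<close>
  define t where "t n = ((r - s) / (2 * (norm e + d + 1))) * inverse (real (Suc n))" for n
  have ned: "0 < norm e + d + 1" using cone(1) by (simp add: add_nonneg_pos add_pos_pos)
  have t: "0 < t n" for n using s ned by (simp add: t_def)
  have tle: "t n * (norm e + d) < (r - s) / 2" for n
  proof -
    have "t n \<le> (r - s) / (2 * (norm e + d + 1))"
      unfolding t_def using s ned by (intro mult_left_le) (auto simp: inverse_le_1_iff)
    then have "t n * (norm e + d + 1) \<le> (r - s) / 2"
      using ned by (simp add: field_simps)
    then show ?thesis using t[of n] by (simp add: distrib_left)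
  qed
  have t0: "t \<longlonglongrightarrow> 0"
    unfolding t_def using tendsto_mult_right_zero[OF LIMSEQ_inverse_real_of_nat] by blast
  define a where "a n = t n *\<^sub>R e" for n
  define \<rho> where "\<rho> n = t n * d" for n
  have \<rho>: "0 < \<rho> n" for n using t cone(1) by (simp add: \<rho>_def)
  have "(\<lambda>n. t n * (norm e + d)) \<longlonglongrightarrow> 0" by (rule tendsto_mult_left_zero[OF t0])
  moreover have "norm (a n) + \<rho> n = t n * (norm e + d)" for n
    using t[of n] by (simp add: a_def \<rho>_def distrib_left)
  ultimately have lim: "(\<lambda>n. norm (a n) + \<rho> n) \<longlonglongrightarrow> 0" by simp
  have "\<forall>n. \<exists>k. smoothing_kernel (a n) (\<rho> n) k"
    using smoothing_kernel_exists[OF \<rho>] by blast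
  then obtain k where k: "\<And>n. smoothing_kernel (a n) (\<rho> n) (k n)"
    by metis
  define s' where "s' = (r + s) / 2"
  have near: "dist x y < (r - s) / 2" if y: "y \<in> cball (x + a n) (\<rho> n)" for x y n
  proof -
    have "dist x y \<le> norm (a n) + dist (x + a n) y"
      using dist_triangle[of x y "x + a n"] by (simp add: dist_norm)
    also have "\<dots> \<le> t n * (norm e + d)" using y \<open>norm (a n) + \<rho> n = _\<close> by simp
    finally show ?thesis using tle[of n] by simp
  qed
  have inside: "cball (x + a n) (\<rho> n) \<subseteq> \<Omega>" if x: "x \<in> \<Omega>" "x \<in> ball p s'" for x n
  proof
    fix y assume y: "y \<in> cball (x + a n) (\<rho> n)"
    define z where "z = inverse (t n) *\<^sub>R (y - x)"
    have yz: "y = x + t n *\<^sub>R z" using t[of n] by (simp add: z_def)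
    have "norm (t n *\<^sub>R (e - z)) \<le> t n * d"
      using y by (simp add: yz dist_norm a_def \<rho>_def scaleR_diff_right)
    then have "z \<in> cball e d" using t[of n] by (simp add: dist_norm)
    moreover have "y \<in> ball p r"
      using dist_triangle[of p y x] near[OF y] x(2) by (simp add: s'_def field_simps)
    moreover have "x \<in> ball p r" using x(2) s by (simp add: s'_def)
    ultimately show "y \<in> \<Omega>" using cone(2)[OF x(1) _ t[of n], of z] yz by simp
  qed
  have outside: "y \<notin> ball p s" if x: "x \<notin> ball p s'" and y: "y \<in> cball (x + a n) (\<rho> n)" for x y n
    using dist_triangle[of p x y] near[OF y] x by (auto simp: s'_def field_simps dist_commute)
  let ?ext = "\<lambda>f x. indicator \<Omega> x *\<^sub>R (f x :: complex)"
  define l where "l x = b x - 1" for x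
  have one: "(\<lambda>x. 1 :: complex) \<in> L2 \<Omega>" by (simp add: L2_def)
  have bL2: "b \<in> L2 \<Omega>" by (rule bounded_L2[OF O b(1,2)])
  have lL2: "l \<in> L2 \<Omega>" unfolding l_def[abs_def] by (rule L2_diff[OF bL2 one])
  have gL2: "g i \<in> L2 \<Omega>" for i by (rule bounded_L2[OF O g(1,2)])
  have ci: "(\<lambda>x. c x $ i) \<in> L2 \<Omega>" for i using c(1) L2_vec_iff by blast
  have Gi: "(\<lambda>x. G x $ i) \<in> L2 \<Omega>" for i using \<phi>(2) L2_vec_iff by blast
  have wl: "has_weak_grad \<Omega> l (\<lambda>x. \<chi> i. g i x)"
    unfolding has_weak_grad_def
  proof (intro allI ballI)
    fix i and \<theta> :: "real^3 \<Rightarrow> complex" assume th: "\<theta> \<in> test_functions \<Omega>"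
    note dth = test_functions_L2(2)[OF O th, of i]
    have "partial_deriv i (\<lambda>x::real^3. 1 :: complex) x = 0" for x
      using partial_deriv_eq[OF has_derivative_const] by blast
    then have z: "(LINT x|lebesgue_on \<Omega>. partial_deriv i \<theta> x) = 0"
      using C1_has_weak_grad[OF O C_k_const[of 1 1]] th by (simp add: has_weak_grad_def grad_def)
    have "(LINT x|lebesgue_on \<Omega>. l x * partial_deriv i \<theta> x) =
       (LINT x|lebesgue_on \<Omega>. b x * partial_deriv i \<theta> x - partial_deriv i \<theta> x)"
      by (simp add: l_def left_diff_distrib)
    also have "\<dots> = (LINT x|lebesgue_on \<Omega>. b x * partial_deriv i \<theta> x) - (LINT x|lebesgue_on \<Omega>. partial_deriv i \<theta> x)"
      by (rule Bochner_Integration.integral_diff[OF L2_mult_integrable[OF bL2 dth] L2_integrable[OF O dth]])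
    also have "\<dots> = - (LINT x|lebesgue_on \<Omega>. (\<chi> i. g i x) $ i * \<theta> x)"
      using g(3) th z unfolding has_weak_grad_def by simp
    finally show "(LINT x|lebesgue_on \<Omega>. l x * partial_deriv i \<theta> x) = - (LINT x|lebesgue_on \<Omega>. (\<chi> i. g i x) $ i * \<theta> x)" .
  qed
  define P where "P n = mollify (k n) (?ext \<phi>)" for n
  define DP where "DP i n = mollify (k n) (?ext (\<lambda>x. G x $ i))" for i n
  \<comment> \<open>The mollification of \<open>b\<close> extended by \<open>1\<close>; only its integrable part \<open>l = b - 1\<close> is mollified.\<close>
  define Q where "Q n x = 1 + mollify (k n) (?ext l) x" for n x
  define DQ where "DQ i n = mollify (k n) (?ext (g i))" for i n
  have "AE y in lebesgue. y \<in> \<Omega> \<longrightarrow> m \<le> Re (b y)"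
    using b(3) O by (simp add: AE_restrict_space_iff)
  then have "AE y in lebesgue. m' - 1 \<le> Re (?ext l y)"
    by eventually_elim (use m' in \<open>auto simp: l_def indicator_def\<close>)
  then have "m' - 1 \<le> Re (mollify (k n) (?ext l) x)" for n x
    by (rule mollify_Re_lower_bound[OF k L2_extension(1)[OF O lL2]])
  then have "m' \<le> Re (Q n x)" for n x by (simp add: Q_def algebra_simps)
  then have Qm: "m' \<le> norm (Q n x)" for n x using complex_Re_le_cmod order_trans by blast
  then have Q0: "Q n x \<noteq> 0" for n x using m'(1) by (metis norm_zero not_le)
  have bm: "AE x in lebesgue_on \<Omega>. m' \<le> norm (b x)"
    using b(3) by eventually_elim (use m' complex_Re_le_cmod in \<open>meson order_trans\<close>)
  have PC: "C_k j (P n)" for j n unfolding P_def by (rule C_k_mollify_kernel[OF k L2_extension(1)[OF O \<phi>(1)]])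
  have lC: "C_k j (mollify (k n) (?ext l))" for j n by (rule C_k_mollify_kernel[OF k L2_extension(1)[OF O lL2]])
  have QC: "C_k j (Q n)" for j n unfolding Q_def[abs_def] by (intro C_k_add C_k_const lC)
  have \<psi>: "C_k 2 (\<lambda>x. P n x / Q n x)" for n by (rule C_k_divide[OF Q0 PC QC])
  have grad: "grad (\<lambda>x. P n x / Q n x) x $ i =
      DP i n x * inverse (Q n x) + - (P n x * DQ i n x * inverse (Q n x) * inverse (Q n x))"
    if x: "x \<in> \<Omega>" for n x i
  proof -
    have 1: "grad (\<lambda>x. P n x / Q n x) x $ i =
      partial_deriv i (P n) x * inverse (Q n x) - P n x * partial_deriv i (Q n) x * inverse (Q n x) * inverse (Q n x)"
      unfolding grad_def using partial_deriv_divide[OF C_k_differentiable[OF PC] C_k_differentiable[OF QC] Q0] by simp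
    have q: "partial_deriv i (Q n) x = partial_deriv i (mollify (k n) (?ext l)) x"
      unfolding Q_def[abs_def] by (rule partial_deriv_const_add[OF C_k_differentiable[OF lC]])
    have 2: "partial_deriv i (P n) x = DP i n x"
    proof (cases "x \<in> ball p s'")
      case True
      show ?thesis unfolding P_def DP_def
        by (rule partial_deriv_mollify_extension[OF O \<phi>(1,3) k inside[OF x True]])
    next
      case False
      have "DP i n x = 0" unfolding DP_def
        by (rule mollify_eq_0[OF smoothing_kernel_zero[OF k]]) (use vanish outside[OF False] in auto)
      moreover have "partial_deriv i (P n) x = 0"
        unfolding P_def partial_deriv_mollify_kernel[OF k L2_extension(1)[OF O \<phi>(1)]]
        by (rule mollify_eq_0[where a = "a n" and r = "\<rho> n"])
          (use vanish outside[OF False] smoothing_kernel_partial_zero[OF k] in auto)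
      ultimately show ?thesis by simp
    qed
    have 3: "P n x * partial_deriv i (Q n) x = P n x * DQ i n x"
    proof (cases "x \<in> ball p s'")
      case True
      then show ?thesis unfolding q DQ_def
        using partial_deriv_mollify_extension[OF O lL2 wl k inside[OF x True], of i] by simp
    next
      case False
      have "P n x = 0" unfolding P_def
        by (rule mollify_eq_0[OF smoothing_kernel_zero[OF k]]) (use vanish outside[OF False] in auto)
      then show ?thesis by simp
    qed
    show ?thesis unfolding 1 2 3 by simp
  qed
  let ?M = "lebesgue_on \<Omega>"
  have LP: "L1_lim ?M (\<lambda>n x. c x $ i * P n x) (\<lambda>x. c x $ i * \<phi> x)" for i
    unfolding P_def by (rule mollification_L1_lim[OF O ci \<phi>(1) k lim])
  have LDP: "L1_lim ?M (\<lambda>n x. c x $ i * DP i n x) (\<lambda>x. c x $ i * G x $ i)" for i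
    unfolding DP_def by (rule mollification_L1_lim[OF O ci Gi k lim])
  have LDQ: "L1_lim ?M (DQ i) (g i)" for i
    using mollification_L1_lim[OF O one gL2 k lim, of i] unfolding DQ_def by simp
  have "L1_lim ?M (\<lambda>n x. 1) (\<lambda>x. 1)" by (simp add: L1_lim_def)
  from L1_lim_add[OF this mollification_L1_lim[OF O one lL2 k lim]]
  have "L1_lim ?M Q b" unfolding Q_def[abs_def] l_def by simp
  then have LI: "L1_lim ?M (\<lambda>n x. inverse (Q n x)) (\<lambda>x. inverse (b x))"
    by (rule L1_lim_inverse[OF _ finite_measure_axioms m'(1) Qm bm])
  have inv: "norm (inverse z) \<le> inverse m'" if "m' \<le> norm z" for z :: complex
    using that m'(1) by (simp add: norm_inverse le_imp_inverse_le)
  have IB: "AE x in ?M. norm (inverse (Q n x)) \<le> inverse m'" for n using Qm inv by simp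
  have Ib: "AE x in ?M. norm (inverse (b x)) \<le> inverse m'" using bm by eventually_elim (rule inv)
  have DQB: "AE x in ?M. norm (DQ i n x) \<le> \<bar>B\<bar>" for i n
  proof (rule AE_I2)
    fix x
    have "AE y in lebesgue. y \<in> \<Omega> \<longrightarrow> norm (g i y) \<le> B"
      using g(2)[of i] O by (simp add: AE_restrict_space_iff)
    then have "AE y in lebesgue. norm (?ext (g i) y) \<le> \<bar>B\<bar>"
      by eventually_elim (auto simp: indicator_def)
    then show "norm (DQ i n x) \<le> \<bar>B\<bar>"
      unfolding DQ_def by (rule mollify_norm_bound[OF k L2_extension(1)[OF O gL2]])
  qed
  have gB: "AE x in ?M. norm (g i x) \<le> \<bar>B\<bar>" for i using g(2)[of i] by eventually_elim simp
  let ?q = "\<lambda>n x. \<Sum>i\<in>UNIV. c x $ i * DP i n x * inverse (Q n x)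
       + - (c x $ i * P n x * DQ i n x * inverse (Q n x) * inverse (Q n x))"
  have L: "L1_lim ?M ?q (quotient_form c b g \<phi> G)"
    unfolding quotient_form_def[abs_def]
    by (intro L1_lim_sum L1_lim_add L1_lim_minus L1_lim_mult[OF _ LI IB Ib] L1_lim_mult[OF _ LDQ DQB gB] LDP LP)
  then show "integrable ?M (quotient_form c b g \<phi> G)" by (simp add: L1_lim_def)
  have q: "?q n x = c x \<bullet>\<^sub>c grad (\<lambda>x. P n x / Q n x) x" if "x \<in> \<Omega>" for n x
    unfolding cdot_def grad[OF that] by (rule sum.cong) (simp_all add: algebra_simps)
  have "(LINT x|?M. ?q n x) = (LINT x|?M. c x \<bullet>\<^sub>c grad (\<lambda>x. P n x / Q n x) x)" for n
    by (rule Bochner_Integration.integral_cong[OF refl], rule q) simp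
  then have "(LINT x|?M. ?q n x) = 0" for n using c(2)[OF \<psi>] by simp
  with L1_lim_integral[OF L] show "(LINT x|?M. quotient_form c b g \<phi> G x) = 0"
    by (simp add: LIMSEQ_const_iff)
qed

text \<open>The quotient form is linear in \<open>(\<phi>, G)\<close>, and the gradients of a partition of unity add up to zero on \<open>\<Omega>\<close>,
so the local identities sum up to the global one.\<close>

lemma quotient_identity:
  fixes c :: "real^3 \<Rightarrow> complex^3" and b \<phi> :: "real^3 \<Rightarrow> complex" and g :: "3 \<Rightarrow> real^3 \<Rightarrow> complex" and G :: "real^3 \<Rightarrow> complex^3"
  assumes O: "open \<Omega>" "bounded \<Omega>" and lip: "lipschitz_boundary \<Omega>"
    and c: "c \<in> L2 \<Omega>" "\<And>\<psi>. C_k 2 \<psi> \<Longrightarrow> (LINT x|lebesgue_on \<Omega>. c x \<bullet>\<^sub>c grad \<psi> x) = 0"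
    and b: "b \<in> borel_measurable (lebesgue_on \<Omega>)" "AE x in lebesgue_on \<Omega>. norm (b x) \<le> B"
      "AE x in lebesgue_on \<Omega>. m \<le> Re (b x)" "0 < m"
    and g: "\<And>i. g i \<in> borel_measurable (lebesgue_on \<Omega>)" "\<And>i. AE x in lebesgue_on \<Omega>. norm (g i x) \<le> B"
      "has_weak_grad \<Omega> b (\<lambda>x. \<chi> i. g i x)"
    and \<phi>: "\<phi> \<in> L2 \<Omega>" "G \<in> L2 \<Omega>" "has_weak_grad \<Omega> \<phi> G"
  shows "(LINT x|lebesgue_on \<Omega>. quotient_form c b g \<phi> G x) = 0"
proof -
  have "\<exists>r e d. 0 < r \<and> 0 < d \<and> (\<forall>x\<in>\<Omega> \<inter> ball p r. \<forall>t>0. \<forall>z\<in>cball e d.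
    x + t *\<^sub>R z \<in> ball p r \<longrightarrow> x + t *\<^sub>R z \<in> \<Omega>)" if "p \<in> closure \<Omega>" for p
    using cone_condition[OF O(1) lip that] by blast
  then obtain r e d where r: "\<And>p. p \<in> closure \<Omega> \<Longrightarrow> 0 < r p" and d: "\<And>p. p \<in> closure \<Omega> \<Longrightarrow> 0 < d p"
    and cone: "\<And>p. p \<in> closure \<Omega> \<Longrightarrow> \<forall>x\<in>\<Omega> \<inter> ball p (r p). \<forall>t>0. \<forall>z\<in>cball (e p) (d p).
    x + t *\<^sub>R z \<in> ball p (r p) \<longrightarrow> x + t *\<^sub>R z \<in> \<Omega>"
    by metis
  have K: "compact (closure \<Omega>)" using O by simp
  have r2: "0 < r p / 2" if "p \<in> closure \<Omega>" for p using r[OF that] by simp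
  have "\<exists>D h. finite D \<and> D \<subseteq> closure \<Omega> \<and> (\<forall>p\<in>D. smooth (h p) \<and> (\<forall>x. x \<notin> ball p (r p / 2) \<longrightarrow> h p x = 0)) \<and>
     (\<forall>x\<in>closure \<Omega>. (\<Sum>p\<in>D. h p x) = (1::real))"
    by (rule smooth_partition_of_unity[OF K]) (rule r2)
  then obtain D h where D: "finite D" "D \<subseteq> closure \<Omega>"
    and h': "\<forall>p\<in>D. smooth (h p) \<and> (\<forall>x. x \<notin> ball p (r p / 2) \<longrightarrow> h p x = 0)"
    and h1: "\<forall>x\<in>closure \<Omega>. (\<Sum>p\<in>D. h p x) = (1::real)"
    by (elim exE conjE)
  have h: "smooth (h p)" "\<And>x. x \<notin> ball p (r p / 2) \<Longrightarrow> h p x = 0" if "p \<in> D" for p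
    using bspec[OF h' that] by blast+
  define H where "H p x = complex_of_real (h p x)" for p x
  have H: "smooth (H p)" if "p \<in> D" for p
    using h(1)[OF that] C_k_bounded_linear[OF bounded_linear_of_real]
    unfolding smooth_def H_def[abs_def] by blast
  have Hd: "H p differentiable (at x)" if "p \<in> D" for p x
    using H[OF that] C_k_differentiable unfolding smooth_def by blast
  have H0: "H p x = 0" if "p \<in> D" "x \<notin> ball p (r p / 2)" for p x
    using h(2)[OF that] by (simp add: H_def)
  \<comment> \<open>The radius is enlarged, because on the boundary of \<open>ball p (r p / 2)\<close> the vanishing of \<open>H p\<close> outside
      does not directly give that of its derivatives.\<close>
  have dH0: "partial_deriv i (H p) x = 0" if p: "p \<in> D" and x: "x \<notin> ball p (3 / 4 * r p)" for p x i
  proof (rule partial_deriv_zero_open[of "- cball p (r p / 2)"])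
    show "x \<in> - cball p (r p / 2)" using x r D(2) p by (force simp: field_simps)
  qed (use H0[OF p] in \<open>auto simp: open_Compl\<close>)
  have H1: "(\<Sum>p\<in>D. H p x) = 1" if "x \<in> \<Omega>" for x
    using bspec[OF h1 subsetD[OF closure_subset that]] by (simp add: H_def of_real_sum[symmetric] del: of_real_sum)
  have dH1: "(\<Sum>p\<in>D. partial_deriv i (H p) x) = 0" if x: "x \<in> \<Omega>" for x i
  proof -
    have "((\<lambda>x. \<Sum>p\<in>D. H p x) has_derivative (\<lambda>v. \<Sum>p\<in>D. frechet_derivative (H p) (at x) v)) (at x)"
      by (rule has_derivative_sum) (use Hd in \<open>simp add: frechet_derivative_works\<close>)
    from partial_deriv_eq[OF this, of i]
    have 1: "partial_deriv i (\<lambda>x. \<Sum>p\<in>D. H p x) x = (\<Sum>p\<in>D. partial_deriv i (H p) x)"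
      by (simp add: frechet_partial)
    have "((\<lambda>x. \<Sum>p\<in>D. H p x) has_derivative (\<lambda>v. 0)) (at x)"
      by (rule has_derivative_transform_within_open[OF has_derivative_const[of 1] O(1) x]) (simp add: H1)
    from partial_deriv_eq[OF this, of i] 1 show ?thesis by simp
  qed
  define \<Phi> where "\<Phi> p x = H p x * \<phi> x" for p x
  define \<Gamma> where "\<Gamma> p x = (\<chi> i. H p x * G x $ i + partial_deriv i (H p) x * \<phi> x)" for p x
  have loc: "integrable (lebesgue_on \<Omega>) (quotient_form c b g (\<Phi> p) (\<Gamma> p))"
    "(LINT x|lebesgue_on \<Omega>. quotient_form c b g (\<Phi> p) (\<Gamma> p) x) = 0" if p: "p \<in> D" for p
  proof -
    have pc: "p \<in> closure \<Omega>" using p D(2) by blast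
    note w = has_weak_grad_smooth_mult[OF O \<phi> H[OF p], folded \<Phi>_def \<Gamma>_def]
    have v1: "\<Phi> p x = 0" if "x \<notin> ball p (3 / 4 * r p)" for x
    proof -
      have "x \<notin> ball p (r p / 2)" using that r[OF pc] by auto
      then show ?thesis using H0[OF p] by (simp add: \<Phi>_def)
    qed
    have v2: "\<Gamma> p x = 0" if "x \<notin> ball p (3 / 4 * r p)" for x
    proof -
      have "x \<notin> ball p (r p / 2)" using that r[OF pc] by auto
      then show ?thesis using H0[OF p] dH0[OF p that] by (simp add: \<Gamma>_def vec_eq_iff)
    qed
    have rr: "3 / 4 * r p < r p" using r[OF pc] by simp
    have cc: "x \<in> \<Omega> \<Longrightarrow> x \<in> ball p (r p) \<Longrightarrow> 0 < t \<Longrightarrow> z \<in> cball (e p) (d p) \<Longrightarrow>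
       x + t *\<^sub>R z \<in> ball p (r p) \<Longrightarrow> x + t *\<^sub>R z \<in> \<Omega>" for x t z
      using cone[OF pc] by blast
    show "integrable (lebesgue_on \<Omega>) (quotient_form c b g (\<Phi> p) (\<Gamma> p))"
      by (rule local_quotient_identity(1)[OF O c b g w v1 v2 rr d[OF pc] cc])
    show "(LINT x|lebesgue_on \<Omega>. quotient_form c b g (\<Phi> p) (\<Gamma> p) x) = 0"
      by (rule local_quotient_identity(2)[OF O c b g w v1 v2 rr d[OF pc] cc])
  qed
  have "quotient_form c b g \<phi> G x = (\<Sum>p\<in>D. quotient_form c b g (\<Phi> p) (\<Gamma> p) x)" if x: "x \<in> \<Omega>" for x
  proof -
    have 1: "(\<Sum>p\<in>D. \<Phi> p x) = \<phi> x"
      unfolding \<Phi>_def by (simp add: sum_distrib_right[symmetric] H1[OF x])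
    have 2: "(\<Sum>p\<in>D. \<Gamma> p x $ i) = G x $ i" for i
      unfolding \<Gamma>_def by (simp add: sum.distrib sum_distrib_right[symmetric] H1[OF x] dH1[OF x])
    have "(\<Sum>p\<in>D. quotient_form c b g (\<Phi> p) (\<Gamma> p) x) =
      (\<Sum>i\<in>UNIV. \<Sum>p\<in>D. c x $ i * \<Gamma> p x $ i * inverse (b x) + - (c x $ i * \<Phi> p x * g i x * inverse (b x) * inverse (b x)))"
      unfolding quotient_form_def by (rule sum.swap)
    also have "\<dots> = (\<Sum>i\<in>UNIV. c x $ i * (\<Sum>p\<in>D. \<Gamma> p x $ i) * inverse (b x)
        + - (c x $ i * (\<Sum>p\<in>D. \<Phi> p x) * g i x * inverse (b x) * inverse (b x)))"
      by (simp add: sum.distrib sum_subtractf sum_distrib_left sum_distrib_right)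
    also have "\<dots> = quotient_form c b g \<phi> G x"
      unfolding 1 2 quotient_form_def ..
    finally show ?thesis ..
  qed
  then have "(LINT x|lebesgue_on \<Omega>. quotient_form c b g \<phi> G x) =
     (LINT x|lebesgue_on \<Omega>. (\<Sum>p\<in>D. quotient_form c b g (\<Phi> p) (\<Gamma> p) x))"
    by (intro Bochner_Integration.integral_cong) auto
  also have "\<dots> = (\<Sum>p\<in>D. (LINT x|lebesgue_on \<Omega>. quotient_form c b g (\<Phi> p) (\<Gamma> p) x))"
    by (rule Bochner_Integration.integral_sum[OF loc(1)])
  also have "\<dots> = 0" using loc(2) by simp
  finally show ?thesis .
qed

section \<open>Regularity of the flux\<close>

text \<open>The quotient identity is the vanishing of the normal trace once the weak divergence \<open>\<delta>\<close> is read off; test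
functions are particular elements of \<open>H1\<close> and confirm \<open>\<delta>\<close>.\<close>

lemma quotient_H0div:
  fixes c :: "real^3 \<Rightarrow> complex^3" and \<mu> :: "real^3 \<Rightarrow> real"
  assumes O: "open \<Omega>" "bounded \<Omega>" and lip: "lipschitz_boundary \<Omega>"
    and c: "c \<in> L2 \<Omega>" "\<And>\<psi>. C_k 2 \<psi> \<Longrightarrow> (LINT x|lebesgue_on \<Omega>. c x \<bullet>\<^sub>c grad \<psi> x) = 0"
    and \<mu>: "\<mu> \<in> W1inf \<Omega>" "ae_bounded_below \<Omega> \<mu>"
  shows "(\<lambda>x. inverse (\<mu> x) *\<^sub>R c x) \<in> H0div \<Omega>"
proof -
  obtain g' where g': "g' \<in> Linf \<Omega>" "has_weak_grad \<Omega> \<mu> g'" and \<mu>L: "\<mu> \<in> Linf \<Omega>"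
    using \<mu>(1) by (auto simp: W1inf_def)
  obtain B1 where B1: "AE x in lebesgue_on \<Omega>. norm (\<mu> x) \<le> B1" and \<mu>m: "\<mu> \<in> borel_measurable (lebesgue_on \<Omega>)"
    using \<mu>L by (auto simp: Linf_def)
  obtain B2 where B2: "AE x in lebesgue_on \<Omega>. norm (g' x) \<le> B2" and gm: "g' \<in> borel_measurable (lebesgue_on \<Omega>)"
    using g'(1) by (auto simp: Linf_def)
  define B where "B = max B1 B2"
  obtain m where m: "0 < m" "AE x in lebesgue_on \<Omega>. m \<le> \<mu> x" using \<mu>(2) by (auto simp: ae_bounded_below_def)
  have gim: "(\<lambda>x. g' x $ i) \<in> borel_measurable (lebesgue_on \<Omega>)" for i
    by (intro measurable_compose[OF gm] borel_measurable_continuous_onI continuous_on_component continuous_on_id)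
  have gib: "AE x in lebesgue_on \<Omega>. \<bar>g' x $ i\<bar> \<le> B" for i
    using B2
  proof eventually_elim
    case (elim x)
    then show ?case using component_le_norm_cart[of "g' x" i] by (simp add: B_def)
  qed
  have \<mu>b: "AE x in lebesgue_on \<Omega>. \<bar>\<mu> x\<bar> \<le> B"
    using B1 by eventually_elim (simp add: B_def)
  define b where "b x = complex_of_real (\<mu> x)" for x
  define g where "g i x = complex_of_real (g' x $ i)" for i x
  have b: "b \<in> borel_measurable (lebesgue_on \<Omega>)" "AE x in lebesgue_on \<Omega>. norm (b x) \<le> B"
      "AE x in lebesgue_on \<Omega>. m \<le> Re (b x)" "0 < m"
    using \<mu>m \<mu>b m by (simp_all add: b_def[abs_def])
  have g: "\<And>i. g i \<in> borel_measurable (lebesgue_on \<Omega>)" "\<And>i. AE x in lebesgue_on \<Omega>. norm (g i x) \<le> B"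
      "has_weak_grad \<Omega> b (\<lambda>x. \<chi> i. g i x)"
    using gim gib has_weak_grad_of_real[OF O \<mu>m \<mu>b gim gib g'(2)] by (simp_all add: b_def[abs_def] g_def[abs_def])
  let ?u = "\<lambda>x. inverse (\<mu> x) *\<^sub>R c x"
  define \<delta> where "\<delta> x = (\<Sum>i\<in>UNIV. - (c x $ i * (g i x * inverse (b x) * inverse (b x))))" for x
  have key: "(LINT x|lebesgue_on \<Omega>. ?u x \<bullet>\<^sub>c G x + \<delta> x * \<phi> x) = 0"
    if "\<phi> \<in> L2 \<Omega>" "G \<in> L2 \<Omega>" "has_weak_grad \<Omega> \<phi> G" for \<phi> G
  proof -
    have "?u x \<bullet>\<^sub>c G x + \<delta> x * \<phi> x = quotient_form c b g \<phi> G x" for x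
      unfolding quotient_form_def \<delta>_def cdot_def b_def sum_distrib_right sum.distrib[symmetric]
      by (rule sum.cong) (simp_all add: scaleR_conv_of_real[where 'a = complex] of_real_inverse mult_ac)
    then show ?thesis using quotient_identity[OF O lip c b g that] by simp
  qed
  have invb: "AE x in lebesgue_on \<Omega>. norm (inverse (b x)) \<le> inverse m"
    using m(2) by eventually_elim (use m(1) in \<open>simp add: b_def norm_inverse le_imp_inverse_le\<close>)
  have "(\<lambda>x. c x $ i * (g i x * inverse (b x) * inverse (b x))) \<in> L2 \<Omega>" for i
  proof (rule L2_bounded_mult[where B = "B * inverse m * inverse m"])
    show "(\<lambda>x. c x $ i) \<in> L2 \<Omega>" using c(1) L2_vec_iff by blast
    show "(\<lambda>x. g i x * inverse (b x) * inverse (b x)) \<in> borel_measurable (lebesgue_on \<Omega>)"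
      using g(1)[of i] b(1) by measurable
    show "AE x in lebesgue_on \<Omega>. norm (g i x * inverse (b x) * inverse (b x)) \<le> B * inverse m * inverse m"
      using g(2)[of i] invb
    proof eventually_elim
      case (elim x)
      have "0 \<le> B" using elim(1) norm_ge_zero order_trans by blast
      then show ?case unfolding norm_mult using elim m(1) by (intro mult_mono) auto
    qed
  qed
  then have \<delta>i: "(\<lambda>x. - (c x $ i * (g i x * inverse (b x) * inverse (b x)))) \<in> L2 \<Omega>" for i by (rule L2_minus)
  have \<delta>: "\<delta> \<in> L2 \<Omega>"
    unfolding \<delta>_def[abs_def] sum_3 by (intro L2_add \<delta>i)
  obtain C where C: "AE x in lebesgue_on \<Omega>. \<bar>inverse (\<mu> x)\<bar> \<le> C"
    using coefficient_inverse_bounded(1)[OF \<mu>(2) \<mu>m] by blast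
  have u: "?u \<in> L2 \<Omega>"
    by (rule bounded_coefficient_L2[OF c(1) coefficient_inverse_bounded(2)[OF \<mu>(2) \<mu>m] C])
  have div: "has_weak_div \<Omega> ?u \<delta>"
    unfolding has_weak_div_def
  proof
    fix \<theta> :: "real^3 \<Rightarrow> complex" assume t: "\<theta> \<in> test_functions \<Omega>"
    note C1 = test_functions_C_k[OF t, of 1]
    note L = C1_grad_L2[OF O C1]
    have "0 = (LINT x|lebesgue_on \<Omega>. ?u x \<bullet>\<^sub>c grad \<theta> x + \<delta> x * \<theta> x)"
      using key[OF L C1_has_weak_grad[OF O C1]] by simp
    also have "\<dots> = (LINT x|lebesgue_on \<Omega>. ?u x \<bullet>\<^sub>c grad \<theta> x) + (LINT x|lebesgue_on \<Omega>. \<delta> x * \<theta> x)"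
      by (rule Bochner_Integration.integral_add[OF L2_cdot_integrable[OF u L(2)] L2_mult_integrable[OF \<delta> L(1)]])
    finally show "(LINT x|lebesgue_on \<Omega>. ?u x \<bullet>\<^sub>c grad \<theta> x) = - (LINT x|lebesgue_on \<Omega>. \<delta> x * \<theta> x)"
      by (simp add: eq_neg_iff_add_eq_0)
  qed
  have H: "?u \<in> Hdiv \<Omega>" using u \<delta> div by (auto simp: Hdiv_def)
  have ae: "AE x in lebesgue_on \<Omega>. weak_div \<Omega> ?u x = \<delta> x"
    by (rule weak_div_unique[OF O weak_div_spec[OF H] \<delta> div])
  have "normal_trace \<Omega> ?u \<phi> = 0" if p: "\<phi> \<in> H1 \<Omega>" for \<phi>
  proof -
    note G = weak_grad_spec[OF p]
    have pL2: "\<phi> \<in> L2 \<Omega>" using p by (simp add: H1_def)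
    have "normal_trace \<Omega> ?u \<phi> = (LINT x|lebesgue_on \<Omega>. ?u x \<bullet>\<^sub>c weak_grad \<Omega> \<phi> x + \<delta> x * \<phi> x)"
      unfolding normal_trace_def
    proof (rule integral_cong_AE)
      show "AE x in lebesgue_on \<Omega>. ?u x \<bullet>\<^sub>c weak_grad \<Omega> \<phi> x + weak_div \<Omega> ?u x * \<phi> x =
         ?u x \<bullet>\<^sub>c weak_grad \<Omega> \<phi> x + \<delta> x * \<phi> x"
        using ae by eventually_elim simp
    qed (intro borel_measurable_add borel_measurable_integrable[OF L2_cdot_integrable[OF u G(1)]]
        borel_measurable_integrable[OF L2_mult_integrable[OF weak_div_spec(1)[OF H] pL2]]
        borel_measurable_integrable[OF L2_mult_integrable[OF \<delta> pL2]])+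
    then show ?thesis using key[OF pL2 G] by simp
  qed
  then show ?thesis using H by (simp add: H0div_def)
qed

theorem theorem3p15:
  fixes \<Omega> :: "(real^3) set"
    and \<mu> \<kappa> :: "real^3 \<Rightarrow> real"
    and \<omega> :: real
    and f w :: "real^3 \<Rightarrow> complex^3"
  assumes "polyhedral_domain \<Omega>" and "lipschitz_boundary \<Omega>"
    and "\<omega> \<noteq> 0"
    and "\<mu> \<in> W1inf \<Omega>" and "\<kappa> \<in> W1inf \<Omega>"
    and "ae_bounded_below \<Omega> \<mu>" and "ae_bounded_below \<Omega> \<kappa>"
    and "f \<in> L2 \<Omega>"
    and "adjoint_solution \<Omega> \<mu> \<kappa> \<omega> f w"
  shows "(\<lambda>x. inverse (\<mu> x) *\<^sub>R weak_curl \<Omega> w x) \<in> Hcurl \<Omega> \<inter> H0div \<Omega>"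
proof
  have O: "open \<Omega>" "bounded \<Omega>" using assms(1) by (auto simp: polyhedral_domain_def)
  have w: "w \<in> H0curl \<Omega>" using assms(9) by (simp add: adjoint_solution_def)
  note wL2 = Hcurl_L2[OF H0curl_Hcurl[OF w]]
  note c = weak_curl_spec(1)[OF H0curl_Hcurl[OF w]]
  let ?u = "\<lambda>x. inverse (\<mu> x) *\<^sub>R weak_curl \<Omega> w x"
  show div: "?u \<in> H0div \<Omega>"
    by (rule quotient_H0div[OF O assms(2) c weak_curl_orthogonal_grad[OF O w] assms(4,6)])
  then have u: "?u \<in> L2 \<Omega>" by (simp add: H0div_def Hdiv_def)
  obtain B where B: "AE x in lebesgue_on \<Omega>. \<bar>\<kappa> x\<bar> \<le> B" using W1inf_bounded(2)[OF assms(5)] by blast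
  have kw: "(\<lambda>x. \<kappa> x *\<^sub>R w x) \<in> L2 \<Omega>"
    by (rule bounded_coefficient_L2[OF wL2 W1inf_bounded(1)[OF assms(5)] B])
  let ?r = "\<lambda>x. \<chi> i. f x $ i + \<i> * of_real \<omega> * (\<kappa> x *\<^sub>R w x) $ i"
  have r: "?r \<in> L2 \<Omega>"
  proof -
    have "(\<lambda>x. f x $ i) \<in> L2 \<Omega>" "(\<lambda>x. (\<kappa> x *\<^sub>R w x) $ i) \<in> L2 \<Omega>" for i
      by (rule assms(8)[unfolded L2_vec_iff, rule_format], rule kw[unfolded L2_vec_iff, rule_format])
    then show ?thesis
      unfolding L2_vec_iff vec_lambda_beta by (intro allI L2_add L2_cmult)
  qed
  show "?u \<in> Hcurl \<Omega>"
    using u r adjoint_solution_flux_weak_curl[OF O u kw assms(8,9)] unfolding Hcurl_def by blast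
qed

end
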